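(* The convex bodies of revolution satisfy the KLS conjecture: there exists a universal constant $C$ such that for every $n\ge1$ and every isotropic convex body of revolution $K\subset\mathbb{R}^{n+1}$, $$C_{\mathrm P}(\mu_K)\le C\,\frac{\mathrm{E}_{\mu_K}|X|^2}{n+1}.$$
   Context: $|\cdot|$ is the Euclidean norm and $\langle\cdot,\cdot\rangle$ the Euclidean scalar product; $\mathbb{R}^+=[0,\infty)$. A convex body is a compact convex set with non-empty interior; $\mu_K$ is the uniform probability measure on $K$, and $\mathrm{E}_{\mu_K}$ is expectation for $X$ of law $\mu_K$. A convex body of revolution in $\mathbb{R}^{n+1}$ is (up to a choice of orthonormal coordinates) a convex body of the form $K=\{(t,x)\in I\times\mathbb{R}^n:\ |x|\le R(t)\}$, where $I$ is a bounded interval of $\mathbb{R}$ and $R:I\to\mathbb{R}^+$ is a concave function. A convex body $K\subset\mathbb{R}^m$ is isotropic if its barycenter $\int x\,d\mu_K(x)$ is $0$ and $\int\langle x,\theta\rangle^2d\mu_K(x)$ is constant over the unit vectors $\theta\in\mathbb{S}^{m-1}$ (the constant is not required to be $1$). The Poincaré constant $C_{\mathrm P}(\mu)$ is the best constant $A$ such that $\mathrm{Var}_\mu f\le A\int|\nabla f|^2\,d\mu$ for every smooth function $f$, where $\mathrm{Var}_\mu f=\int\big(f-\int f\,d\mu\big)^2d\mu$. "Universal" means independent of $n$ and $K$. *)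

theory Defs
  imports "HOL-Analysis.Analysis"
begin

text \<open>
  The ambient dimension is quantified inside the statements, so \<open>\<real>\<^sup>m\<close> is not the type
  \<open>real ^ 'm\<close> but the set of functions \<open>nat \<Rightarrow> real\<close> that are \<^const>\<open>undefined\<close> from \<open>m\<close> on.
  It is both the carrier of the product topology \<open>powertop_real {..<m}\<close> and the space of the
  product measure \<open>\<Pi>\<^sub>M i\<in>{..<m}. lborel\<close>, i.e. Lebesgue measure.  The Euclidean norm of \<open>x\<close> is
  \<open>L2_set x {..<m}\<close>.
\<close>

definition Rn :: "nat \<Rightarrow> (nat \<Rightarrow> real) set" where
  "Rn m = ({..<m} \<rightarrow>\<^sub>E UNIV)"

definition scalar_product :: "nat \<Rightarrow> (nat \<Rightarrow> real) \<Rightarrow> (nat \<Rightarrow> real) \<Rightarrow> real" where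
  "scalar_product m x y = (\<Sum>i<m. x i * y i)"

definition lebesgue_Rn :: "nat \<Rightarrow> (nat \<Rightarrow> real) measure" where
  "lebesgue_Rn m = (\<Pi>\<^sub>M i\<in>{..<m}. lborel)"

text \<open>\<^const>\<open>convex\<close> is not available, as \<open>nat \<Rightarrow> real\<close> is not an instance of
  \<^class>\<open>real_vector\<close>.\<close>

definition convex_Rn :: "nat \<Rightarrow> (nat \<Rightarrow> real) set \<Rightarrow> bool" where
  "convex_Rn m K \<longleftrightarrow> K \<subseteq> Rn m \<and>
     (\<forall>x\<in>K. \<forall>y\<in>K. \<forall>u\<ge>0. \<forall>v\<ge>0. u + v = 1 \<longrightarrow> (\<lambda>i\<in>{..<m}. u * x i + v * y i) \<in> K)"

definition convex_body :: "nat \<Rightarrow> (nat \<Rightarrow> real) set \<Rightarrow> bool" where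
  "convex_body m K \<longleftrightarrow> convex_Rn m K \<and> compactin (powertop_real {..<m}) K \<and>
     (powertop_real {..<m}) interior_of K \<noteq> {}"

definition uniform_prob :: "nat \<Rightarrow> (nat \<Rightarrow> real) set \<Rightarrow> (nat \<Rightarrow> real) measure" where
  "uniform_prob m K = uniform_measure (lebesgue_Rn m) K"

definition orthonormal_basis :: "nat \<Rightarrow> (nat \<Rightarrow> nat \<Rightarrow> real) \<Rightarrow> bool" where
  "orthonormal_basis m e \<longleftrightarrow> (\<forall>j<m. e j \<in> Rn m) \<and>
     (\<forall>j<m. \<forall>k<m. scalar_product m (e j) (e k) = (if j = k then 1 else 0))"

text \<open>The coordinates of \<open>z\<close> in the basis \<open>e\<close> are \<open>scalar_product (n + 1) z (e j)\<close>; the coordinate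
  along \<open>e 0\<close> is the \<open>t\<close> of a point \<open>(t, x) \<in> \<real> \<times> \<real>\<^sup>n\<close>, the \<open>n\<close> other ones are those of \<open>x\<close>.\<close>

definition convex_body_of_revolution :: "nat \<Rightarrow> (nat \<Rightarrow> real) set \<Rightarrow> bool" where
  "convex_body_of_revolution n K \<longleftrightarrow> convex_body (n + 1) K \<and>
     (\<exists>e I R. orthonormal_basis (n + 1) e \<and>
        is_interval I \<and> bounded I \<and> (\<forall>t\<in>I. 0 \<le> R t) \<and> concave_on I R \<and>
        K = {z \<in> Rn (n + 1). scalar_product (n + 1) z (e 0) \<in> I \<and>
               L2_set (\<lambda>j. scalar_product (n + 1) z (e j)) {1..n}
                 \<le> R (scalar_product (n + 1) z (e 0))})"

definition isotropic :: "nat \<Rightarrow> (nat \<Rightarrow> real) set \<Rightarrow> bool" where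
  "isotropic m K \<longleftrightarrow> convex_body m K \<and>
     (\<forall>i<m. (LINT x|uniform_prob m K. x i) = 0) \<and>
     (\<exists>c. \<forall>\<theta>\<in>Rn m. L2_set \<theta> {..<m} = 1 \<longrightarrow>
        (LINT x|uniform_prob m K. (scalar_product m x \<theta>)\<^sup>2) = c)"

definition partial_deriv :: "nat \<Rightarrow> ((nat \<Rightarrow> real) \<Rightarrow> real) \<Rightarrow> (nat \<Rightarrow> real) \<Rightarrow> real" where
  "partial_deriv i f x = deriv (\<lambda>s. f (x(i := s))) (x i)"

text \<open>\<open>f\<close> is of class \<open>C\<^sup>k\<close> on \<open>\<real>\<^sup>m\<close>: its partial derivatives up to order \<open>k\<close> exist and
  are continuous.\<close>

primrec C_k :: "nat \<Rightarrow> nat \<Rightarrow> ((nat \<Rightarrow> real) \<Rightarrow> real) \<Rightarrow> bool" where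
  "C_k m 0 f \<longleftrightarrow> continuous_map (powertop_real {..<m}) euclideanreal f"
| "C_k m (Suc k) f \<longleftrightarrow> continuous_map (powertop_real {..<m}) euclideanreal f \<and>
     (\<forall>i<m. (\<forall>x\<in>Rn m. (\<lambda>s. f (x(i := s))) field_differentiable (at (x i))) \<and>
            C_k m k (partial_deriv i f))"

definition smooth :: "nat \<Rightarrow> ((nat \<Rightarrow> real) \<Rightarrow> real) \<Rightarrow> bool" where
  "smooth m f \<longleftrightarrow> (\<forall>k. C_k m k f)"

definition grad :: "nat \<Rightarrow> ((nat \<Rightarrow> real) \<Rightarrow> real) \<Rightarrow> (nat \<Rightarrow> real) \<Rightarrow> nat \<Rightarrow> real" where
  "grad m f x = (\<lambda>i\<in>{..<m}. partial_deriv i f x)"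

definition Var :: "(nat \<Rightarrow> real) measure \<Rightarrow> ((nat \<Rightarrow> real) \<Rightarrow> real) \<Rightarrow> real" where
  "Var \<mu> f = (LINT x|\<mu>. (f x - (LINT y|\<mu>. f y))\<^sup>2)"

text \<open>Meant for \<open>\<mu>\<close> a compactly supported probability measure on \<open>\<real>\<^sup>m\<close>, for which all the integrals
  below converge.  The infimum is in \<^typ>\<open>ereal\<close>, so that it is \<open>\<infinity>\<close> when no
  constant is admissible.\<close>

definition poincare_constant :: "nat \<Rightarrow> (nat \<Rightarrow> real) measure \<Rightarrow> ereal" where
  "poincare_constant m \<mu> = Inf (ereal ` {A. \<forall>f. smooth m f \<longrightarrow>
     Var \<mu> f \<le> A * (LINT x|\<mu>. (L2_set (grad m f x) {..<m})\<^sup>2)})"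

end

theory Submission
  imports Defs "HOL-Probability.Probability"
begin

text \<open>
  Let \<open>K = {(t, x). |x| \<le> R t}\<close> with \<open>R\<close> concave.  The proof writes the uniform law of \<open>K\<close> as the
  image of a product of one-dimensional laws and adds up one-dimensional inequalities.

  The first variable is \<open>t\<close>, with density proportional to \<open>R\<^sup>n\<close>.  In the cross-section take \<open>n\<close>
  Gaussian variables \<open>z\<^sub>j\<close> with density proportional to \<open>exp (- s\<^sup>2)\<close> and an exponential variable
  \<open>\<rho>\<close>, all independent.  With \<open>q = |z|\<^sup>2 + \<rho>\<close>, the vector \<open>y = z / sqrt q\<close> is uniform in the unit
  ball and independent of \<open>q\<close>; so \<open>(t, R t \<cdot> y)\<close> is uniform in \<open>K\<close>.  By the Efron--Stein inequality
  (\<open>osc_pair\<close>, \<open>osc_PiM\<close>) the variance of a function of \<open>(t, z, \<rho>)\<close> is controlled by its oscillation in each single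
  variable, and these all come from one Hardy inequality (\<open>weighted_hardy\<close>), in which the derivative is
  multiplied by a bound \<open>w\<close> for the quotient of tail and density.

  \<^item> Variable \<open>t\<close>.  The derivative of \<open>f (t, R t \<cdot> y)\<close> is at most \<open>sqrt (1 + R'\<^sup>2) |\<nabla>f|\<close>, and \<open>R'\<close> can be
    large.  But where \<open>R\<close> is steep the tail is small: the profile lies below its tangent, which
    gives tail \<open>/\<close> density \<open>\<le> R / ((n + 1) |R'|)\<close>.  Since \<open>R\<^sup>n\<close> is log-concave, one also has
    tail \<open>/\<close> density \<open>\<le> 8 \<sigma>\<close> with \<open>\<sigma>\<^sup>2 = E t\<^sup>2\<close>.  Hence \<open>w\<^sup>2 (1 + R'\<^sup>2) \<le> 64 \<sigma>\<^sup>2 + (max R / (n + 1))\<^sup>2\<close>.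
  \<^item> Variables \<open>z\<^sub>j\<close>.  The derivatives are \<open>R / sqrt q\<close> times the components across the axis of
    \<open>\<nabla>f - \<langle>y, \<nabla>f\<rangle> y\<close>, and their squares add up to at most \<open>R\<^sup>2 |\<nabla>f|\<^sup>2 / q\<close>.
  \<^item> Variable \<open>\<rho>\<close>.  The exponential law allows the weight \<open>w\<^sup>2 = 9 \<rho> \<le> 9 q\<close>, which turns the square of the
    derivative \<open>R \<langle>y, \<nabla>f\<rangle> / (2 q)\<close> into a multiple of \<open>R\<^sup>2 |\<nabla>f|\<^sup>2 / q\<close>.

  As \<open>q\<close> is independent of \<open>y\<close> and \<open>E (1 / q) = 2 / n\<close>, the last two items cost
  \<open>200 (max R)\<^sup>2 / n\<close>.  Finally let \<open>c\<close> be the second moment of \<open>K\<close> in every direction.  The axis gives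
  \<open>\<sigma>\<^sup>2 = c\<close>; the other directions give \<open>n c = E R\<^sup>2 E |y|\<^sup>2 \<ge> E R\<^sup>2 / 8\<close>, and \<open>(max R)\<^sup>2 \<le> 12 E R\<^sup>2\<close> by concavity, so
  \<open>(max R)\<^sup>2 \<le> 96 n c\<close>.  Every term is then a constant times \<open>c = E |X|\<^sup>2 / (n + 1)\<close>.
\<close>

section \<open>The Efron--Stein inequality\<close>

text \<open>Twice the variance.  As an iterated integral of a nonnegative function it can be estimated under
  further integrals, one variable at a time.\<close>

definition osc :: "'a measure \<Rightarrow> ('a \<Rightarrow> real) \<Rightarrow> ennreal" where
  "osc M g = (\<integral>\<^sup>+x. \<integral>\<^sup>+y. ennreal ((g x - g y)\<^sup>2) \<partial>M \<partial>M)"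

lemma quadrilateral_inequality:
  fixes p q r s :: real
  shows "(p - r)\<^sup>2 + (q - s)\<^sup>2 \<le> (p - q)\<^sup>2 + (q - r)\<^sup>2 + (r - s)\<^sup>2 + (s - p)\<^sup>2"
proof -
  have "(p - q)\<^sup>2 + (q - r)\<^sup>2 + (r - s)\<^sup>2 + (s - p)\<^sup>2 - (p - r)\<^sup>2 - (q - s)\<^sup>2 = (p - q + r - s)\<^sup>2"
    by (simp add: power2_eq_square algebra_simps)
  then show ?thesis
    by (smt (verit) zero_le_power2)
qed

text \<open>For four points \<open>(x, a)\<close>, \<open>(x, b)\<close>, \<open>(y, b)\<close>, \<open>(y, a)\<close> the values of \<open>g\<close> form a quadrilateral: the
  diagonals compare independent pairs \<open>(x, a)\<close> and \<open>(y, b)\<close>, while along each side one variable is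
  fixed.  Integrating \<open>quadrilateral_inequality\<close> gives Efron--Stein for two factors, with constant one.\<close>

lemma osc_pair:
  assumes "prob_space M" "prob_space N"
    and g: "(\<lambda>(x, a). g x a) \<in> borel_measurable (M \<Otimes>\<^sub>M N)"
  shows "(\<integral>\<^sup>+x. \<integral>\<^sup>+a. \<integral>\<^sup>+y. \<integral>\<^sup>+b. ennreal ((g x a - g y b)\<^sup>2) \<partial>N \<partial>M \<partial>N \<partial>M)
    \<le> (\<integral>\<^sup>+a. osc M (\<lambda>x. g x a) \<partial>N) + (\<integral>\<^sup>+x. osc N (g x) \<partial>M)"
proof -
  interpret M: prob_space M by fact
  interpret N: prob_space N by fact
  interpret P: pair_prob_space M N ..
  have MN: "g (u z) (v z) = (\<lambda>(x, a). g x a) (u z, v z)" for u v and z :: 'z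
    by simp
  have meas[measurable]: "(\<lambda>z. g (u z) (v z)) \<in> borel_measurable L"
    if [measurable]: "u \<in> measurable L M" "v \<in> measurable L N" for u v and L :: "'z measure"
    unfolding MN by (rule measurable_compose[OF _ g]) measurable
  let ?e = "\<lambda>p q :: real. ennreal ((p - q)\<^sup>2)"
  let ?L = "\<integral>\<^sup>+x. \<integral>\<^sup>+a. \<integral>\<^sup>+y. \<integral>\<^sup>+b. ?e (g x a) (g y b) \<partial>N \<partial>M \<partial>N \<partial>M"
  let ?X = "\<integral>\<^sup>+a. \<integral>\<^sup>+x. \<integral>\<^sup>+y. ?e (g x a) (g y a) \<partial>M \<partial>M \<partial>N"
  let ?A = "\<integral>\<^sup>+x. \<integral>\<^sup>+a. \<integral>\<^sup>+b. ?e (g x a) (g x b) \<partial>N \<partial>N \<partial>M"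
  have pointwise: "?e (g x a) (g y b) + ?e (g x b) (g y a)
      \<le> ?e (g x a) (g x b) + ?e (g x b) (g y b) + ?e (g y a) (g y b) + ?e (g x a) (g y a)"
    for x a y b
    using quadrilateral_inequality[of "g x a" "g y b" "g x b" "g y a"]
    by (simp add: power2_commute flip: ennreal_plus)
  \<comment> \<open>Every side and both diagonals of the quadrilateral integrate to one of three quantities.\<close>
  let ?I = "\<lambda>F. \<integral>\<^sup>+x. \<integral>\<^sup>+y. \<integral>\<^sup>+a. \<integral>\<^sup>+b. F x y a b \<partial>N \<partial>N \<partial>M \<partial>M"
  have swap: "(\<integral>\<^sup>+x. \<integral>\<^sup>+a. \<integral>\<^sup>+y. \<integral>\<^sup>+b. ?e (g x a) (g y b) \<partial>N \<partial>M \<partial>N \<partial>M)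
    = ?I (\<lambda>x y a b. ?e (g x a) (g y b))"
    by (intro nn_integral_cong P.Fubini') measurable
  have L2: "?I (\<lambda>x y a b. ?e (g x b) (g y a)) = ?L"
    unfolding swap by (intro nn_integral_cong pair_sigma_finite.Fubini') (unfold_locales, measurable)
  have A1: "?I (\<lambda>x y a b. ?e (g x a) (g x b)) = ?A"
    by (simp add: M.emeasure_space_1)
  have A2: "?I (\<lambda>x y a b. ?e (g y a) (g y b)) = ?A"
    by (simp add: M.emeasure_space_1)
  have X1: "?I (\<lambda>x y a b. ?e (g x a) (g y a)) = ?X"
  proof -
    have "?I (\<lambda>x y a b. ?e (g x a) (g y a)) = (\<integral>\<^sup>+x. \<integral>\<^sup>+y. \<integral>\<^sup>+a. ?e (g x a) (g y a) \<partial>N \<partial>M \<partial>M)"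
      by (simp add: N.emeasure_space_1)
    also have "\<dots> = (\<integral>\<^sup>+x. \<integral>\<^sup>+a. \<integral>\<^sup>+y. ?e (g x a) (g y a) \<partial>M \<partial>N \<partial>M)"
      by (intro nn_integral_cong P.Fubini'[symmetric]) measurable
    also have "\<dots> = ?X"
      by (intro P.Fubini'[symmetric]) measurable
    finally show ?thesis .
  qed
  have X2: "?I (\<lambda>x y a b. ?e (g x b) (g y b)) = ?X"
    unfolding X1[symmetric]
    by (simp add: N.emeasure_space_1)
  \<comment> \<open>Additivity of the fourfold integral, stated once for jointly measurable integrands.\<close>
  have I_add: "?I (\<lambda>x y a b. F x y a b + G x y a b) = ?I F + ?I G"
    if F: "(\<lambda>z. F (fst (fst (fst z))) (snd (fst (fst z))) (snd (fst z)) (snd z)) \<in> borel_measurable (((M \<Otimes>\<^sub>M M) \<Otimes>\<^sub>M N) \<Otimes>\<^sub>M N)"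
      and G: "(\<lambda>z. G (fst (fst (fst z))) (snd (fst (fst z))) (snd (fst z)) (snd z)) \<in> borel_measurable (((M \<Otimes>\<^sub>M M) \<Otimes>\<^sub>M N) \<Otimes>\<^sub>M N)" for F G
  proof -
    have meas4: "(\<lambda>z. H (u z) (v z) (w z) (k z)) \<in> borel_measurable L"
      if H: "(\<lambda>z. H (fst (fst (fst z))) (snd (fst (fst z))) (snd (fst z)) (snd z)) \<in> borel_measurable (((M \<Otimes>\<^sub>M M) \<Otimes>\<^sub>M N) \<Otimes>\<^sub>M N)"
        and [measurable]: "u \<in> measurable L M" "v \<in> measurable L M" "w \<in> measurable L N" "k \<in> measurable L N"
      for H u v w k and L :: "'z measure"
    proof -
      have "(\<lambda>z. H (u z) (v z) (w z) (k z)) =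
          (\<lambda>z. H (fst (fst (fst z))) (snd (fst (fst z))) (snd (fst z)) (snd z)) \<circ> (\<lambda>z. (((u z, v z), w z), k z))"
        by auto
      also have "\<dots> \<in> borel_measurable L"
        by (rule measurable_comp[OF _ H]) measurable
      finally show ?thesis .
    qed
    note [measurable] = meas4[OF F] meas4[OF G]
    have "?I (\<lambda>x y a b. F x y a b + G x y a b)
      = (\<integral>\<^sup>+x. \<integral>\<^sup>+y. \<integral>\<^sup>+a. (\<integral>\<^sup>+b. F x y a b \<partial>N) + (\<integral>\<^sup>+b. G x y a b \<partial>N) \<partial>N \<partial>M \<partial>M)"
      by (intro nn_integral_cong nn_integral_add) measurable
    also have "\<dots> = (\<integral>\<^sup>+x. \<integral>\<^sup>+y. (\<integral>\<^sup>+a. \<integral>\<^sup>+b. F x y a b \<partial>N \<partial>N) + (\<integral>\<^sup>+a. \<integral>\<^sup>+b. G x y a b \<partial>N \<partial>N) \<partial>M \<partial>M)"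
      by (intro nn_integral_cong nn_integral_add) measurable
    also have "\<dots> = (\<integral>\<^sup>+x. (\<integral>\<^sup>+y. \<integral>\<^sup>+a. \<integral>\<^sup>+b. F x y a b \<partial>N \<partial>N \<partial>M) + (\<integral>\<^sup>+y. \<integral>\<^sup>+a. \<integral>\<^sup>+b. G x y a b \<partial>N \<partial>N \<partial>M) \<partial>M)"
      by (intro nn_integral_cong nn_integral_add) measurable
    also have "\<dots> = ?I F + ?I G"
      by (intro nn_integral_cong nn_integral_add) measurable
    finally show ?thesis .
  qed
  have "?I (\<lambda>x y a b. ?e (g x a) (g y b) + ?e (g x b) (g y a))
      \<le> ?I (\<lambda>x y a b. ?e (g x a) (g x b) + ?e (g x b) (g y b) + ?e (g y a) (g y b) + ?e (g x a) (g y a))"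
    by (intro nn_integral_mono pointwise)
  then have "?L + ?L \<le> ?A + ?X + ?A + ?X"
    \<comment> \<open>Three sums on the right are split before the one on the left.\<close>
    apply (subst (asm) (2) I_add, measurable)
    apply (subst (asm) (2) I_add, measurable)
    apply (subst (asm) (2) I_add, measurable)
    apply (subst (asm) I_add, measurable)
    unfolding swap[symmetric] L2 A1 A2 X1 X2 apply assumption
    done
  then have "2 * ?L \<le> 2 * (?X + ?A)"
    by (simp add: mult_2 add_ac)
  then show ?thesis
    unfolding osc_def by (subst (asm) ennreal_mult_le_mult_iff) auto
qed

text \<open>Induction on \<open>I\<close> with \<open>osc_pair\<close>.  A term that resamples coordinate \<open>j\<close> and then averages over all other
  coordinates is the same for \<open>I\<close> and for \<open>insert i I\<close>, since the factors have mass one.\<close>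

lemma osc_PiM:
  assumes "finite I" "\<And>i. prob_space (M i)" "g \<in> borel_measurable (PiM I M)"
  shows "osc (PiM I M) g \<le> (\<Sum>i\<in>I. \<integral>\<^sup>+x. osc (M i) (\<lambda>a. g (x(i := a))) \<partial>PiM I M)"
  using assms(1,3)
proof (induction I arbitrary: g rule: finite_induct)
  case empty
  then show ?case by (simp add: osc_def space_PiM_empty nn_integral_count_space_finite PiM_empty)
next
  case (insert i I)
  interpret product_prob_space M by (rule product_prob_spaceI) (rule assms)
  note insert.hyps(1)[simp] insert.prems[measurable]
  have PI: "prob_space (PiM I M)" by (rule prob_space_PiM) (rule assms)
  interpret PI: prob_space "PiM I M" by fact
  interpret P: pair_prob_space "PiM I M" "M i" ..
  have upd_in: "(\<lambda>z. (u z)(j := v z)) \<in> measurable L (PiM J M)"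
    if "j \<in> J" "u \<in> measurable L (PiM J M)" "v \<in> measurable L (M j)" for u v j J and L :: "'z measure"
  proof (rule measurable_fun_upd)
    show "J = J \<union> {j}" using that(1) by blast
  qed (rule that)+
  have upd: "(\<lambda>(x, a). g (x(i := a))) \<in> borel_measurable (PiM I M \<Otimes>\<^sub>M M i)"
    by measurable
  have split: "(\<integral>\<^sup>+x. f x \<partial>PiM (insert i I) M) = (\<integral>\<^sup>+x. \<integral>\<^sup>+a. f (x(i := a)) \<partial>M i \<partial>PiM I M)"
    if "f \<in> borel_measurable (PiM (insert i I) M)" for f
    by (rule product_nn_integral_insert) (use insert that in auto)
  have step1: "osc (PiM (insert i I) M) g
     = (\<integral>\<^sup>+x. \<integral>\<^sup>+a. \<integral>\<^sup>+y. \<integral>\<^sup>+b. ennreal ((g (x(i := a)) - g (y(i := b)))\<^sup>2) \<partial>M i \<partial>PiM I M \<partial>M i \<partial>PiM I M)"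
    unfolding osc_def by (subst split, measurable)+
  have step2: "\<dots> \<le> (\<integral>\<^sup>+a. osc (PiM I M) (\<lambda>x. g (x(i := a))) \<partial>M i) + (\<integral>\<^sup>+x. osc (M i) (\<lambda>a. g (x(i := a))) \<partial>PiM I M)"
    by (rule osc_pair[OF PI _ upd]) (rule assms)
  have [measurable]: "(\<lambda>z. (u z)(i := v z)) \<in> measurable L (PiM (insert i I) M)"
    if "u \<in> measurable L (PiM (insert i I) M)" "v \<in> measurable L (M i)" for u v and L :: "'z measure"
    using that by (intro upd_in) auto
  have step3: "(\<integral>\<^sup>+x. osc (M i) (\<lambda>a. g (x(i := a))) \<partial>PiM I M) = (\<integral>\<^sup>+x. osc (M i) (\<lambda>a. g (x(i := a))) \<partial>PiM (insert i I) M)"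
    unfolding osc_def by (subst split) (measurable, simp add: M.emeasure_space_1)
  have "(\<integral>\<^sup>+a. osc (PiM I M) (\<lambda>x. g (x(i := a))) \<partial>M i)
      \<le> (\<integral>\<^sup>+a. (\<Sum>j\<in>I. \<integral>\<^sup>+x. osc (M j) (\<lambda>b. g (x(j := b, i := a))) \<partial>PiM I M) \<partial>M i)"
    by (intro nn_integral_mono insert.IH measurable_compose[OF _ insert.prems] measurable_fun_upd) auto
  also have "\<dots> = (\<Sum>j\<in>I. \<integral>\<^sup>+x. osc (M j) (\<lambda>b. g (x(j := b))) \<partial>PiM (insert i I) M)"
  proof -
    have "(\<integral>\<^sup>+a. (\<Sum>j\<in>I. \<integral>\<^sup>+x. osc (M j) (\<lambda>b. g (x(j := b, i := a))) \<partial>PiM I M) \<partial>M i)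
      = (\<Sum>j\<in>I. \<integral>\<^sup>+a. \<integral>\<^sup>+x. osc (M j) (\<lambda>b. g (x(j := b, i := a))) \<partial>PiM I M \<partial>M i)"
    proof (intro nn_integral_sum)
      fix j assume [simp]: "j \<in> I"
      have [measurable]: "(\<lambda>z. (u z)(j := v z)) \<in> measurable L (PiM I M)"
        if "u \<in> measurable L (PiM I M)" "v \<in> measurable L (M j)" for u v and L :: "'z measure"
        by (rule upd_in) fact+
      show "(\<lambda>a. \<integral>\<^sup>+x. osc (M j) (\<lambda>b. g (x(j := b, i := a))) \<partial>PiM I M) \<in> borel_measurable (M i)"
        unfolding osc_def by measurable
    qed
    also have "\<dots> = (\<Sum>j\<in>I. \<integral>\<^sup>+x. osc (M j) (\<lambda>b. g (x(j := b))) \<partial>PiM (insert i I) M)"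
    proof (intro sum.cong refl)
      fix j assume [simp]: "j \<in> I"
      then have "j \<noteq> i" using insert.hyps(2) by metis
      have [measurable]: "(\<lambda>z. (u z)(j := v z)) \<in> measurable L (PiM I M)"
        if "u \<in> measurable L (PiM I M)" "v \<in> measurable L (M j)" for u v and L :: "'z measure"
        by (rule upd_in) fact+
      have [measurable]: "(\<lambda>z. (u z)(j := v z)) \<in> measurable L (PiM (insert i I) M)"
        if "u \<in> measurable L (PiM (insert i I) M)" "v \<in> measurable L (M j)" for u v and L :: "'z measure"
        using that by (intro upd_in) auto
      have "(\<integral>\<^sup>+a. \<integral>\<^sup>+x. osc (M j) (\<lambda>b. g (x(j := b, i := a))) \<partial>PiM I M \<partial>M i)
          = (\<integral>\<^sup>+x. \<integral>\<^sup>+a. osc (M j) (\<lambda>b. g (x(j := b, i := a))) \<partial>M i \<partial>PiM I M)"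
        unfolding osc_def by (intro P.Fubini') measurable
      also have "\<dots> = (\<integral>\<^sup>+x. osc (M j) (\<lambda>b. g (x(j := b))) \<partial>PiM (insert i I) M)"
        unfolding osc_def fun_upd_twist[OF \<open>j \<noteq> i\<close>]
        by (rule split[symmetric]) measurable
      finally show "(\<integral>\<^sup>+a. \<integral>\<^sup>+x. osc (M j) (\<lambda>b. g (x(j := b, i := a))) \<partial>PiM I M \<partial>M i)
        = (\<integral>\<^sup>+x. osc (M j) (\<lambda>b. g (x(j := b))) \<partial>PiM (insert i I) M)" .
    qed
    finally show ?thesis .
  qed
  finally show ?case
    unfolding sum.insert[OF insert.hyps] using step2 unfolding step1 step3
    by (subst add.commute) (meson add_mono order_trans order_refl)
qed

lemma osc_le_second_moment:
  assumes "prob_space M" and [measurable]: "u \<in> borel_measurable M"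
  shows "osc M u \<le> 4 * (\<integral>\<^sup>+x. ennreal ((u x - c)\<^sup>2) \<partial>M)"
proof -
  interpret prob_space M by fact
  have "(u x - u y)\<^sup>2 \<le> 2 * (u x - c)\<^sup>2 + 2 * (u y - c)\<^sup>2" for x y
    using sum_squares_bound[of "u x - c" "- (u y - c)"] by (simp add: power2_eq_square algebra_simps)
  then have "osc M u \<le> (\<integral>\<^sup>+x. \<integral>\<^sup>+y. 2 * ennreal ((u x - c)\<^sup>2) + 2 * ennreal ((u y - c)\<^sup>2) \<partial>M \<partial>M)"
    unfolding osc_def
    by (intro nn_integral_mono) (simp flip: ennreal_plus ennreal_numeral ennreal_mult)
  also have "\<dots> = 4 * (\<integral>\<^sup>+x. ennreal ((u x - c)\<^sup>2) \<partial>M)"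
    by (simp add: nn_integral_add nn_integral_cmult emeasure_space_1 flip: distrib_right)
  finally show ?thesis .
qed

text \<open>By Jensen, averaging \<open>(f x - f y)\<^sup>2\<close> over \<open>y\<close> only decreases when \<open>f y\<close> is replaced by the mean.\<close>

lemma variance_le_osc:
  assumes "prob_space M" and [measurable]: "f \<in> borel_measurable M" and B: "AE x in M. \<bar>f x\<bar> \<le> B"
  shows "ennreal (\<integral>x. (f x - (\<integral>y. f y \<partial>M))\<^sup>2 \<partial>M) \<le> osc M f"
proof -
  interpret prob_space M by fact
  have int[simp]: "integrable M f"
    by (rule integrable_const_bound[of _ B]) (use B in auto)
  have int2: "integrable M (\<lambda>y. (f y - a)\<^sup>2)" for a
  proof (rule integrable_const_bound[of _ "(B + \<bar>a\<bar>)\<^sup>2"])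
    show "AE y in M. norm ((f y - a)\<^sup>2) \<le> (B + \<bar>a\<bar>)\<^sup>2"
      using B
    proof eventually_elim
      fix y assume "\<bar>f y\<bar> \<le> B"
      then have "\<bar>f y - a\<bar> \<le> B + \<bar>a\<bar>" by linarith
      then have "(f y - a)\<^sup>2 \<le> (B + \<bar>a\<bar>)\<^sup>2" by (intro power2_le_iff_abs_le[THEN iffD2]) auto
      then show "norm ((f y - a)\<^sup>2) \<le> (B + \<bar>a\<bar>)\<^sup>2" by simp
    qed
  qed simp
  define m where "m = (\<integral>y. f y \<partial>M)"
  have "ennreal ((f x - m)\<^sup>2) \<le> (\<integral>\<^sup>+y. ennreal ((f x - f y)\<^sup>2) \<partial>M)" for x
  proof -
    have "(\<integral>y. (f y - f x)\<^sup>2 \<partial>M) = (\<integral>y. (f y - m)\<^sup>2 + 2 * (m - f x) * (f y - m) + (f x - m)\<^sup>2 \<partial>M)"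
      by (intro Bochner_Integration.integral_cong) (auto simp: power2_eq_square algebra_simps)
    also have "\<dots> = (\<integral>y. (f y - m)\<^sup>2 \<partial>M) + (f x - m)\<^sup>2"
      by (simp add: int2 prob_space m_def)
    finally have "(f x - m)\<^sup>2 \<le> (\<integral>y. (f x - f y)\<^sup>2 \<partial>M)"
      by (simp add: power2_commute)
    also have "ennreal \<dots> = (\<integral>\<^sup>+y. ennreal ((f x - f y)\<^sup>2) \<partial>M)"
      using int2[of "f x"] by (intro nn_integral_eq_integral[symmetric]) (auto simp: power2_commute)
    finally show ?thesis by (simp add: ennreal_leI)
  qed
  then have "(\<integral>\<^sup>+x. ennreal ((f x - m)\<^sup>2) \<partial>M) \<le> osc M f"
    unfolding osc_def by (intro nn_integral_mono)
  then show ?thesis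
    unfolding m_def using int2 by (simp add: nn_integral_eq_integral)
qed

section \<open>A weighted Hardy inequality on the line\<close>

text \<open>A concave profile has only one-sided derivatives, so the mean value theorem does not apply.
  The substitute: for \<open>M > L\<close> the last point \<open>x\<close> with \<open>F x - F a \<le> M (x - a)\<close> cannot lie
  before \<open>b\<close>, because the right derivative there is below \<open>M\<close>.\<close>

lemma increment_le_right_derivative_bound:
  fixes F F' :: "real \<Rightarrow> real"
  assumes "a \<le> b" and cont: "continuous_on {a..b} F"
    and deriv: "\<And>x. a \<le> x \<Longrightarrow> x < b \<Longrightarrow> (F has_real_derivative F' x) (at_right x)"
    and bound: "\<And>x. a \<le> x \<Longrightarrow> x < b \<Longrightarrow> F' x \<le> L"
  shows "F b - F a \<le> L * (b - a)"
proof (rule field_le_epsilon)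
  fix e :: real assume "e > 0"
  \<comment> \<open>The \<open>+ 1\<close> keeps the denominator positive when \<open>a = b\<close>.\<close>
  define M where "M = L + e / (b - a + 1)"
  have "L < M" using \<open>e > 0\<close> \<open>a \<le> b\<close> by (simp add: M_def)
  define T where "T = {x \<in> {a..b}. F x - F a \<le> M * (x - a)}"
  have "closed T" unfolding T_def
    by (intro continuous_on_closed_Collect_le continuous_intros cont)
  moreover have "bounded T" by (rule bounded_subset[of "{a..b}"]) (auto simp: T_def)
  ultimately have "compact T" by (simp add: compact_eq_bounded_closed)
  moreover have "T \<noteq> {}" using \<open>a \<le> b\<close> by (auto simp: T_def)
  ultimately obtain c where c: "c \<in> T" and max: "\<And>x. x \<in> T \<Longrightarrow> x \<le> c"
    using compact_attains_sup[of T] by blast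
  have "c = b"
  proof (rule ccontr)
    assume "c \<noteq> b"
    then have "a \<le> c" "c < b" using c by (auto simp: T_def)
    then have "((\<lambda>y. (F y - F c) / (y - c)) \<longlongrightarrow> F' c) (at_right c)"
      using deriv[of c] by (simp add: has_field_derivative_iff)
    moreover have "F' c < M" using bound[OF \<open>a \<le> c\<close> \<open>c < b\<close>] \<open>L < M\<close> by simp
    ultimately have "\<forall>\<^sub>F y in at_right c. (F y - F c) / (y - c) < M"
      by (rule order_tendstoD)
    moreover have "\<forall>\<^sub>F y in at_right c. y \<in> {c<..<b}"
      using \<open>c < b\<close> by (rule eventually_at_right_real)
    ultimately have "\<forall>\<^sub>F y in at_right c. (F y - F c) / (y - c) < M \<and> y \<in> {c<..<b}"
      by (rule eventually_conj)
    then obtain y where y: "(F y - F c) / (y - c) < M" "c < y" "y < b"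
      using eventually_happens[of _ "at_right c"] by (auto simp: trivial_limit_at_right_real)
    then have "F y - F c < M * (y - c)" by (simp add: divide_simps)
    then have "y \<in> T" using c y \<open>a \<le> c\<close> by (auto simp: T_def algebra_simps)
    then show False using max y by force
  qed
  then have "F b - F a \<le> M * (b - a)" using c by (simp add: T_def)
  also have "\<dots> \<le> L * (b - a) + e"
    using \<open>e > 0\<close> \<open>a \<le> b\<close> by (simp add: M_def field_simps)
  finally show "F b - F a \<le> L * (b - a) + e" .
qed

lemma lipschitz_of_right_derivative:
  fixes F F' :: "real \<Rightarrow> real"
  assumes "a \<le> b" and cont: "continuous_on {a..b} F"
    and deriv: "\<And>x. a \<le> x \<Longrightarrow> x < b \<Longrightarrow> (F has_real_derivative F' x) (at_right x)"
    and bound: "\<And>x. a \<le> x \<Longrightarrow> x < b \<Longrightarrow> \<bar>F' x\<bar> \<le> L"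
  shows "\<bar>F b - F a\<bar> \<le> L * (b - a)"
proof -
  have "F b - F a \<le> L * (b - a)"
    using assms by (intro increment_le_right_derivative_bound[of a b F F' L]) (auto simp: abs_le_iff)
  moreover have "(- F b) - (- F a) \<le> L * (b - a)"
    using bound by (intro increment_le_right_derivative_bound[of a b "\<lambda>x. - F x" "\<lambda>x. - F' x" L])
      (auto intro!: continuous_intros derivative_intros assms simp: abs_le_iff)
  ultimately show ?thesis by (simp add: abs_le_iff)
qed

text \<open>The fundamental theorem of calculus for a bounded right derivative.  The difference quotients
  \<open>Q k\<close> are bounded by the Lipschitz constant and converge to \<open>F'\<close>, and their integrals are differences
  of means of \<open>F\<close> over short intervals at \<open>b\<close> and \<open>a\<close>.  The room between \<open>b\<close> and \<open>c\<close> is what makes the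
  quotients available up to \<open>b\<close>.\<close>

lemma increment_le_nn_integral_right_derivative:
  fixes F F' :: "real \<Rightarrow> real"
  assumes ab: "a \<le> b" "b < c" and cont: "continuous_on {a..c} F"
    and deriv: "\<And>x. a \<le> x \<Longrightarrow> x < c \<Longrightarrow> (F has_real_derivative F' x) (at_right x)"
    and bound: "\<And>x. a \<le> x \<Longrightarrow> x < c \<Longrightarrow> \<bar>F' x\<bar> \<le> L"
    and [measurable]: "F' \<in> borel_measurable borel"
  shows "ennreal \<bar>F b - F a\<bar> \<le> (\<integral>\<^sup>+x. ennreal \<bar>F' x\<bar> * indicator {a..b} x \<partial>lborel)"
proof -
  define d where "d k = (c - b) / real (k + 2)" for k
  have d_pos: "d k > 0" for k using ab by (simp add: d_def)
  have d_less: "d k < c - b" for k using ab by (simp add: d_def divide_simps)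
  have d_lim: "d \<longlonglongrightarrow> 0"
    unfolding d_def by real_asymp
  define \<Phi> where "\<Phi> x = integral {a..x} F" for x
  define Q where "Q k x = (F (x + d k) - F x) / d k" for k x
  have \<Phi>_deriv: "(\<Phi> has_real_derivative F x) (at x within {a..c})" if "x \<in> {a..c}" for x
    unfolding \<Phi>_def has_real_derivative_iff_has_vector_derivative
    by (rule integral_has_vector_derivative[OF cont that])
  have int: "F integrable_on {s..t}" if "a \<le> s" "t \<le> c" for s t
    by (rule integrable_continuous_real) (rule continuous_on_subset[OF cont], use that in auto)
  have Q_int: "(Q k has_integral ((\<Phi> (b + d k) - \<Phi> b) / d k - (\<Phi> (a + d k) - \<Phi> a) / d k)) {a..b}" for k
  proof -
    have "(F has_integral (\<Phi> (b + d k) - \<Phi> (a + d k))) {a + d k..b + d k}"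
    proof -
      have "integral {a..a + d k} F + integral {a + d k..b + d k} F = integral {a..b + d k} F"
        using d_pos[of k] d_less[of k] ab
        by (intro Henstock_Kurzweil_Integration.integral_combine int) auto
      then have "integral {a + d k..b + d k} F = \<Phi> (b + d k) - \<Phi> (a + d k)"
        unfolding \<Phi>_def by linarith
      moreover have "(F has_integral integral {a + d k..b + d k} F) {a + d k..b + d k}"
        using d_pos[of k] d_less[of k] by (intro integrable_integral int) auto
      ultimately show ?thesis by (simp only:)
    qed
    then have shifted: "((\<lambda>x. F (x + d k)) has_integral (\<Phi> (b + d k) - \<Phi> (a + d k))) {a..b}"
      using has_integral_affinity01
        has_integral_affinity[of F "\<Phi> (b + d k) - \<Phi> (a + d k)" "a + d k" "b + d k" 1 "d k"] ab by simp
    moreover have "(F has_integral (\<Phi> b - \<Phi> a)) {a..b}"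
      using ab by (auto simp: \<Phi>_def intro!: integrable_integral int)
    ultimately have "((\<lambda>x. F (x + d k) - F x) has_integral (\<Phi> (b + d k) - \<Phi> (a + d k)) - (\<Phi> b - \<Phi> a)) {a..b}"
      by (rule has_integral_diff)
    then have "((\<lambda>x. (F (x + d k) - F x) / d k) has_integral ((\<Phi> (b + d k) - \<Phi> (a + d k)) - (\<Phi> b - \<Phi> a)) / d k) {a..b}"
      by (rule has_integral_divide)
    then show ?thesis
      unfolding Q_def[abs_def] by (simp add: diff_divide_distrib add_divide_distrib algebra_simps)
  qed
  have quot_lim: "(\<lambda>k. (G (x + d k) - G x) / d k) \<longlonglongrightarrow> G'"
    if "(G has_real_derivative G') (at x within {x..c})" "x < c" "x \<le> b" for G G' x
  proof -
    have "((\<lambda>y. (G y - G x) / (y - x)) \<longlongrightarrow> G') (at x within {x..c})"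
      using that by (simp add: has_field_derivative_iff)
    moreover have "filterlim (\<lambda>k. x + d k) (at x within {x..c}) sequentially"
      unfolding filterlim_at using d_pos d_less that
      by (auto intro!: tendsto_eq_intros d_lim always_eventually simp: less_imp_neq less_imp_le)
        (smt (verit) d_less that)+
    ultimately show ?thesis
      by (auto dest: filterlim_compose)
  qed
  have integral_lim: "(\<lambda>k. integral {a..b} (Q k)) \<longlonglongrightarrow> F b - F a"
  proof -
    have "(\<Phi> has_real_derivative F x) (at x within {x..c})" if "x \<in> {a..c}" for x
      using that by (intro has_field_derivative_subset[OF \<Phi>_deriv]) auto
    then show ?thesis
      unfolding integral_unique[OF Q_int] using ab by (intro tendsto_diff quot_lim) auto
  qed
  have Q_bound: "norm (Q k x) \<le> L" if "x \<in> {a..b}" for k x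
  proof -
    have "\<bar>F (x + d k) - F x\<bar> \<le> L * ((x + d k) - x)"
      using that d_pos[of k] d_less[of k]
      by (intro lipschitz_of_right_derivative[where F' = F'] continuous_on_subset[OF cont] deriv bound) auto
    then show ?thesis using d_pos[of k] by (simp add: Q_def divide_simps)
  qed
  have Q_lim: "(\<lambda>k. Q k x) \<longlonglongrightarrow> F' x" if "x \<in> {a..b}" for x
    unfolding Q_def using deriv[of x] that ab
    by (intro quot_lim) (auto simp: has_field_derivative_iff at_within_Icc_at_right)
  note convergence = dominated_convergence[of Q "{a..b}" "\<lambda>_. L" F', OF has_integral_integrable[OF Q_int] _ Q_bound Q_lim]
  have eq: "integral {a..b} F' = F b - F a"
    by (intro LIMSEQ_unique[OF convergence(2) integral_lim]) auto
  have "set_integrable lborel {a..b} F'"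
    unfolding set_integrable_def
    by (rule integrableI_bounded_set_indicator[where B = L]) (use bound ab in auto)
  from set_borel_integral_eq_integral(2)[OF this] eq
  have "F b - F a = (\<integral>x. indicator {a..b} x *\<^sub>R F' x \<partial>lborel)"
    by (simp add: set_lebesgue_integral_def)
  moreover have "integrable lborel (\<lambda>x. indicator {a..b} x *\<^sub>R F' x)"
    using \<open>set_integrable lborel {a..b} F'\<close> by (simp add: set_integrable_def)
  ultimately have "ennreal \<bar>F b - F a\<bar> \<le> (\<integral>\<^sup>+x. ennreal (norm (indicator {a..b} x *\<^sub>R F' x)) \<partial>lborel)"
    by (metis integral_norm_bound_ennreal real_norm_def)
  also have "(\<integral>\<^sup>+x. ennreal (norm (indicator {a..b} x *\<^sub>R F' x)) \<partial>lborel)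
      = (\<integral>\<^sup>+x. ennreal \<bar>F' x\<bar> * indicator {a..b} x \<partial>lborel)"
    by (intro nn_integral_cong) (auto split: split_indicator)
  finally show ?thesis .
qed

text \<open>Hardy's argument: \<open>v\<^sup>2\<close> is at most the integral of \<open>|2 v v'|\<close> from \<open>m\<close>.  Exchanging the integrals
  brings in the mass beyond \<open>y\<close>, which is at most \<open>w y * h y\<close>, and
  \<open>4 |v v'| w \<le> v\<^sup>2 + 4 v'\<^sup>2 w\<^sup>2\<close> leaves a copy of the left hand side that can be absorbed.\<close>

lemma weighted_hardy:
  fixes h v v' w :: "real \<Rightarrow> real" and S :: "real set"
  assumes S: "open S" "is_interval S" "m \<in> S"
    and [measurable]: "h \<in> borel_measurable borel" "v' \<in> borel_measurable borel" "w \<in> borel_measurable borel"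
    and h: "\<And>x. 0 \<le> h x" "\<And>x. x \<notin> S \<Longrightarrow> h x = 0" "(\<integral>\<^sup>+x. h x \<partial>lborel) < \<infinity>"
    and v: "continuous_on S v" "v m = 0" "\<And>x. x \<in> S \<Longrightarrow> \<bar>v x\<bar> \<le> B"
    and deriv: "\<And>x. x \<in> S \<Longrightarrow> (v has_real_derivative v' x) (at_right x)"
    and deriv_bd: "\<And>a b. {a..b} \<subseteq> S \<Longrightarrow> \<exists>L. \<forall>x\<in>{a..b}. \<bar>v' x\<bar> \<le> L"
    and tail: "\<And>y. y \<in> S \<Longrightarrow> y \<noteq> m \<Longrightarrow> (\<integral>\<^sup>+x. ennreal (h x) * indicator (closed_segment m x) y \<partial>lborel) \<le> ennreal (w y * h y)"
    and w: "\<And>y. y \<in> S \<Longrightarrow> 0 \<le> w y"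
  shows "(\<integral>\<^sup>+x. ennreal ((v x)\<^sup>2 * h x) \<partial>lborel) \<le> 4 * (\<integral>\<^sup>+x. ennreal ((v' x)\<^sup>2 * (w x)\<^sup>2 * h x) \<partial>lborel)"
proof -
  \<comment> \<open>Extended by zero, \<open>v\<close> is measurable on the whole line.\<close>
  define u where "u x = indicator S x * v x" for x
  have [measurable]: "S \<in> sets borel" using S(1) by simp
  have [measurable]: "u \<in> borel_measurable borel"
    unfolding u_def using borel_measurable_continuous_on_indicator[OF _ v(1)] by simp
  have seg: "y \<in> S" if "x \<in> S" "y \<in> closed_segment m x" for x y
    using that S closed_segment_subset[of m S x] by (auto simp: is_interval_convex_1)
  have Icc: "{a..b} \<subseteq> S" if "a \<in> S" "b \<in> S" for a b
    using mem_is_interval_1_I[OF S(2) that] by auto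
  have sq: "ennreal \<bar>(v b)\<^sup>2 - (v a)\<^sup>2\<bar> \<le> (\<integral>\<^sup>+y. ennreal \<bar>2 * u y * v' y\<bar> * indicator {a..b} y \<partial>lborel)"
    if "a \<in> S" "b \<in> S" "a \<le> b" for a b
  proof -
    obtain e where "e > 0" and e: "cball b e \<subseteq> S"
      using S(1) \<open>b \<in> S\<close> open_contains_cball by blast
    define c where "c = b + e"
    have "c \<in> S" using e \<open>e > 0\<close> by (auto simp: c_def dist_real_def)
    then have sub: "{a..c} \<subseteq> S" using Icc \<open>a \<in> S\<close> by blast
    obtain L where L: "\<And>x. x \<in> {a..c} \<Longrightarrow> \<bar>v' x\<bar> \<le> L" using deriv_bd[OF sub] by blast
    have uv: "u x = v x" if "a \<le> x" "x \<le> c" for x using sub that by (auto simp: u_def)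
    show ?thesis
    proof (rule increment_le_nn_integral_right_derivative[where c = c and L = "2 * B * L" and F' = "\<lambda>y. 2 * u y * v' y"])
      show "continuous_on {a..c} (\<lambda>x. (v x)\<^sup>2)"
        by (intro continuous_intros continuous_on_subset[OF v(1) sub])
      fix x assume x: "a \<le> x" "x < c"
      then have "x \<in> S" using sub by auto
      show "((\<lambda>x. (v x)\<^sup>2) has_real_derivative 2 * u x * v' x) (at_right x)"
        using x by (auto intro!: derivative_eq_intros deriv[OF \<open>x \<in> S\<close>] simp: uv)
      have "\<bar>v x\<bar> * \<bar>v' x\<bar> \<le> B * L"
        using x v(3)[OF \<open>x \<in> S\<close>] L[of x] by (intro mult_mono) auto
      then show "\<bar>2 * u x * v' x\<bar> \<le> 2 * B * L"
        using x by (simp add: uv abs_mult)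
    qed (use that \<open>e > 0\<close> in \<open>auto simp: c_def\<close>)
  qed
  have pointwise: "ennreal ((v x)\<^sup>2) \<le> (\<integral>\<^sup>+y. ennreal \<bar>2 * u y * v' y\<bar> * indicator (closed_segment m x) y \<partial>lborel)"
    if "x \<in> S" for x
    using sq[of m x] sq[of x m] that S(3) v(2) by (cases "m \<le> x") (auto simp: closed_segment_eq_real_ivl)
  let ?H = "\<lambda>x y. ennreal (h x) * (ennreal \<bar>2 * u y * v' y\<bar> * indicator (closed_segment m x) y)"
  let ?X = "\<integral>\<^sup>+x. ennreal ((v x)\<^sup>2 * h x) \<partial>lborel"
  let ?Y = "\<integral>\<^sup>+x. ennreal ((v' x)\<^sup>2 * (w x)\<^sup>2 * h x) \<partial>lborel"
  have [measurable]: "Measurable.pred (borel \<Otimes>\<^sub>M borel) (\<lambda>(x, y). y \<in> closed_segment m x)"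
    unfolding closed_segment_eq_real_ivl by (auto simp: split_beta' cong: if_cong)
  have Xu: "?X = (\<integral>\<^sup>+x. ennreal ((u x)\<^sup>2 * h x) \<partial>lborel)"
    using h(2) by (intro nn_integral_cong) (auto simp: u_def split: split_indicator)
  have "?X \<le> (\<integral>\<^sup>+x. \<integral>\<^sup>+y. ?H x y \<partial>lborel \<partial>lborel)"
  proof (intro nn_integral_mono)
    fix x
    show "ennreal ((v x)\<^sup>2 * h x) \<le> (\<integral>\<^sup>+y. ?H x y \<partial>lborel)"
    proof (cases "x \<in> S")
      case True
      then have "ennreal (h x) * ennreal ((v x)\<^sup>2) \<le> ennreal (h x) * (\<integral>\<^sup>+y. ennreal \<bar>2 * u y * v' y\<bar> * indicator (closed_segment m x) y \<partial>lborel)"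
        by (intro mult_left_mono pointwise) auto
      also have "\<dots> = (\<integral>\<^sup>+y. ?H x y \<partial>lborel)"
        by (intro nn_integral_cmult[symmetric]) measurable
      finally show ?thesis using h(1) by (simp add: ennreal_mult'[symmetric] mult.commute)
    qed (use h(2) in auto)
  qed
  also have "\<dots> = (\<integral>\<^sup>+y. \<integral>\<^sup>+x. ?H x y \<partial>lborel \<partial>lborel)"
    by (intro lborel_pair.Fubini') measurable
  finally have "2 * ?X \<le> 2 * (\<integral>\<^sup>+y. \<integral>\<^sup>+x. ?H x y \<partial>lborel \<partial>lborel)"
    by (rule mult_left_mono) simp
  also have "\<dots> \<le> (\<integral>\<^sup>+y. ennreal ((u y)\<^sup>2 * h y) + 4 * ennreal ((v' y)\<^sup>2 * (w y)\<^sup>2 * h y) \<partial>lborel)"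
  proof -
    have "2 * (\<integral>\<^sup>+x. ?H x y \<partial>lborel)
      \<le> ennreal ((u y)\<^sup>2 * h y) + 4 * ennreal ((v' y)\<^sup>2 * (w y)\<^sup>2 * h y)" if "y \<noteq> m" for y
    proof (cases "y \<in> S")
      case True
      have "(\<integral>\<^sup>+x. ?H x y \<partial>lborel)
          = ennreal \<bar>2 * u y * v' y\<bar> * (\<integral>\<^sup>+x. ennreal (h x) * indicator (closed_segment m x) y \<partial>lborel)"
        by (subst nn_integral_cmult[symmetric]) (measurable, simp add: ac_simps)
      also have "\<dots> \<le> ennreal \<bar>2 * u y * v' y\<bar> * ennreal (w y * h y)"
        by (intro mult_left_mono tail True that) simp
      also have "\<dots> = ennreal (\<bar>2 * u y * v' y\<bar> * (w y * h y))"
        by (simp add: ennreal_mult')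
      finally have "2 * (\<integral>\<^sup>+x. ?H x y \<partial>lborel)
          \<le> 2 * ennreal (\<bar>2 * u y * v' y\<bar> * (w y * h y))"
        by (rule mult_left_mono) simp
      also have "\<dots> = ennreal (2 * (\<bar>2 * u y * v' y\<bar> * (w y * h y)))"
        by (simp add: ennreal_mult')
      also have "\<dots> \<le> ennreal ((u y)\<^sup>2 * h y + 4 * ((v' y)\<^sup>2 * (w y)\<^sup>2 * h y))"
      proof (rule ennreal_leI)
        have "0 \<le> (\<bar>u y\<bar> - 2 * \<bar>v' y\<bar> * w y)\<^sup>2 * h y" using h(1) by simp
        then show "2 * (\<bar>2 * u y * v' y\<bar> * (w y * h y)) \<le> (u y)\<^sup>2 * h y + 4 * ((v' y)\<^sup>2 * (w y)\<^sup>2 * h y)"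
          by (simp add: abs_mult power2_diff power_mult_distrib algebra_simps)
      qed
      also have "\<dots> = ennreal ((u y)\<^sup>2 * h y) + 4 * ennreal ((v' y)\<^sup>2 * (w y)\<^sup>2 * h y)"
        using h(1)[of y] by (subst ennreal_plus) (auto simp: ennreal_mult' mult.assoc)
      finally show ?thesis .
    qed (simp add: u_def)
    then have "AE y in lborel. 2 * (\<integral>\<^sup>+x. ?H x y \<partial>lborel)
      \<le> ennreal ((u y)\<^sup>2 * h y) + 4 * ennreal ((v' y)\<^sup>2 * (w y)\<^sup>2 * h y)"
      using AE_lborel_singleton[of m] by (auto elim: eventually_mono)
    then show ?thesis
      by (subst nn_integral_cmult[symmetric]) (measurable, rule nn_integral_mono_AE)
  qed
  also have "\<dots> = ?X + 4 * ?Y"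
    unfolding Xu by (simp add: nn_integral_add nn_integral_cmult)
  finally have le: "2 * ?X \<le> ?X + 4 * ?Y" .
  have "?X \<le> (\<integral>\<^sup>+x. ennreal (B\<^sup>2) * ennreal (h x) \<partial>lborel)"
  proof (intro nn_integral_mono)
    fix x
    have "(v x)\<^sup>2 * h x \<le> B\<^sup>2 * h x"
    proof (cases "x \<in> S")
      case True
      then show ?thesis using v(3)[OF True] h(1) by (intro mult_right_mono) (auto simp: abs_le_square_iff[symmetric])
    qed (simp add: h(2))
    then show "ennreal ((v x)\<^sup>2 * h x) \<le> ennreal (B\<^sup>2) * ennreal (h x)"
      by (simp add: ennreal_mult'[symmetric] ennreal_leI)
  qed
  also have "\<dots> < \<infinity>" using h(3) by (simp add: nn_integral_cmult ennreal_mult_less_top)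
  finally have "?X \<noteq> \<infinity>" by simp
  then show ?thesis
    using le by (simp add: mult_2 ennreal_add_left_cancel_le)
qed

lemma bounded_continuous_Icc:
  fixes f :: "real \<Rightarrow> real"
  assumes "continuous_on {a..b} f"
  shows "\<exists>L. \<forall>x\<in>{a..b}. \<bar>f x\<bar> \<le> L"
proof -
  have "bounded (f ` {a..b})" by (intro compact_imp_bounded compact_continuous_image assms) simp
  then show ?thesis by (auto simp: bounded_iff)
qed

text \<open>The factor is \<open>16 = 4 \<cdot> 4\<close>: comparison of the oscillation with the second moment about the value
  at \<open>m\<close>, then Hardy's inequality.\<close>

lemma osc_le_weighted_gradient:
  fixes h u u' w :: "real \<Rightarrow> real" and S :: "real set"
  assumes S: "open S" "is_interval S" "m \<in> S"
    and [measurable]: "h \<in> borel_measurable borel" "u' \<in> borel_measurable borel" "w \<in> borel_measurable borel"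
    and h: "\<And>x. 0 \<le> h x" "\<And>x. x \<notin> S \<Longrightarrow> h x = 0" "(\<integral>\<^sup>+x. h x \<partial>lborel) = 1"
    and u: "continuous_on S u" "\<And>x. x \<in> S \<Longrightarrow> \<bar>u x\<bar> \<le> B"
    and deriv: "\<And>x. x \<in> S \<Longrightarrow> (u has_real_derivative u' x) (at_right x)"
    and deriv_bd: "\<And>a b. {a..b} \<subseteq> S \<Longrightarrow> \<exists>L. \<forall>x\<in>{a..b}. \<bar>u' x\<bar> \<le> L"
    and tail: "\<And>y. y \<in> S \<Longrightarrow> y \<noteq> m \<Longrightarrow> (\<integral>\<^sup>+x. ennreal (h x) * indicator (closed_segment m x) y \<partial>lborel) \<le> ennreal (w y * h y)"
    and w: "\<And>y. y \<in> S \<Longrightarrow> 0 \<le> w y"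
  shows "osc (density lborel h) u \<le> 16 * (\<integral>\<^sup>+x. ennreal ((u' x)\<^sup>2 * (w x)\<^sup>2) \<partial>density lborel h)"
proof -
  let ?M = "density lborel h"
  define v where "v x = u x - u m" for x
  have prob: "prob_space ?M"
    by (rule prob_spaceI) (simp add: emeasure_density h)
  have hardy: "(\<integral>\<^sup>+x. ennreal ((v x)\<^sup>2 * h x) \<partial>lborel) \<le> 4 * (\<integral>\<^sup>+x. ennreal ((u' x)\<^sup>2 * (w x)\<^sup>2 * h x) \<partial>lborel)"
  proof (rule weighted_hardy[where S = S and m = m and B = "2 * B"])
    show "continuous_on S v" unfolding v_def by (intro continuous_intros u)
    show "\<bar>v x\<bar> \<le> 2 * B" if "x \<in> S" for x using u(2)[OF that] u(2)[OF S(3)] by (simp add: v_def)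
    show "(v has_real_derivative u' x) (at_right x)" if "x \<in> S" for x
      unfolding v_def using DERIV_diff[OF deriv[OF that] DERIV_const] by simp
  qed (use assms in \<open>simp_all add: v_def\<close>)
  define u0 where "u0 x = indicator S x * u x" for x
  have [measurable]: "u0 \<in> borel_measurable borel"
    unfolding u0_def using borel_measurable_continuous_on_indicator[OF _ u(1)] S(1) by simp
  have "AE x in ?M. x \<in> S"
    using h(2) by (subst AE_density) (auto intro!: AE_I2, metis less_irrefl)
  then have u0: "AE x in ?M. u x = u0 x"
    by (auto elim!: eventually_mono simp: u0_def)
  have "osc ?M u = osc ?M u0"
    unfolding osc_def
  proof (intro nn_integral_cong_AE, use u0 in eventually_elim)
    case (elim x)
    show ?case
      using u0 by (intro nn_integral_cong_AE) (auto elim!: eventually_mono simp: elim)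
  qed
  also have "\<dots> \<le> 4 * (\<integral>\<^sup>+x. ennreal ((u0 x - u m)\<^sup>2) \<partial>?M)"
    by (rule osc_le_second_moment[OF prob]) simp
  also have "(\<integral>\<^sup>+x. ennreal ((u0 x - u m)\<^sup>2) \<partial>?M) = (\<integral>\<^sup>+x. ennreal (h x) * ennreal ((u0 x - u m)\<^sup>2) \<partial>lborel)"
    by (rule nn_integral_density) measurable
  also have "\<dots> = (\<integral>\<^sup>+x. ennreal ((v x)\<^sup>2 * h x) \<partial>lborel)"
    using h by (intro nn_integral_cong) (auto simp: u0_def v_def mult.commute simp flip: ennreal_mult split: split_indicator)
  finally have "osc ?M u \<le> 4 * (\<integral>\<^sup>+x. ennreal ((v x)\<^sup>2 * h x) \<partial>lborel)" .
  also have "\<dots> \<le> 4 * (4 * (\<integral>\<^sup>+x. ennreal ((u' x)\<^sup>2 * (w x)\<^sup>2 * h x) \<partial>lborel))"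
    by (intro mult_left_mono hardy) simp
  also have "(\<integral>\<^sup>+x. ennreal ((u' x)\<^sup>2 * (w x)\<^sup>2 * h x) \<partial>lborel) = (\<integral>\<^sup>+x. ennreal (h x) * ennreal ((u' x)\<^sup>2 * (w x)\<^sup>2) \<partial>lborel)"
    using h(1) by (intro nn_integral_cong) (simp add: mult.commute flip: ennreal_mult)
  also have "\<dots> = (\<integral>\<^sup>+x. ennreal ((u' x)\<^sup>2 * (w x)\<^sup>2) \<partial>?M)"
    by (rule nn_integral_density[symmetric]) measurable
  finally show ?thesis by (simp add: mult.assoc[symmetric])
qed

section \<open>Concave profiles and the law of the axial coordinate\<close>

text \<open>The right derivative of a concave \<open>R\<close>, as the supremum of the slopes of its chords to the right of \<open>x\<close>.
  The value outside \<open>S\<close> makes it measurable on the whole line.\<close>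

definition right_slope :: "real set \<Rightarrow> (real \<Rightarrow> real) \<Rightarrow> real \<Rightarrow> real" where
  "right_slope S R x = (if x \<in> S then - Inf ((\<lambda>t. (R t - R x) / (x - t)) ` ({x<..} \<inter> S)) else 0)"

lemma right_slope_supergradient:
  assumes "open S" "concave_on S R" "x \<in> S" "y \<in> S"
  shows "R y \<le> R x + right_slope S R x * (y - x)"
  using convex_le_Inf_differential[of S "\<lambda>x. - R x" x y] assms
  by (simp add: concave_on_def interior_open right_slope_def)

lemma right_slope_antimono:
  assumes "open S" "concave_on S R" "x \<in> S" "y \<in> S" "x \<le> y"
  shows "right_slope S R y \<le> right_slope S R x"
proof (cases "x = y")
  case False
  have "right_slope S R y * (y - x) \<le> right_slope S R x * (y - x)"
    using right_slope_supergradient[OF assms(1,2), of x y] right_slope_supergradient[OF assms(1,2), of y x] assms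
    by (simp add: algebra_simps)
  then show ?thesis using False assms(5) by (simp add: mult_le_cancel_right)
qed simp

text \<open>The chord slopes decrease with the length of the chord, so their limit is their supremum.\<close>

lemma right_slope_has_derivative:
  assumes "open S" "concave_on S R" "x \<in> S"
  shows "(R has_real_derivative right_slope S R x) (at_right x)"
proof -
  let ?p = "right_slope S R x" and ?s = "\<lambda>t. (R t - R x) / (t - x)"
  obtain e where "e > 0" and e: "cball x e \<subseteq> S"
    using assms open_contains_cball by blast
  then have mem: "t \<in> S" if "x < t" "t \<le> x + e" for t
    using that by (auto simp: dist_real_def subset_eq)
  have le: "?s t \<le> ?p" if "x < t" "t \<in> S" for t
    using right_slope_supergradient[OF assms(1-3) that(2)] that by (simp add: divide_simps mult.commute)
  have mono: "?s t' \<le> ?s t" if "x < t" "t \<le> t'" "t' \<in> S" for t t'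
  proof -
    define l where "l = (t - x) / (t' - x)"
    have l: "0 \<le> l" "l \<le> 1" and lt: "l * (t' - x) = t - x"
      using that by (auto simp: l_def divide_simps)
    then have l3: "(1 - l) * x + l * t' = t" by (simp add: algebra_simps)
    have "(1 - l) * R x + l * R t' \<le> R t"
      using concave_onD[OF assms(2) l(1,2) assms(3) that(3)] l3 by simp
    then have "l * (R t' - R x) \<le> R t - R x" by (simp add: algebra_simps)
    then have "(R t' - R x) * (t - x) \<le> (R t - R x) * (t' - x)"
      using that by (simp add: l_def field_simps)
    then show ?thesis using that by (simp add: divide_simps)
  qed
  have "(?s \<longlongrightarrow> ?p) (at_right x)"
  proof (rule order_tendstoI)
    fix c assume "c > ?p"
    have "\<forall>\<^sub>F t in at_right x. t \<in> {x<..<x + e}"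
      using \<open>e > 0\<close> by (intro eventually_at_right_real) simp
    then show "\<forall>\<^sub>F t in at_right x. ?s t < c"
      by eventually_elim (use le mem \<open>c > ?p\<close> in force)
  next
    fix c assume "c < ?p"
    have "x + e \<in> {x<..} \<inter> S" using mem[of "x + e"] \<open>e > 0\<close> by simp
    then have nonempty: "{x<..} \<inter> S \<noteq> {}" by blast
    have "\<exists>t\<in>{x<..} \<inter> S. (R t - R x) / (x - t) < - c"
    proof (rule ccontr)
      assume "\<not> ?thesis"
      then have "- c \<le> Inf ((\<lambda>t. (R t - R x) / (x - t)) ` ({x<..} \<inter> S))"
        by (intro cInf_greatest) (use nonempty in \<open>auto simp: not_less\<close>)
      then show False using \<open>c < ?p\<close> assms(3) by (simp add: right_slope_def)
    qed
    then obtain t0 where t0: "x < t0" "t0 \<in> S" "(R t0 - R x) / (x - t0) < - c" by auto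
    have "(R t0 - R x) / (x - t0) = - ?s t0"
      using minus_divide_right[of "R t0 - R x" "t0 - x"] by simp
    then have "c < ?s t0" using t0(3) by linarith
    have "\<forall>\<^sub>F t in at_right x. t \<in> {x<..<t0}"
      using t0 by (intro eventually_at_right_real) simp
    then show "\<forall>\<^sub>F t in at_right x. c < ?s t"
      by eventually_elim (use mono[OF _ _ t0(2)] \<open>c < ?s t0\<close> in \<open>fastforce intro: less_le_trans\<close>)
  qed
  then show ?thesis by (simp add: has_field_derivative_iff)
qed

lemma borel_measurable_right_slope:
  assumes "open S" "concave_on S R"
  shows "right_slope S R \<in> borel_measurable borel"
proof -
  have "(\<lambda>x. - right_slope S R x) \<in> borel_measurable (restrict_space borel S)"
    by (rule borel_measurable_mono_on_fnc) (auto intro!: mono_onI right_slope_antimono assms)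
  then have "right_slope S R \<in> borel_measurable (restrict_space borel S)"
    by (simp add: borel_measurable_uminus_eq)
  then have "(\<lambda>x. indicator S x *\<^sub>R right_slope S R x) \<in> borel_measurable borel"
    using assms(1) by (subst (asm) borel_measurable_restrict_space_iff) auto
  moreover have "(\<lambda>x. indicator S x *\<^sub>R right_slope S R x) = right_slope S R"
    by (auto simp: right_slope_def split: split_indicator)
  ultimately show ?thesis by simp
qed

text \<open>The axial coordinate of a body of revolution: \<open>R\<close> is the radius of the section, and the interval is
  taken open, as its endpoints carry no mass.  Extending \<open>R\<close> by zero lets all integrals range over the line.\<close>

locale concave_profile =
  fixes S :: "real set" and R :: "real \<Rightarrow> real" and n :: nat
  assumes open_S: "open S" and interval_S: "is_interval S"
    and concave_R: "concave_on S R"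
    and R_pos: "\<And>x. x \<in> S \<Longrightarrow> 0 < R x" and R_zero: "\<And>x. x \<notin> S \<Longrightarrow> R x = 0"
    and n_pos: "1 \<le> n"
    and mass_pos: "0 < (\<integral>\<^sup>+x. ennreal (R x ^ n) \<partial>lborel)"
    and mass_finite: "(\<integral>\<^sup>+x. ennreal (R x ^ n) \<partial>lborel) < \<infinity>"
begin

lemma R_nonneg: "0 \<le> R x"
  using R_pos[of x] R_zero[of x] by (cases "x \<in> S") auto

lemma between_S: "a \<in> S \<Longrightarrow> b \<in> S \<Longrightarrow> a \<le> x \<Longrightarrow> x \<le> b \<Longrightarrow> x \<in> S"
  by (rule mem_is_interval_1_I[OF interval_S])

lemma continuous_R: "continuous_on S R"
  using convex_on_continuous[OF open_S, of "\<lambda>x. - R x"] concave_R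
  by (auto simp: concave_on_def dest: continuous_on_minus)

lemma borel_R[measurable]: "R \<in> borel_measurable borel"
proof -
  have "(\<lambda>x. indicator S x *\<^sub>R R x) \<in> borel_measurable borel"
    by (rule borel_measurable_continuous_on_indicator[OF _ continuous_R]) (simp add: open_S)
  moreover have "(\<lambda>x. indicator S x *\<^sub>R R x) = R"
    by (auto simp: R_zero split: split_indicator)
  ultimately show ?thesis by simp
qed

abbreviation D :: "real \<Rightarrow> real" where "D \<equiv> right_slope S R"

lemma borel_D[measurable]: "D \<in> borel_measurable borel"
  by (rule borel_measurable_right_slope[OF open_S concave_R])

text \<open>The direction \<open>\<epsilon> = 1\<close> or \<open>\<epsilon> = -1\<close> selects the half-line to the right or to the left of \<open>y\<close>, so that both
  sides are treated by the same argument.\<close>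

definition half_mass :: "real \<Rightarrow> real \<Rightarrow> ennreal" where
  "half_mass \<epsilon> y = (\<integral>\<^sup>+x. ennreal (R x ^ n) * indicator {0..} (\<epsilon> * (x - y)) \<partial>lborel)"

lemma half_mass_shift:
  assumes "\<epsilon> = 1 \<or> \<epsilon> = -1"
  shows "half_mass \<epsilon> y = (\<integral>\<^sup>+s. ennreal (R (y + \<epsilon> * s) ^ n) * indicator {0..} s \<partial>lborel)"
proof -
  have "half_mass \<epsilon> y = ennreal \<bar>\<epsilon>\<bar> * (\<integral>\<^sup>+s. ennreal (R (y + \<epsilon> * s) ^ n) * indicator {0..} (\<epsilon> * ((y + \<epsilon> * s) - y)) \<partial>lborel)"
    unfolding half_mass_def using assms by (intro nn_integral_real_affine) auto
  also have "\<dots> = (\<integral>\<^sup>+s. ennreal (R (y + \<epsilon> * s) ^ n) * indicator {0..} s \<partial>lborel)"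
    using assms by auto
  finally show ?thesis .
qed

text \<open>Log-concavity in the form used for tails: \<open>y\<close> and \<open>m + \<epsilon> s\<close> lie between \<open>m\<close> and \<open>y + \<epsilon> s\<close>, with
  complementary weights.  The product of the two interpolated values exceeds that of the end values
  by \<open>s d (R m - R (y + \<epsilon> s))\<^sup>2\<close> over \<open>(d + s)\<^sup>2\<close>.\<close>

lemma concave_product:
  assumes \<epsilon>: "\<epsilon> = 1 \<or> \<epsilon> = -1" and "m \<in> S" "y \<in> S" "0 \<le> \<epsilon> * (y - m)" "0 \<le> s"
  shows "R (y + \<epsilon> * s) * R m \<le> R y * R (m + \<epsilon> * s)"
proof (cases "y + \<epsilon> * s \<in> S \<and> 0 < s")
  case True
  define d where "d = \<epsilon> * (y - m)"
  have "\<epsilon> * d = y - m" using \<epsilon> by (auto simp: d_def)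
  then have y: "y = m + \<epsilon> * d" by simp
  have ds: "0 \<le> d" "0 < d + s" using True assms by (auto simp: d_def)
  let ?z = "y + \<epsilon> * s" and ?A = "R m" and ?B = "R (y + \<epsilon> * s)"
  have conc: "(1 - t) * ?A + t * ?B \<le> R (m + t * (\<epsilon> * (d + s)))" if "0 \<le> t" "t \<le> 1" for t
    using concave_onD[OF concave_R that assms(2) conjunct1[OF True]] by (simp add: y algebra_simps)
  have s: "s / (d + s) * (\<epsilon> * (d + s)) = \<epsilon> * s" "1 - s / (d + s) = d / (d + s)"
    and d: "d / (d + s) * (\<epsilon> * (d + s)) = \<epsilon> * d" "1 - d / (d + s) = s / (d + s)"
    using ds by (auto simp: divide_simps)
  have 1: "s * ?A + d * ?B \<le> (d + s) * R y"
    using mult_left_mono[OF conc[of "d / (d + s)"], of "d + s"] ds True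
    unfolding d y[symmetric] by (simp add: distrib_left)
  have 2: "d * ?A + s * ?B \<le> (d + s) * R (m + \<epsilon> * s)"
    using mult_left_mono[OF conc[of "s / (d + s)"], of "d + s"] ds True
    unfolding s by (simp add: distrib_left)
  have "(d + s)\<^sup>2 * (?B * ?A) \<le> (s * ?A + d * ?B) * (d * ?A + s * ?B)"
  proof -
    have "(s * ?A + d * ?B) * (d * ?A + s * ?B) - (d + s)\<^sup>2 * (?B * ?A) = s * d * (?A - ?B)\<^sup>2"
      by (simp add: power2_eq_square algebra_simps)
    moreover have "0 \<le> s * d * (?A - ?B)\<^sup>2" using ds True by simp
    ultimately show ?thesis by linarith
  qed
  also have "\<dots> \<le> ((d + s) * R y) * ((d + s) * R (m + \<epsilon> * s))"
    using ds True by (intro mult_mono 1 2) (auto intro!: add_nonneg_nonneg mult_nonneg_nonneg R_nonneg)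
  also have "\<dots> = (d + s)\<^sup>2 * (R y * R (m + \<epsilon> * s))"
    by (simp add: power2_eq_square)
  finally show ?thesis using ds by simp
next
  case False
  then have "y + \<epsilon> * s \<notin> S \<or> s = 0" using assms by auto
  then show ?thesis using R_nonneg by (auto simp: R_zero mult.commute)
qed

text \<open>The quotient of tail and density decreases when moving away from \<open>m\<close>.\<close>

lemma half_mass_compare:
  assumes \<epsilon>: "\<epsilon> = 1 \<or> \<epsilon> = -1" and "m \<in> S" "y \<in> S" "0 \<le> \<epsilon> * (y - m)"
  shows "half_mass \<epsilon> y * ennreal (R m ^ n) \<le> half_mass \<epsilon> m * ennreal (R y ^ n)"
proof -
  have "half_mass \<epsilon> y * ennreal (R m ^ n)
      = (\<integral>\<^sup>+s. ennreal (R (y + \<epsilon> * s) ^ n) * indicator {0..} s * ennreal (R m ^ n) \<partial>lborel)"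
    unfolding half_mass_shift[OF \<epsilon>] by (intro nn_integral_multc[symmetric]) measurable
  also have "\<dots> \<le> (\<integral>\<^sup>+s. ennreal (R (m + \<epsilon> * s) ^ n) * indicator {0..} s * ennreal (R y ^ n) \<partial>lborel)"
  proof (intro nn_integral_mono)
    fix s
    have "ennreal (R (y + \<epsilon> * s) ^ n) * ennreal (R m ^ n) \<le> ennreal (R (m + \<epsilon> * s) ^ n) * ennreal (R y ^ n)" if "0 \<le> s"
    proof -
      have "(R (y + \<epsilon> * s) * R m) ^ n \<le> (R y * R (m + \<epsilon> * s)) ^ n"
        by (intro power_mono concave_product assms that mult_nonneg_nonneg R_nonneg)
      then show ?thesis
        by (simp add: power_mult_distrib mult.commute ennreal_leI R_nonneg flip: ennreal_mult)
    qed
    then show "ennreal (R (y + \<epsilon> * s) ^ n) * indicator {0..} s * ennreal (R m ^ n)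
        \<le> ennreal (R (m + \<epsilon> * s) ^ n) * indicator {0..} s * ennreal (R y ^ n)"
      by (auto split: split_indicator)
  qed
  also have "\<dots> = half_mass \<epsilon> m * ennreal (R y ^ n)"
    unfolding half_mass_shift[OF \<epsilon>] by (intro nn_integral_multc) measurable
  finally show ?thesis .
qed

text \<open>Below a line of slope \<open>-p\<close> starting at height \<open>R y\<close>, the tail is at most the integral of the \<open>n\<close>th power of that
  line, which reaches zero after the distance \<open>R y / p\<close>.\<close>

lemma half_mass_le_slope:
  assumes \<epsilon>: "\<epsilon> = 1 \<or> \<epsilon> = -1" and "y \<in> S" "0 < p"
    and slope: "\<And>x. x \<in> S \<Longrightarrow> 0 \<le> \<epsilon> * (x - y) \<Longrightarrow> R x \<le> R y - p * (\<epsilon> * (x - y))"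
  shows "half_mass \<epsilon> y \<le> ennreal (R y ^ (n + 1) / (p * (real n + 1)))"
proof -
  let ?b = "R y / p"
  have b: "0 \<le> ?b" using assms R_nonneg by simp
  have "half_mass \<epsilon> y \<le> (\<integral>\<^sup>+s. ennreal ((R y - p * s) ^ n) * indicator {0..?b} s \<partial>lborel)"
    unfolding half_mass_shift[OF \<epsilon>]
  proof (intro nn_integral_mono)
    fix s
    have "ennreal (R (y + \<epsilon> * s) ^ n) \<le> ennreal ((R y - p * s) ^ n) * indicator {0..?b} s" if "0 \<le> s"
    proof (cases "y + \<epsilon> * s \<in> S")
      case True
      have "R (y + \<epsilon> * s) \<le> R y - p * s" using slope[OF True] \<epsilon> that by auto
      moreover from this have "s \<le> ?b" using R_nonneg[of "y + \<epsilon> * s"] assms(3) by (simp add: field_simps)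
      ultimately show ?thesis using that by (auto intro!: ennreal_leI power_mono R_nonneg)
    next
      case False
      then show ?thesis using n_pos by (simp add: R_zero zero_power)
    qed
    then show "ennreal (R (y + \<epsilon> * s) ^ n) * indicator {0..} s \<le> ennreal ((R y - p * s) ^ n) * indicator {0..?b} s"
      by (auto split: split_indicator)
  qed
  also have "\<dots> = ennreal (- ((R y - p * ?b) ^ (n + 1)) / (p * (real n + 1)) - (- ((R y - p * 0) ^ (n + 1)) / (p * (real n + 1))))"
  proof (rule nn_integral_FTC_Icc)
    fix s assume "s \<in> {0..?b}"
    then show "0 \<le> (R y - p * s) ^ n" using assms(3) by (simp add: field_simps)
    have "((\<lambda>s. - ((R y - p * s) ^ Suc n / (p * (real n + 1)))) has_real_derivative
        - ((1 + real n) * (- p * (R y - p * s) ^ n) / (p * (real n + 1)))) (at s)"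
      by (intro DERIV_minus DERIV_cdivide DERIV_power_Suc) (auto intro!: derivative_eq_intros)
    also have "- ((1 + real n) * (- p * (R y - p * s) ^ n) / (p * (real n + 1))) = (R y - p * s) ^ n"
      using assms(3) by (simp add: divide_simps)
    finally show "((\<lambda>s. - ((R y - p * s) ^ (n + 1)) / (p * (real n + 1))) has_real_derivative (R y - p * s) ^ n) (at s)"
      by simp
  qed (use b in auto)
  also have "\<dots> = ennreal (R y ^ (n + 1) / (p * (real n + 1)))"
    using assms(3) by simp
  finally show ?thesis .
qed

definition Z :: real where "Z = enn2real (\<integral>\<^sup>+x. ennreal (R x ^ n) \<partial>lborel)"

definition h :: "real \<Rightarrow> real" where "h x = R x ^ n / Z"

definition \<nu> :: "real measure" where "\<nu> = density lborel (\<lambda>x. ennreal (h x))"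

lemma Z_pos: "0 < Z"
  using mass_pos mass_finite by (simp add: Z_def enn2real_positive_iff)

lemma nn_integral_R_power: "(\<integral>\<^sup>+x. ennreal (R x ^ n) \<partial>lborel) = ennreal Z"
  using mass_finite by (simp add: Z_def)

lemma h_nonneg: "0 \<le> h x"
  using R_nonneg Z_pos by (simp add: h_def)

lemma h_zero: "x \<notin> S \<Longrightarrow> h x = 0"
  using n_pos by (simp add: h_def R_zero zero_power)

lemma borel_h[measurable]: "h \<in> borel_measurable borel"
  unfolding h_def[abs_def] by measurable

lemma ennreal_R_power: "ennreal (R x ^ n) = ennreal Z * ennreal (h x)"
  using Z_pos h_nonneg by (simp add: h_def flip: ennreal_mult)

lemma nn_integral_h: "(\<integral>\<^sup>+x. ennreal (h x) \<partial>lborel) = 1"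
proof -
  have "ennreal Z * (\<integral>\<^sup>+x. ennreal (h x) \<partial>lborel) = ennreal Z * 1"
    using nn_integral_R_power by (simp add: ennreal_R_power nn_integral_cmult)
  then show ?thesis using Z_pos by (subst (asm) ennreal_mult_cancel_left) auto
qed

lemma sets_\<nu>[measurable_cong, simp]: "sets \<nu> = sets borel"
  by (simp add: \<nu>_def)

lemma space_\<nu>[simp]: "space \<nu> = UNIV"
  by (simp add: \<nu>_def)

lemma prob_space_\<nu>: "prob_space \<nu>"
  by (rule prob_spaceI) (simp add: \<nu>_def emeasure_density nn_integral_h)

sublocale \<nu>: prob_space \<nu>
  by (rule prob_space_\<nu>)

sublocale \<nu>: real_distribution \<nu>
  by unfold_locales simp_all

lemma nn_integral_\<nu>:
  "f \<in> borel_measurable borel \<Longrightarrow> (\<integral>\<^sup>+x. f x \<partial>\<nu>) = (\<integral>\<^sup>+x. ennreal (h x) * f x \<partial>lborel)"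
  unfolding \<nu>_def by (intro nn_integral_density) simp_all

lemma AE_\<nu>_S: "AE x in \<nu>. x \<in> S"
  unfolding \<nu>_def using h_zero by (subst AE_density) (auto intro!: AE_I2, metis less_irrefl)

definition half_prob :: "real \<Rightarrow> real \<Rightarrow> real" where
  "half_prob \<epsilon> y = measure \<nu> {x. 0 \<le> \<epsilon> * (x - y)}"

lemma half_mass_eq: "half_mass \<epsilon> y = ennreal (Z * half_prob \<epsilon> y)"
proof -
  have "half_mass \<epsilon> y = ennreal Z * (\<integral>\<^sup>+x. ennreal (h x) * indicator {x. 0 \<le> \<epsilon> * (x - y)} x \<partial>lborel)"
    unfolding half_mass_def
    by (subst nn_integral_cmult[symmetric])
      (auto intro!: nn_integral_cong simp: ennreal_R_power mult.assoc split: split_indicator)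
  also have "(\<integral>\<^sup>+x. ennreal (h x) * indicator {x. 0 \<le> \<epsilon> * (x - y)} x \<partial>lborel) = emeasure \<nu> {x. 0 \<le> \<epsilon> * (x - y)}"
    unfolding \<nu>_def by (subst emeasure_density) auto
  also have "\<dots> = ennreal (half_prob \<epsilon> y)"
    by (simp add: half_prob_def \<nu>.emeasure_eq_measure)
  finally show ?thesis using Z_pos by (simp add: ennreal_mult half_prob_def)
qed

lemma half_prob_compare:
  assumes "\<epsilon> = 1 \<or> \<epsilon> = -1" "m \<in> S" "y \<in> S" "0 \<le> \<epsilon> * (y - m)"
  shows "half_prob \<epsilon> y * h m \<le> half_prob \<epsilon> m * h y"
proof -
  have nonneg: "0 \<le> half_prob \<epsilon> y" for \<epsilon> y by (simp add: half_prob_def)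
  have "Z * half_prob \<epsilon> y * R m ^ n \<le> Z * half_prob \<epsilon> m * R y ^ n"
    using half_mass_compare[OF assms] Z_pos nonneg R_nonneg
    by (simp add: half_mass_eq flip: ennreal_mult)
  then show ?thesis using Z_pos by (simp add: h_def divide_right_mono)
qed

lemma half_prob_le_slope:
  assumes "\<epsilon> = 1 \<or> \<epsilon> = -1" "y \<in> S" "0 < p"
    "\<And>x. x \<in> S \<Longrightarrow> 0 \<le> \<epsilon> * (x - y) \<Longrightarrow> R x \<le> R y - p * (\<epsilon> * (x - y))"
  shows "half_prob \<epsilon> y * p \<le> R y / (real n + 1) * h y"
proof -
  have "Z * half_prob \<epsilon> y \<le> R y ^ (n + 1) / (p * (real n + 1))"
    using half_mass_le_slope[OF assms] R_nonneg assms(3) by (simp add: half_mass_eq)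
  then have "half_prob \<epsilon> y \<le> R y ^ (n + 1) / (p * (real n + 1)) / Z"
    using Z_pos by (subst pos_le_divide_eq) (auto simp: mult.commute)
  then have "half_prob \<epsilon> y * p \<le> R y ^ (n + 1) / (p * (real n + 1)) / Z * p"
    using assms(3) by (intro mult_right_mono) auto
  also have "\<dots> = R y / (real n + 1) * h y"
  proof -
    have "a * b / (p * k) / Z * p = b / k * (a / Z)" if "k > 0" for a b k
      using that assms(3) Z_pos by (simp add: divide_simps)
    from this[of "real n + 1" "R y ^ n" "R y"] assms(3) show ?thesis by (simp add: h_def mult.commute)
  qed
  finally show ?thesis .
qed

lemma half_prob_antimono:
  assumes "\<epsilon> = 1 \<or> \<epsilon> = -1" "0 \<le> \<epsilon> * (y - m)"
  shows "half_prob \<epsilon> y \<le> half_prob \<epsilon> m"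
  unfolding half_prob_def using assms by (intro \<nu>.finite_measure_mono) auto

lemma \<nu>_singleton: "measure \<nu> {x} = 0"
proof -
  have "emeasure \<nu> {x} = (\<integral>\<^sup>+y. ennreal (h y) * indicator {x} y \<partial>lborel)"
    unfolding \<nu>_def by (subst emeasure_density) auto
  also have "\<dots> = (\<integral>\<^sup>+y. 0 \<partial>(lborel::real measure))"
    using AE_lborel_singleton[of x] by (intro nn_integral_cong_AE) (auto elim!: eventually_mono)
  finally show ?thesis by (simp add: \<nu>.emeasure_eq_measure)
qed

lemma half_prob_sum: "half_prob 1 y + half_prob (-1) y = 1"
proof -
  have "half_prob 1 y = measure \<nu> {y<..}"
  proof -
    have "measure \<nu> ({y<..} \<union> {y}) = measure \<nu> {y<..} + measure \<nu> {y}"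
      by (rule \<nu>.finite_measure_Union) auto
    moreover have "{y<..} \<union> {y} = {x. 0 \<le> 1 * (x - y)}" by auto
    ultimately show ?thesis by (simp add: half_prob_def \<nu>_singleton)
  qed
  moreover have "{x. 0 \<le> -1 * (x - y)} = space \<nu> - {y<..}" by auto
  ultimately show ?thesis using \<nu>.prob_compl[of "{y<..}"] by (simp add: half_prob_def)
qed

lemma median_exists: "\<exists>m\<in>S. half_prob 1 m = 1/2 \<and> half_prob (-1) m = 1/2"
proof -
  have cdf: "cdf \<nu> x = half_prob (-1) x" for x
    by (auto simp: cdf_def half_prob_def intro!: arg_cong[where f = "measure \<nu>"])
  have "\<forall>\<^sub>F x in at_top. 1/2 < cdf \<nu> x"
    using \<nu>.cdf_lim_at_top_prob by (rule order_tendstoD) simp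
  moreover have "\<forall>\<^sub>F x in at_bot. cdf \<nu> x < 1/2"
    using \<nu>.cdf_lim_at_bot by (rule order_tendstoD) simp
  ultimately obtain a b where a: "cdf \<nu> a < 1/2" and b: "1/2 < cdf \<nu> b"
    by (metis (mono_tags, lifting) eventually_at_bot_linorder eventually_at_top_linorder order_refl)
  then have "a \<le> b"
    by (metis \<nu>.cdf_nondecreasing linorder_le_cases order_less_le_trans order_less_imp_not_less)
  moreover have "continuous_on {a..b} (cdf \<nu>)"
    by (intro continuous_at_imp_continuous_on ballI) (simp add: \<nu>.isCont_cdf \<nu>_singleton)
  ultimately obtain m where m: "cdf \<nu> m = 1/2"
    using IVT'[of "cdf \<nu>" a "1/2" b] a b by auto
  have half: "half_prob 1 m = 1/2" "half_prob (-1) m = 1/2"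
    using m half_prob_sum[of m] by (auto simp: cdf)
  have "m \<in> S"
  proof (rule ccontr)
    assume "m \<notin> S"
    then have "(\<forall>x\<in>S. x < m) \<or> (\<forall>x\<in>S. m < x)"
      using between_S by (metis linorder_le_less_linear order_less_imp_le order_le_less)
    then show False
    proof
      assume "\<forall>x\<in>S. x < m"
      then have "AE x in \<nu>. x \<notin> {x. 0 \<le> 1 * (x - m)}" using AE_\<nu>_S by (auto elim!: eventually_mono)
      then have "half_prob 1 m = 0" unfolding half_prob_def by (subst \<nu>.prob_eq_0) auto
      then show False using half by simp
    next
      assume "\<forall>x\<in>S. m < x"
      then have "AE x in \<nu>. x \<notin> {x. 0 \<le> -1 * (x - m)}" using AE_\<nu>_S by (auto elim!: eventually_mono)
      then have "half_prob (-1) m = 0" unfolding half_prob_def by (subst \<nu>.prob_eq_0) auto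
      then show False using half by simp
    qed
  qed
  then show ?thesis using half by blast
qed

text \<open>On one side of the median the density stays below its value there, and that side carries mass
  \<open>1/2\<close>.  By Chebyshev, \<open>|x| \<ge> 2 \<sigma>\<close> has mass at most \<open>1/4\<close>, so mass \<open>1/4\<close> lies in an interval of length
  \<open>4 \<sigma>\<close> where the density is at most \<open>h m\<close>.\<close>

lemma density_at_median:
  assumes "m \<in> S" and half: "half_prob 1 m = 1/2" "half_prob (-1) m = 1/2"
    and "0 < \<sigma>" and second_moment: "(\<integral>\<^sup>+x. ennreal (x\<^sup>2) \<partial>\<nu>) \<le> ennreal (\<sigma>\<^sup>2)"
  shows "1 \<le> 16 * \<sigma> * h m"
proof -
  \<comment> \<open>The density is at most its value at the median on one of the two sides.\<close>
  obtain \<epsilon> :: real where \<epsilon>: "\<epsilon> = 1 \<or> \<epsilon> = -1" and side: "\<And>x. x \<in> S \<Longrightarrow> 0 \<le> \<epsilon> * (x - m) \<Longrightarrow> R x \<le> R m"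
  proof (cases "D m \<le> 0")
    case True
    show ?thesis
    proof (rule that[of 1])
      fix x assume x: "x \<in> S" "0 \<le> 1 * (x - m)"
      then have "D m * (x - m) \<le> 0" using True by (simp add: mult_nonpos_nonneg)
      then show "R x \<le> R m"
        using right_slope_supergradient[OF open_S concave_R \<open>m \<in> S\<close> x(1)] by linarith
    qed simp
  next
    case False
    show ?thesis
    proof (rule that[of "-1"])
      fix x assume x: "x \<in> S" "0 \<le> -1 * (x - m)"
      then have "D m * (x - m) \<le> 0" using False by (simp add: mult_nonneg_nonpos)
      then show "R x \<le> R m"
        using right_slope_supergradient[OF open_S concave_R \<open>m \<in> S\<close> x(1)] by linarith
    qed simp
  qed
  have side_h: "h x \<le> h m" if "0 \<le> \<epsilon> * (x - m)" for x
  proof (cases "x \<in> S")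
    case True
    then show ?thesis
      unfolding h_def using side[OF True that] R_nonneg Z_pos by (intro divide_right_mono power_mono) auto
  qed (simp add: h_zero h_nonneg)
  have far: "measure \<nu> {x. 2 * \<sigma> \<le> \<bar>x\<bar>} \<le> 1/4"
  proof -
    have "ennreal (4 * \<sigma>\<^sup>2) * emeasure \<nu> {x. 2 * \<sigma> \<le> \<bar>x\<bar>} = (\<integral>\<^sup>+x. ennreal (4 * \<sigma>\<^sup>2) * indicator {x. 2 * \<sigma> \<le> \<bar>x\<bar>} x \<partial>\<nu>)"
      by (subst nn_integral_cmult_indicator) auto
    also have "\<dots> \<le> (\<integral>\<^sup>+x. ennreal (x\<^sup>2) \<partial>\<nu>)"
    proof (intro nn_integral_mono)
      fix x
      have "4 * \<sigma>\<^sup>2 \<le> x\<^sup>2" if "2 * \<sigma> \<le> \<bar>x\<bar>"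
        using power_mono[OF that, of 2] \<open>0 < \<sigma>\<close> by (simp add: power_mult_distrib)
      then show "ennreal (4 * \<sigma>\<^sup>2) * indicator {x. 2 * \<sigma> \<le> \<bar>x\<bar>} x \<le> ennreal (x\<^sup>2)"
        by (auto split: split_indicator intro: ennreal_leI)
    qed
    also have "\<dots> \<le> ennreal (\<sigma>\<^sup>2)" by (rule second_moment)
    finally have "4 * \<sigma>\<^sup>2 * measure \<nu> {x. 2 * \<sigma> \<le> \<bar>x\<bar>} \<le> \<sigma>\<^sup>2"
      by (simp add: \<nu>.emeasure_eq_measure flip: ennreal_mult)
    then show ?thesis using \<open>0 < \<sigma>\<close> by (simp add: field_simps)
  qed
  have near: "measure \<nu> ({x. 0 \<le> \<epsilon> * (x - m)} \<inter> {-2 * \<sigma>..2 * \<sigma>}) \<le> 4 * \<sigma> * h m"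
  proof -
    have "emeasure \<nu> ({x. 0 \<le> \<epsilon> * (x - m)} \<inter> {-2 * \<sigma>..2 * \<sigma>})
        = (\<integral>\<^sup>+x. ennreal (h x) * indicator ({x. 0 \<le> \<epsilon> * (x - m)} \<inter> {-2 * \<sigma>..2 * \<sigma>}) x \<partial>lborel)"
      unfolding \<nu>_def by (subst emeasure_density) auto
    also have "\<dots> \<le> (\<integral>\<^sup>+x. ennreal (h m) * indicator {-2 * \<sigma>..2 * \<sigma>} x \<partial>lborel)"
      by (intro nn_integral_mono) (auto split: split_indicator intro!: ennreal_leI side_h)
    also have "\<dots> = ennreal (4 * \<sigma> * h m)"
      using \<open>0 < \<sigma>\<close> h_nonneg[of m] by (subst nn_integral_cmult_indicator) (auto simp: mult.commute simp flip: ennreal_mult)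
    finally show ?thesis
      using \<open>0 < \<sigma>\<close> h_nonneg[of m] by (simp add: \<nu>.emeasure_eq_measure)
  qed
  have "1/2 = half_prob \<epsilon> m" using \<epsilon> half by auto
  also have "\<dots> \<le> measure \<nu> (({x. 0 \<le> \<epsilon> * (x - m)} \<inter> {-2 * \<sigma>..2 * \<sigma>}) \<union> {x. 2 * \<sigma> \<le> \<bar>x\<bar>})"
    unfolding half_prob_def by (intro \<nu>.finite_measure_mono) auto
  also have "\<dots> \<le> measure \<nu> ({x. 0 \<le> \<epsilon> * (x - m)} \<inter> {-2 * \<sigma>..2 * \<sigma>}) + measure \<nu> {x. 2 * \<sigma> \<le> \<bar>x\<bar>}"
    by (intro measure_Un_le) auto
  also have "\<dots> \<le> 4 * \<sigma> * h m + 1/4" by (intro add_mono near far)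
  finally show ?thesis by simp
qed

text \<open>The homothety of ratio \<open>1/2\<close> with centre \<open>t0\<close> sends every point into \<open>{R \<ge> R t0 / 2}\<close>, by concavity.
  Where \<open>R < R t0\<close> it does not decrease the density, so \<open>{R < R t0}\<close> has at most twice the mass of its
  target.  Therefore \<open>{R \<ge> R t0 / 2}\<close> has mass at least \<open>1/3\<close>, and \<open>12 = 3 \<cdot> 2\<^sup>2\<close>.\<close>

lemma radius_le_second_moment:
  assumes "t0 \<in> S"
  shows "ennreal ((R t0)\<^sup>2) \<le> 12 * (\<integral>\<^sup>+x. ennreal ((R x)\<^sup>2) \<partial>\<nu>)"
proof -
  define J where "J = {x. R t0 / 2 \<le> R x}"
  have [measurable]: "J \<in> sets borel" unfolding J_def by measurable
  have "emeasure \<nu> {x. R x < R t0} \<le> 2 * emeasure \<nu> J"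
  proof -
    have "emeasure \<nu> {x. R x < R t0} = (\<integral>\<^sup>+x. ennreal (h x) * indicator {x. R x < R t0} x \<partial>lborel)"
      unfolding \<nu>_def by (subst emeasure_density) auto
    also have "\<dots> \<le> (\<integral>\<^sup>+x. ennreal (h (t0 / 2 + 1/2 * x)) * indicator J (t0 / 2 + 1/2 * x) \<partial>lborel)"
    proof (intro nn_integral_mono)
      fix x
      show "ennreal (h x) * indicator {x. R x < R t0} x \<le> ennreal (h (t0 / 2 + 1/2 * x)) * indicator J (t0 / 2 + 1/2 * x)"
      proof (cases "x \<in> S \<and> R x < R t0")
        case True
        then have "R t0 / 2 + R x / 2 \<le> R (t0 / 2 + 1/2 * x)"
          using concave_onD[OF concave_R, of "1/2" t0 x] assms by simp
        moreover from this have "R x \<le> R (t0 / 2 + 1/2 * x)" using True by linarith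
        moreover have "h x \<le> h (t0 / 2 + 1/2 * x)"
          unfolding h_def using Z_pos R_nonneg calculation(2) by (intro divide_right_mono power_mono) auto
        ultimately show ?thesis
          using R_nonneg[of x] by (auto simp: J_def intro!: ennreal_leI split: split_indicator)
      qed (auto simp: h_zero split: split_indicator)
    qed
    also have "\<dots> = 2 * (ennreal \<bar>1/2\<bar> * (\<integral>\<^sup>+x. ennreal (h (t0 / 2 + 1/2 * x)) * indicator J (t0 / 2 + 1/2 * x) \<partial>lborel))"
    proof -
      have "ennreal 2 * ennreal \<bar>1/2\<bar> = 1"
        by (subst ennreal_mult[symmetric]) simp_all
      then show ?thesis by (simp only: ennreal_numeral mult.assoc[symmetric] mult_1)
    qed
    also have "\<dots> = 2 * (\<integral>\<^sup>+x. ennreal (h x) * indicator J x \<partial>lborel)"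
      by (subst nn_integral_real_affine[of "\<lambda>x. ennreal (h x) * indicator J x" "1/2" "t0/2"]) auto
    also have "(\<integral>\<^sup>+x. ennreal (h x) * indicator J x \<partial>lborel) = emeasure \<nu> J"
      unfolding \<nu>_def by (subst emeasure_density) auto
    finally show ?thesis .
  qed
  then have "measure \<nu> {x. R x < R t0} \<le> 2 * measure \<nu> J"
    by (simp add: \<nu>.emeasure_eq_measure flip: ennreal_numeral ennreal_mult)
  moreover have "1 \<le> measure \<nu> {x. R x < R t0} + measure \<nu> J"
  proof -
    have "{x. R x < R t0} \<union> J = UNIV" using R_nonneg[of t0] by (auto simp: J_def)
    then show ?thesis
      using measure_Un_le[of "{x. R x < R t0}" \<nu> J] \<nu>.prob_space by simp
  qed
  ultimately have J: "1 \<le> 3 * measure \<nu> J" by linarith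
  have "(R t0)\<^sup>2 \<le> 12 * ((R t0 / 2)\<^sup>2 * measure \<nu> J)"
    using mult_left_mono[OF J, of "(R t0)\<^sup>2"] by (simp add: power_divide mult_ac)
  then have "ennreal ((R t0)\<^sup>2) \<le> 12 * (ennreal ((R t0 / 2)\<^sup>2) * emeasure \<nu> J)"
    by (simp add: \<nu>.emeasure_eq_measure ennreal_leI flip: ennreal_numeral ennreal_mult)
  also have "ennreal ((R t0 / 2)\<^sup>2) * emeasure \<nu> J = (\<integral>\<^sup>+x. ennreal ((R t0 / 2)\<^sup>2) * indicator J x \<partial>\<nu>)"
    by (subst nn_integral_cmult_indicator) auto
  also have "12 * \<dots> \<le> 12 * (\<integral>\<^sup>+x. ennreal ((R x)\<^sup>2) \<partial>\<nu>)"
  proof (intro mult_left_mono nn_integral_mono)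
    fix x
    show "ennreal ((R t0 / 2)\<^sup>2) * indicator J x \<le> ennreal ((R x)\<^sup>2)"
      using R_nonneg[of t0] by (auto simp: J_def split: split_indicator intro!: ennreal_leI power_mono)
  qed simp
  finally show ?thesis .
qed

text \<open>The first bound follows from the monotone quotient of tail and density and from its value at the
  median, at most \<open>(1/2) \<cdot> 16 \<sigma>\<close>.  For the second, the tail beyond \<open>y\<close> seen from the median is the lighter of the
  two sides of \<open>y\<close>, hence at most the side on which the profile decreases, where the tangent line
  bounds the tail.\<close>

lemma tail_le_weight:
  assumes m: "m \<in> S" "half_prob 1 m = 1/2" "half_prob (-1) m = 1/2"
    and "0 < \<sigma>" and second_moment: "(\<integral>\<^sup>+x. ennreal (x\<^sup>2) \<partial>\<nu>) \<le> ennreal (\<sigma>\<^sup>2)"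
    and \<epsilon>: "\<epsilon> = 1 \<or> \<epsilon> = -1" and y: "y \<in> S" "0 \<le> \<epsilon> * (y - m)"
  shows "half_prob \<epsilon> y \<le> 8 * \<sigma> * h y"
    and "half_prob \<epsilon> y * \<bar>D y\<bar> \<le> R y / (real n + 1) * h y"
proof -
  have "half_prob \<epsilon> y * h m \<le> 1/2 * h y"
  proof -
    have "half_prob \<epsilon> m = 1/2" using \<epsilon> m by auto
    then show ?thesis using half_prob_compare[OF \<epsilon> m(1) y] by (simp only:)
  qed
  moreover have "half_prob \<epsilon> y * 1 \<le> half_prob \<epsilon> y * (16 * \<sigma> * h m)"
    using density_at_median[OF m \<open>0 < \<sigma>\<close> second_moment] by (intro mult_left_mono) (auto simp: half_prob_def)
  ultimately have "half_prob \<epsilon> y \<le> 16 * \<sigma> * (1/2 * h y)"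
    using \<open>0 < \<sigma>\<close> by (smt (verit) mult.commute mult.left_commute mult_left_mono)
  then show "half_prob \<epsilon> y \<le> 8 * \<sigma> * h y" by simp
  have le_other: "half_prob \<epsilon> y \<le> half_prob (- \<epsilon>) y"
    using half_prob_antimono[OF \<epsilon> y(2)] \<epsilon> m half_prob_sum[of y] by auto
  show "half_prob \<epsilon> y * \<bar>D y\<bar> \<le> R y / (real n + 1) * h y"
  proof (cases "D y = 0")
    case True
    then show ?thesis using R_nonneg h_nonneg by simp
  next
    case False
    \<comment> \<open>The half line on which the profile decreases away from \<open>y\<close>.\<close>
    define \<delta> :: real where "\<delta> = - sgn (D y)"
    have \<delta>: "\<delta> = 1 \<or> \<delta> = -1" using False by (auto simp: \<delta>_def sgn_if)
    have "half_prob \<delta> y * \<bar>D y\<bar> \<le> R y / (real n + 1) * h y"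
    proof (rule half_prob_le_slope[OF \<delta> y(1)])
      fix x assume "x \<in> S"
      then show "R x \<le> R y - \<bar>D y\<bar> * (\<delta> * (x - y))"
        using right_slope_supergradient[OF open_S concave_R y(1), of x] False
        by (cases "0 < D y") (simp_all add: \<delta>_def sgn_if abs_if algebra_simps)
    qed (use False in simp)
    moreover have "half_prob \<epsilon> y \<le> half_prob \<delta> y"
      using \<epsilon> \<delta> le_other by auto
    ultimately show ?thesis
      by (smt (verit) abs_ge_zero mult_right_mono)
  qed
qed

text \<open>The weight is the smaller of the two bounds of \<open>tail_le_weight\<close>, so that \<open>w\<close> and \<open>w |D|\<close> are both bounded and
  the factor \<open>1 + D\<^sup>2\<close> coming from the chain rule disappears.\<close>

lemma osc_le_gradient:
  assumes "0 < \<sigma>" and second_moment: "(\<integral>\<^sup>+x. ennreal (x\<^sup>2) \<partial>\<nu>) \<le> ennreal (\<sigma>\<^sup>2)"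
    and M: "\<And>x. x \<in> S \<Longrightarrow> R x \<le> M" "0 < M"
    and u: "continuous_on S u" "\<And>x. x \<in> S \<Longrightarrow> \<bar>u x\<bar> \<le> B"
    and [measurable]: "u' \<in> borel_measurable borel" "g \<in> borel_measurable borel"
    and deriv: "\<And>x. x \<in> S \<Longrightarrow> (u has_real_derivative u' x) (at_right x)"
    and deriv_bd: "\<And>a b. {a..b} \<subseteq> S \<Longrightarrow> \<exists>L. \<forall>x\<in>{a..b}. \<bar>u' x\<bar> \<le> L"
    and grad: "\<And>x. x \<in> S \<Longrightarrow> (u' x)\<^sup>2 \<le> (1 + (D x)\<^sup>2) * g x"
  shows "osc \<nu> u \<le> ennreal (16 * (64 * \<sigma>\<^sup>2 + (M / (real n + 1))\<^sup>2)) * (\<integral>\<^sup>+x. ennreal (g x) \<partial>\<nu>)"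
proof -
  obtain m where m: "m \<in> S" "half_prob 1 m = 1/2" "half_prob (-1) m = 1/2"
    using median_exists by blast
  define w where "w y = (if D y = 0 then 8 * \<sigma> else min (8 * \<sigma>) (M / (real n + 1) / \<bar>D y\<bar>))" for y
  have [measurable]: "w \<in> borel_measurable borel" unfolding w_def[abs_def] by measurable
  have w_nonneg: "0 \<le> w y" for y using \<open>0 < \<sigma>\<close> M(2) by (simp add: w_def)
  define K where "K = 64 * \<sigma>\<^sup>2 + (M / (real n + 1))\<^sup>2"
  have "0 \<le> K" by (simp add: K_def)
  have w_bound: "(w y)\<^sup>2 * (1 + (D y)\<^sup>2) \<le> K" for y
  proof -
    have "(w y)\<^sup>2 \<le> (8 * \<sigma>)\<^sup>2" using w_nonneg by (intro power_mono) (auto simp: w_def)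
    moreover have "(w y * \<bar>D y\<bar>)\<^sup>2 \<le> (M / (real n + 1))\<^sup>2"
    proof (intro power_mono)
      have "min (8 * \<sigma>) (M / (real n + 1) / \<bar>D y\<bar>) * \<bar>D y\<bar> \<le> M / (real n + 1) / \<bar>D y\<bar> * \<bar>D y\<bar>"
        by (intro mult_right_mono) auto
      then show "w y * \<bar>D y\<bar> \<le> M / (real n + 1)" using M(2) by (auto simp: w_def)
    qed (use w_nonneg in simp)
    ultimately show ?thesis by (simp add: K_def power_mult_distrib algebra_simps)
  qed
  have "osc \<nu> u \<le> 16 * (\<integral>\<^sup>+x. ennreal ((u' x)\<^sup>2 * (w x)\<^sup>2) \<partial>\<nu>)"
    unfolding \<nu>_def
  proof (rule osc_le_weighted_gradient[where S = S and m = m and B = B])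
    show "(\<integral>\<^sup>+x. ennreal (h x) * indicator (closed_segment m x) y \<partial>lborel) \<le> ennreal (w y * h y)"
      if "y \<in> S" "y \<noteq> m" for y
    proof -
      define \<epsilon> where "\<epsilon> = sgn (y - m)"
      have \<epsilon>: "\<epsilon> = 1 \<or> \<epsilon> = -1" "0 \<le> \<epsilon> * (y - m)" using that by (auto simp: \<epsilon>_def sgn_if)
      have "(\<integral>\<^sup>+x. ennreal (h x) * indicator (closed_segment m x) y \<partial>lborel)
          \<le> (\<integral>\<^sup>+x. ennreal (h x) * indicator {x. 0 \<le> \<epsilon> * (x - y)} x \<partial>lborel)"
        using that(2) by (intro nn_integral_mono mult_left_mono)
          (auto simp: \<epsilon>_def sgn_if closed_segment_eq_real_ivl split: split_indicator if_splits)
      also have "\<dots> = emeasure \<nu> {x. 0 \<le> \<epsilon> * (x - y)}"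
        unfolding \<nu>_def by (subst emeasure_density) auto
      also have "\<dots> = ennreal (half_prob \<epsilon> y)"
        by (simp add: half_prob_def \<nu>.emeasure_eq_measure)
      also have "\<dots> \<le> ennreal (w y * h y)"
      proof (rule ennreal_leI)
        note tw = tail_le_weight[OF m \<open>0 < \<sigma>\<close> second_moment \<epsilon>(1) that(1) \<epsilon>(2)]
        have "R y / (real n + 1) * h y \<le> M / (real n + 1) * h y"
          by (intro mult_right_mono divide_right_mono M h_nonneg that) auto
        then have "half_prob \<epsilon> y \<le> M / (real n + 1) * h y / \<bar>D y\<bar>" if "D y \<noteq> 0"
          using tw(2) that by (subst pos_le_divide_eq) auto
        then show "half_prob \<epsilon> y \<le> w y * h y"
          using tw(1) by (auto simp: w_def min_def)
      qed
      finally show ?thesis .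
    qed
  qed (use m u deriv open_S interval_S h_nonneg h_zero nn_integral_h deriv_bd w_nonneg in simp_all)
  also have "\<dots> \<le> 16 * (\<integral>\<^sup>+x. ennreal K * ennreal (g x) \<partial>\<nu>)"
  proof (intro mult_left_mono nn_integral_mono_AE, use AE_\<nu>_S in eventually_elim)
    fix x assume "x \<in> S"
    have "0 < 1 + (D x)\<^sup>2" by (simp add: add_pos_nonneg)
    moreover have "0 \<le> (1 + (D x)\<^sup>2) * g x" using grad[OF \<open>x \<in> S\<close>] by (meson order_trans zero_le_power2)
    ultimately have "0 \<le> g x" by (simp add: zero_le_mult_iff)
    have "(u' x)\<^sup>2 * (w x)\<^sup>2 \<le> ((1 + (D x)\<^sup>2) * g x) * (w x)\<^sup>2"
      by (intro mult_right_mono grad \<open>x \<in> S\<close>) simp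
    also have "\<dots> = ((w x)\<^sup>2 * (1 + (D x)\<^sup>2)) * g x" by simp
    also have "\<dots> \<le> K * g x"
      by (intro mult_right_mono w_bound \<open>0 \<le> g x\<close>)
    finally show "ennreal ((u' x)\<^sup>2 * (w x)\<^sup>2) \<le> ennreal K * ennreal (g x)"
      using \<open>0 \<le> g x\<close> \<open>0 \<le> K\<close> by (simp add: ennreal_leI flip: ennreal_mult)
  qed simp
  also have "\<dots> = ennreal (16 * K) * (\<integral>\<^sup>+x. ennreal (g x) \<partial>\<nu>)"
    using \<open>0 \<le> K\<close> by (simp add: nn_integral_cmult ennreal_mult' mult.assoc[symmetric])
  finally show ?thesis unfolding K_def .
qed

end

section \<open>Lebesgue measure in orthonormal coordinates\<close>

abbreviation lebesgue_PiM :: "nat set \<Rightarrow> (nat \<Rightarrow> real) measure" where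
  "lebesgue_PiM I \<equiv> PiM I (\<lambda>_. lborel)"

interpretation lborel_PiM: product_sigma_finite "\<lambda>_::nat. lborel :: real measure"
  by standard

lemma nn_integral_PiM_affine:
  assumes "finite I" "F \<in> borel_measurable (lebesgue_PiM I)" "c \<noteq> 0"
  shows "(\<integral>\<^sup>+x. F x \<partial>lebesgue_PiM I) = ennreal (\<bar>c\<bar> ^ card I) * (\<integral>\<^sup>+x. F (\<lambda>i\<in>I. a i + c * x i) \<partial>lebesgue_PiM I)"
  using assms(1,2)
proof (induction I arbitrary: F rule: finite_induct)
  case empty
  then show ?case by (simp add: PiM_empty nn_integral_count_space_finite)
next
  case (insert i I)
  note [measurable] = insert.prems
  have [measurable]: "(\<lambda>p. (fst p)(i := snd p)) \<in> measurable (lebesgue_PiM I \<Otimes>\<^sub>M lborel) (lebesgue_PiM (insert i I))"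
    by measurable
  have F2: "(\<lambda>z. F ((u z)(i := v z))) \<in> borel_measurable L"
    if "u \<in> measurable L (lebesgue_PiM I)" "v \<in> borel_measurable L" for u v and L :: "'z measure"
    using that by (intro measurable_compose[OF measurable_fun_upd insert.prems]) auto
  have "(\<integral>\<^sup>+x. F x \<partial>lebesgue_PiM (insert i I)) = (\<integral>\<^sup>+x. \<integral>\<^sup>+t. F (x(i := t)) \<partial>lborel \<partial>lebesgue_PiM I)"
    by (rule lborel_PiM.product_nn_integral_insert) (use insert in auto)
  also have "\<dots> = (\<integral>\<^sup>+x. ennreal \<bar>c\<bar> * (\<integral>\<^sup>+t. F (x(i := a i + c * t)) \<partial>lborel) \<partial>lebesgue_PiM I)"
    using assms(3) by (intro nn_integral_cong nn_integral_real_affine F2) auto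
  also have "\<dots> = ennreal \<bar>c\<bar> * (\<integral>\<^sup>+x. \<integral>\<^sup>+t. F (x(i := a i + c * t)) \<partial>lborel \<partial>lebesgue_PiM I)"
    by (intro nn_integral_cmult lborel.borel_measurable_nn_integral, unfold split_beta', intro F2) measurable
  also have "(\<integral>\<^sup>+x. \<integral>\<^sup>+t. F (x(i := a i + c * t)) \<partial>lborel \<partial>lebesgue_PiM I)
      = ennreal (\<bar>c\<bar> ^ card I) * (\<integral>\<^sup>+x. \<integral>\<^sup>+t. F ((\<lambda>j\<in>I. a j + c * x j)(i := a i + c * t)) \<partial>lborel \<partial>lebesgue_PiM I)"
    by (intro insert.IH lborel.borel_measurable_nn_integral, unfold split_beta', intro F2) measurable
  also have "(\<integral>\<^sup>+x. \<integral>\<^sup>+t. F ((\<lambda>j\<in>I. a j + c * x j)(i := a i + c * t)) \<partial>lborel \<partial>lebesgue_PiM I)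
      = (\<integral>\<^sup>+x. \<integral>\<^sup>+t. F (\<lambda>j\<in>insert i I. a j + c * (x(i := t)) j) \<partial>lborel \<partial>lebesgue_PiM I)"
    using insert.hyps by (intro nn_integral_cong arg_cong[where f = F]) (auto simp: restrict_def)
  also have "\<dots> = (\<integral>\<^sup>+x. F (\<lambda>j\<in>insert i I. a j + c * x j) \<partial>lebesgue_PiM (insert i I))"
    by (rule lborel_PiM.product_nn_integral_insert[symmetric]) (use insert in auto)
  finally show ?case
    by (simp only: card_insert_disjoint[OF insert.hyps] power_Suc mult.assoc
        ennreal_mult[OF abs_ge_zero zero_le_power[OF abs_ge_zero]])
qed

text \<open>The rows of a square matrix with orthonormal columns are orthonormal.  Without matrices: the
  residual in Bessel's inequality for the \<open>i\<close>th unit vector has square norm \<open>1 - (\<Sum>j<m. (e j i)\<^sup>2)\<close>, and these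
  numbers sum to \<open>m - m = 0\<close>.\<close>

lemma orthonormal_completeness:
  assumes "orthonormal_basis m e" "i < m" "k < m"
  shows "(\<Sum>j<m. e j i * e j k) = (if i = k then 1 else 0)"
proof -
  have ON: "(\<Sum>i<m. e j i * e k i) = (if j = k then 1 else 0)" if "j < m" "k < m" for j k
    using assms(1) that by (auto simp: orthonormal_basis_def scalar_product_def)
  \<comment> \<open>The coordinates of the residual of Bessel's inequality for the \<open>i\<close>th unit vector.\<close>
  define r where "r i k = (if i = k then 1 else 0) - (\<Sum>j<m. e j i * e j k)" for i k
  have "(\<Sum>k<m. (r i k)\<^sup>2) = 1 - (\<Sum>j<m. (e j i)\<^sup>2)" if "i < m" for i
  proof -
    have "(\<Sum>k<m. (\<Sum>j<m. e j i * e j k)\<^sup>2) = (\<Sum>k<m. \<Sum>j<m. \<Sum>l<m. e j i * e l i * (e j k * e l k))"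
      by (simp add: power2_eq_square sum_product mult_ac)
    also have "\<dots> = (\<Sum>j<m. \<Sum>k<m. \<Sum>l<m. e j i * e l i * (e j k * e l k))"
      by (rule sum.swap)
    also have "\<dots> = (\<Sum>j<m. \<Sum>l<m. \<Sum>k<m. e j i * e l i * (e j k * e l k))"
      by (intro sum.cong refl sum.swap)
    also have "\<dots> = (\<Sum>j<m. \<Sum>l<m. e j i * e l i * (if j = l then 1 else 0))"
      by (intro sum.cong refl) (simp add: ON flip: sum_distrib_left)
    also have "\<dots> = (\<Sum>j<m. (e j i)\<^sup>2)"
      by (simp add: power2_eq_square if_distrib[of "\<lambda>x. _ * x"] cong: if_cong)
    finally have sq: "(\<Sum>k<m. (\<Sum>j<m. e j i * e j k)\<^sup>2) = (\<Sum>j<m. (e j i)\<^sup>2)" .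
    have "(\<Sum>k<m. (r i k)\<^sup>2) = (\<Sum>k<m. (if i = k then 1 - 2 * (\<Sum>j<m. (e j i)\<^sup>2) else 0) + (\<Sum>j<m. e j i * e j k)\<^sup>2)"
      by (intro sum.cong refl) (auto simp: r_def power2_diff power2_eq_square[of "e _ _"])
    also have "\<dots> = 1 - (\<Sum>j<m. (e j i)\<^sup>2)"
      using that by (simp add: sum.distrib sq)
    finally show ?thesis .
  qed
  then have "(\<Sum>i<m. \<Sum>k<m. (r i k)\<^sup>2) = (\<Sum>i<m. 1 - (\<Sum>j<m. (e j i)\<^sup>2))"
    by simp
  also have "\<dots> = real m - (\<Sum>j<m. \<Sum>i<m. e j i * e j i)"
    by (simp add: sum_subtractf power2_eq_square) (rule sum.swap)
  also have "\<dots> = 0" by (simp add: ON)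
  finally have "(r i k)\<^sup>2 = 0"
    using assms(2,3) by (simp add: sum_nonneg_eq_0_iff sum_nonneg)
  then show ?thesis by (simp add: r_def)
qed

definition from_coords :: "nat \<Rightarrow> (nat \<Rightarrow> nat \<Rightarrow> real) \<Rightarrow> (nat \<Rightarrow> real) \<Rightarrow> nat \<Rightarrow> real" where
  "from_coords m e c = (\<lambda>i\<in>{..<m}. \<Sum>j<m. c j * e j i)"

lemma from_coords_in_Rn: "from_coords m e c \<in> Rn m"
  by (auto simp: from_coords_def Rn_def)

lemma scalar_product_from_coords:
  assumes "orthonormal_basis m e" "k < m"
  shows "scalar_product m (from_coords m e c) (e k) = c k"
proof -
  have "scalar_product m (from_coords m e c) (e k) = (\<Sum>i<m. \<Sum>j<m. c j * (e j i * e k i))"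
    by (simp add: scalar_product_def from_coords_def sum_distrib_left sum_distrib_right mult_ac)
  also have "\<dots> = (\<Sum>j<m. c j * scalar_product m (e j) (e k))"
    unfolding scalar_product_def sum_distrib_left by (rule sum.swap)
  also have "\<dots> = (\<Sum>j<m. c j * (if j = k then 1 else 0))"
    using assms by (intro sum.cong refl) (auto simp: orthonormal_basis_def)
  also have "\<dots> = c k" using assms(2) by (simp add: if_distrib[of "\<lambda>x. _ * x"] cong: if_cong)
  finally show ?thesis .
qed

lemma from_coords_scalar_product:
  assumes "orthonormal_basis m e" "y \<in> Rn m"
  shows "from_coords m e (\<lambda>j. scalar_product m y (e j)) = y"
proof
  fix i
  show "from_coords m e (\<lambda>j. scalar_product m y (e j)) i = y i"
  proof (cases "i < m")
    case True
    then have "from_coords m e (\<lambda>j. scalar_product m y (e j)) i = (\<Sum>j<m. \<Sum>k<m. y k * (e j i * e j k))"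
      by (simp add: from_coords_def scalar_product_def sum_distrib_left sum_distrib_right mult_ac)
    also have "\<dots> = (\<Sum>k<m. \<Sum>j<m. y k * (e j i * e j k))" by (rule sum.swap)
    also have "\<dots> = (\<Sum>k<m. y k * (if i = k then 1 else 0))"
      using True by (intro sum.cong refl) (simp add: orthonormal_completeness[OF assms(1)] flip: sum_distrib_left)
    also have "\<dots> = y i" using True by (simp add: if_distrib[of "\<lambda>x. _ * x"] cong: if_cong)
    finally show ?thesis .
  next
    case False
    then show ?thesis using assms(2) by (auto simp: from_coords_def Rn_def PiE_def extensional_def)
  qed
qed

lemma sum_squares_from_coords:
  assumes "orthonormal_basis m e"
  shows "(\<Sum>i<m. (from_coords m e c i)\<^sup>2) = (\<Sum>j<m. (c j)\<^sup>2)"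
proof -
  have "(\<Sum>i<m. (from_coords m e c i)\<^sup>2) = (\<Sum>i<m. \<Sum>j<m. c j * (from_coords m e c i * e j i))"
    by (intro sum.cong refl) (simp add: power2_eq_square from_coords_def sum_distrib_left sum_distrib_right mult_ac)
  also have "\<dots> = (\<Sum>j<m. c j * scalar_product m (from_coords m e c) (e j))"
    unfolding scalar_product_def sum_distrib_left by (rule sum.swap)
  also have "\<dots> = (\<Sum>j<m. (c j)\<^sup>2)"
    by (intro sum.cong refl) (simp add: scalar_product_from_coords[OF assms] power2_eq_square)
  finally show ?thesis .
qed

lemma borel_measurable_from_coords[measurable]:
  "from_coords m e \<in> measurable (lebesgue_PiM {..<m}) (lebesgue_PiM {..<m})"
  unfolding from_coords_def[abs_def] by measurable

text \<open>The argument for uniqueness of Haar measure.  With the rotation invariant Gaussian density \<open>g\<close>, the double integral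
  of \<open>F y * g (y - Q c)\<close> is the integral of \<open>F\<close> when \<open>c\<close> is integrated first, and that of \<open>F \<circ> Q\<close> when
  \<open>y\<close> is translated by \<open>Q c\<close> first.  Both steps rest on the invariance of
  Lebesgue measure under translations.\<close>

lemma nn_integral_rotation:
  assumes e: "orthonormal_basis m e" and F[measurable]: "F \<in> borel_measurable (lebesgue_PiM {..<m})"
  shows "(\<integral>\<^sup>+c. F (from_coords m e c) \<partial>lebesgue_PiM {..<m}) = (\<integral>\<^sup>+y. F y \<partial>lebesgue_PiM {..<m})"
proof -
  let ?L = "lebesgue_PiM {..<m}" and ?Q = "from_coords m e"
  define add where "add s x y = (\<lambda>i\<in>{..<m}. x i + s * y i)" for s :: real and x y :: "nat \<Rightarrow> real"
  define g where "g y = (\<Prod>i<m. ennreal (std_normal_density (y i)))" for y :: "nat \<Rightarrow> real"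
  interpret L: sigma_finite_measure ?L by (rule lborel_PiM.sigma_finite) simp
  interpret LL: pair_sigma_finite ?L ?L ..
  have [measurable]: "(\<lambda>p. add s (u p) (v p)) \<in> measurable M ?L"
    if u: "u \<in> measurable M ?L" and v: "v \<in> measurable M ?L" for s u v and M :: "'z measure"
    unfolding add_def
  proof (rule measurable_restrict)
    fix i assume "i \<in> {..<m}"
    then have [measurable]: "(\<lambda>p. u p i) \<in> borel_measurable M" "(\<lambda>p. v p i) \<in> borel_measurable M"
      using measurable_compose[OF u measurable_component_singleton[of i "{..<m}"]]
        measurable_compose[OF v measurable_component_singleton[of i "{..<m}"]] by auto
    show "(\<lambda>p. u p i + s * v p i) \<in> measurable M lborel" by measurable
  qed
  have [measurable]: "g \<in> borel_measurable ?L" unfolding g_def by measurable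
  have g_int: "(\<integral>\<^sup>+y. g y \<partial>?L) = 1"
    unfolding g_def
    by (subst lborel_PiM.product_nn_integral_prod) (auto simp: nn_integral_eq_integral)
  have g_alt: "g y = ennreal ((1 / sqrt (2 * pi)) ^ m * exp (- (\<Sum>i<m. (y i)\<^sup>2) / 2))" for y
  proof -
    have "(\<Prod>i<m. exp (- (y i)\<^sup>2 / 2)) = exp (- (\<Sum>i<m. (y i)\<^sup>2) / 2)"
      by (simp add: exp_sum[symmetric] sum_negf sum_divide_distrib)
    then show ?thesis
      unfolding g_def by (subst prod_ennreal) (simp_all only: std_normal_density_def prod.distrib prod_constant card_lessThan, simp)
  qed
  have g_Q: "g (?Q c) = g c" for c
    by (simp add: g_alt sum_squares_from_coords[OF e])
  have Q_add: "add s (?Q w) (?Q c) = ?Q (add s w c)" for s w c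
    by (auto simp: add_def from_coords_def fun_eq_iff sum.distrib sum_distrib_left algebra_simps intro!: sum.cong)
  have surj: "\<exists>w\<in>space ?L. y = ?Q w" if "y \<in> space ?L" for y
  proof
    let ?w = "\<lambda>j\<in>{..<m}. scalar_product m y (e j)"
    have "?Q ?w = ?Q (\<lambda>j. scalar_product m y (e j))" by (simp add: from_coords_def)
    then show "y = ?Q ?w" using from_coords_scalar_product[OF e, of y] that by (simp add: Rn_def space_PiM)
  qed (simp add: space_PiM)
  have shift: "(\<integral>\<^sup>+x. G (add s w x) \<partial>?L) = (\<integral>\<^sup>+x. G x \<partial>?L)" if "G \<in> borel_measurable ?L" "\<bar>s\<bar> = 1" for G s w
    using nn_integral_PiM_affine[of "{..<m}" G s w] that by (auto simp: add_def)
  have add_cancel: "add (-1) (add 1 y z) z = y" if "y \<in> space ?L" for y z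
    using that by (auto simp: add_def space_PiM PiE_def extensional_def fun_eq_iff)
  have add_commute: "add 1 z y = add 1 y z" for y z
    by (auto simp: add_def fun_eq_iff)
  have "(\<integral>\<^sup>+y. F y \<partial>?L) = (\<integral>\<^sup>+y. \<integral>\<^sup>+c. F y * g (add (-1) y (?Q c)) \<partial>?L \<partial>?L)"
  proof (rule nn_integral_cong)
    fix y assume "y \<in> space ?L"
    then obtain w where [measurable]: "w \<in> space ?L" and y: "y = ?Q w" using surj by blast
    have "(\<integral>\<^sup>+c. F y * g (add (-1) y (?Q c)) \<partial>?L) = F y * (\<integral>\<^sup>+c. g (add (-1) w c) \<partial>?L)"
      unfolding y Q_add g_Q by (rule nn_integral_cmult) measurable
    then show "F y = (\<integral>\<^sup>+c. F y * g (add (-1) y (?Q c)) \<partial>?L)"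
      by (simp add: shift g_int)
  qed
  also have "\<dots> = (\<integral>\<^sup>+c. \<integral>\<^sup>+y. F y * g (add (-1) y (?Q c)) \<partial>?L \<partial>?L)"
    by (rule LL.Fubini') measurable
  also have "\<dots> = (\<integral>\<^sup>+c. \<integral>\<^sup>+y. F (add 1 y (?Q c)) * g y \<partial>?L \<partial>?L)"
  proof (rule nn_integral_cong)
    fix c assume [measurable]: "c \<in> space ?L"
    have [measurable]: "?Q c \<in> space ?L" using from_coords_in_Rn by (auto simp: space_PiM Rn_def)
    have "(\<integral>\<^sup>+y. F y * g (add (-1) y (?Q c)) \<partial>?L)
        = (\<integral>\<^sup>+y. F (add 1 (?Q c) y) * g (add (-1) (add 1 (?Q c) y) (?Q c)) \<partial>?L)"
      by (rule shift[symmetric, of "\<lambda>y. F y * g (add (-1) y (?Q c))"]) auto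
    also have "\<dots> = (\<integral>\<^sup>+y. F (add 1 y (?Q c)) * g y \<partial>?L)"
      by (intro nn_integral_cong) (simp add: add_cancel add_commute[of "?Q c"])
    finally show "(\<integral>\<^sup>+y. F y * g (add (-1) y (?Q c)) \<partial>?L) = (\<integral>\<^sup>+y. F (add 1 y (?Q c)) * g y \<partial>?L)" .
  qed
  also have "\<dots> = (\<integral>\<^sup>+y. \<integral>\<^sup>+c. F (add 1 y (?Q c)) * g y \<partial>?L \<partial>?L)"
    by (rule LL.Fubini'[symmetric]) measurable
  also have "\<dots> = (\<integral>\<^sup>+y. (\<integral>\<^sup>+c. F (?Q c) \<partial>?L) * g y \<partial>?L)"
  proof (rule nn_integral_cong)
    fix y assume "y \<in> space ?L"
    then obtain w where [measurable]: "w \<in> space ?L" and y: "y = ?Q w" using surj by blast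
    have "(\<integral>\<^sup>+c. F (add 1 y (?Q c)) * g y \<partial>?L) = (\<integral>\<^sup>+c. F (?Q (add 1 w c)) \<partial>?L) * g y"
      unfolding y Q_add by (rule nn_integral_multc) measurable
    also have "(\<integral>\<^sup>+c. F (?Q (add 1 w c)) \<partial>?L) = (\<integral>\<^sup>+c. F (?Q c) \<partial>?L)"
      by (rule shift) auto
    finally show "(\<integral>\<^sup>+c. F (add 1 y (?Q c)) * g y \<partial>?L) = (\<integral>\<^sup>+c. F (?Q c) \<partial>?L) * g y" .
  qed
  also have "\<dots> = (\<integral>\<^sup>+c. F (?Q c) \<partial>?L)"
    by (simp add: nn_integral_cmult g_int)
  finally show ?thesis ..
qed

section \<open>The uniform law on the ball from Gaussian and exponential variables\<close>

abbreviation sq_norm :: "nat set \<Rightarrow> (nat \<Rightarrow> real) \<Rightarrow> real" where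
  "sq_norm I z \<equiv> (\<Sum>i\<in>I. (z i)\<^sup>2)"

lemma borel_measurable_sq_norm[measurable (raw)]:
  assumes "u \<in> measurable L (lebesgue_PiM I)"
  shows "(\<lambda>p. sq_norm I (u p)) \<in> borel_measurable L"
proof (intro borel_measurable_sum borel_measurable_power)
  fix i assume "i \<in> I"
  then show "(\<lambda>p. u p i) \<in> borel_measurable L"
    using measurable_compose[OF assms measurable_component_singleton[of i I]] by auto
qed

lemma measurable_restrict_divide[measurable (raw)]:
  assumes u: "u \<in> measurable L (lebesgue_PiM I)" and [measurable]: "v \<in> borel_measurable L"
  shows "(\<lambda>p. \<lambda>i\<in>I. u p i / v p) \<in> measurable L (lebesgue_PiM I)"
proof (rule measurable_restrict)
  fix i assume "i \<in> I"
  then have [measurable]: "(\<lambda>p. u p i) \<in> borel_measurable L"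
    using measurable_compose[OF u measurable_component_singleton[of i I]] by auto
  show "(\<lambda>p. u p i / v p) \<in> measurable L lborel" by measurable
qed

text \<open>In the variable \<open>q = |z|\<^sup>2 + \<rho>\<close> the domain becomes \<open>|z|\<^sup>2 \<le> q\<close>; scaling \<open>z = sqrt q \<cdot> y\<close> then separates \<open>q\<close>
  from the point \<open>y\<close> of the unit ball.  This is where independence of direction and radius comes from.\<close>

lemma nn_integral_radial_fibration:
  assumes I: "finite I" and [measurable]: "\<phi> \<in> borel_measurable (lebesgue_PiM I)" "k \<in> borel_measurable borel"
  shows "(\<integral>\<^sup>+z. \<integral>\<^sup>+\<rho>. \<phi> (\<lambda>i\<in>I. z i / sqrt (sq_norm I z + \<rho>)) * k (sq_norm I z + \<rho>) * indicator {0..} \<rho> \<partial>lborel \<partial>lebesgue_PiM I)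
    = (\<integral>\<^sup>+q. ennreal (sqrt q ^ card I) * k q * indicator {0..} q \<partial>lborel)
      * (\<integral>\<^sup>+y. \<phi> y * indicator {y. sq_norm I y \<le> 1} y \<partial>lebesgue_PiM I)"
proof -
  let ?L = "lebesgue_PiM I"
  let ?F = "\<lambda>z \<rho>. \<phi> (\<lambda>i\<in>I. z i / sqrt (sq_norm I z + \<rho>)) * k (sq_norm I z + \<rho>) * indicator {0..} \<rho>" and ?f = "\<lambda>z q. \<phi> (\<lambda>i\<in>I. z i / sqrt q) * k q * indicator {z. sq_norm I z \<le> q} z"
  let ?y = "\<lambda>q y. \<lambda>i\<in>I. 0 + sqrt q * y i" and ?y' = "\<lambda>q y. \<lambda>i\<in>I. (\<lambda>i\<in>I. 0 + sqrt q * y i) i / sqrt q" and ?B = "\<integral>\<^sup>+y. \<phi> y * indicator {y. sq_norm I y \<le> 1} y \<partial>?L"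
  interpret L: sigma_finite_measure ?L by (rule lborel_PiM.sigma_finite) (rule I)
  interpret LL: pair_sigma_finite ?L "lborel :: real measure" ..
  have [measurable]: "(\<lambda>p. indicator {z. sq_norm I z \<le> w p} (u p) :: ennreal) \<in> borel_measurable M"
    if [measurable]: "u \<in> measurable M ?L" "w \<in> borel_measurable M" for u w and M :: "'z measure"
  proof -
    have "(\<lambda>p. indicator {z. sq_norm I z \<le> w p} (u p) :: ennreal) = indicator {p. sq_norm I (u p) \<le> w p}"
      by (auto simp: fun_eq_iff split: split_indicator)
    also have "\<dots> \<in> borel_measurable M" by (rule borel_measurable_indicator') measurable
    finally show ?thesis .
  qed
  have "(\<integral>\<^sup>+z. \<integral>\<^sup>+\<rho>. ?F z \<rho> \<partial>lborel \<partial>?L)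
      = (\<integral>\<^sup>+z. \<integral>\<^sup>+q. ?f z q \<partial>lborel \<partial>?L)"
  proof (rule nn_integral_cong)
    fix z assume [measurable]: "z \<in> space ?L"
    have "(\<integral>\<^sup>+\<rho>. ?F z \<rho> \<partial>lborel)
        = ennreal \<bar>1\<bar> * (\<integral>\<^sup>+q. \<phi> (\<lambda>i\<in>I. z i / sqrt (sq_norm I z + (- sq_norm I z + 1 * q))) * k (sq_norm I z + (- sq_norm I z + 1 * q)) * indicator {0..} (- sq_norm I z + 1 * q) \<partial>lborel)"
    proof (rule nn_integral_real_affine)
      show "(\<lambda>\<rho>. ?F z \<rho>) \<in> borel_measurable borel"
        by measurable
    qed simp
    also have "\<dots> = (\<integral>\<^sup>+q. ?f z q \<partial>lborel)"
    proof -
      have "sq_norm I z + (- sq_norm I z + 1 * q) = q"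
        and "indicator {0..} (- sq_norm I z + 1 * q) = (indicator {z. sq_norm I z \<le> q} z :: ennreal)" for q
        by (auto simp: indicator_def)
      then show ?thesis by (simp only: abs_one ennreal_1 mult_1)
    qed
    finally show "(\<integral>\<^sup>+\<rho>. ?F z \<rho> \<partial>lborel)
      = (\<integral>\<^sup>+q. ?f z q \<partial>lborel)" .
  qed
  also have "\<dots> = (\<integral>\<^sup>+q. \<integral>\<^sup>+z. ?f z q \<partial>?L \<partial>lborel)"
  proof (rule LL.Fubini'[symmetric])
    have "(\<lambda>p. \<phi> (\<lambda>i\<in>I. fst p i / sqrt (snd p)) * k (snd p) * indicator {z. sq_norm I z \<le> snd p} (fst p)) \<in> borel_measurable (?L \<Otimes>\<^sub>M lborel)"
      by measurable
    then show "(\<lambda>(z, q). ?f z q) \<in> borel_measurable (?L \<Otimes>\<^sub>M lborel)"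
      by (simp only: split_beta')
  qed
  also have "\<dots> = (\<integral>\<^sup>+q. ennreal (sqrt q ^ card I) * k q * indicator {0..} q * ?B \<partial>lborel)"
  proof (rule nn_integral_cong_AE, use AE_lborel_singleton[of 0] in eventually_elim)
    fix q :: real assume "q \<noteq> 0"
    show "(\<integral>\<^sup>+z. ?f z q \<partial>?L)
      = ennreal (sqrt q ^ card I) * k q * indicator {0..} q * ?B"
    proof (cases "0 < q")
      case True
      have "(\<integral>\<^sup>+z. ?f z q \<partial>?L)
          = ennreal (\<bar>sqrt q\<bar> ^ card I) * (\<integral>\<^sup>+y. \<phi> (?y' q y) * k q
              * indicator {z. sq_norm I z \<le> q} (?y q y) \<partial>?L)"
      proof (rule nn_integral_PiM_affine[OF I])
        show "(\<lambda>z. ?f z q) \<in> borel_measurable ?L"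
          by measurable
      qed (use True in simp)
      also have "(\<integral>\<^sup>+y. \<phi> (?y' q y) * k q
              * indicator {z. sq_norm I z \<le> q} (?y q y) \<partial>?L)
          = (\<integral>\<^sup>+y. k q * (\<phi> y * indicator {y. sq_norm I y \<le> 1} y) \<partial>?L)"
      proof (rule nn_integral_cong)
        fix y assume "y \<in> space ?L"
        then have "(?y' q y) = y"
          using True by (auto simp: space_PiM PiE_def extensional_def fun_eq_iff)
        moreover have "sq_norm I (?y q y) = q * sq_norm I y"
          using True by (simp add: power_mult_distrib sum_distrib_left)
        ultimately show "\<phi> (?y' q y) * k q * indicator {z. sq_norm I z \<le> q} (?y q y)
          = k q * (\<phi> y * indicator {y. sq_norm I y \<le> 1} y)"
          using True by (auto split: split_indicator simp: mult.commute)
      qed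
      also have "\<dots> = k q * ?B"
        by (rule nn_integral_cmult) measurable
      also have "ennreal (\<bar>sqrt q\<bar> ^ card I) * \<dots> = ennreal (sqrt q ^ card I) * k q * indicator {0..} q * ?B"
        using True by (simp add: mult.assoc)
      finally show ?thesis .
    next
      case False
      then have "\<not> sq_norm I z \<le> q" for z
        using sum_nonneg[of I "\<lambda>i. (z i)\<^sup>2"] \<open>q \<noteq> 0\<close> by force
      then show ?thesis using False \<open>q \<noteq> 0\<close> by simp
    qed
  qed
  also have "\<dots> = (\<integral>\<^sup>+q. ennreal (sqrt q ^ card I) * k q * indicator {0..} q \<partial>lborel)
      * ?B"
    by (rule nn_integral_multc) measurable
  finally show ?thesis .
qed

text \<open>The quotient of the two values, \<open>2 / n\<close>, is the mean of \<open>1 / q\<close>.\<close>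

lemma radial_moment:
  assumes "0 < n"
  shows "(\<integral>\<^sup>+q. ennreal (sqrt q ^ n) * ennreal (exp (- q)) * indicator {0..} q \<partial>lborel) = ennreal (Gamma (n / 2 + 1))"
    and "(\<integral>\<^sup>+q. ennreal (sqrt q ^ n) * ennreal (1 / q * exp (- q)) * indicator {0..} q \<partial>lborel) = ennreal (2 / n * Gamma (n / 2 + 1))"
proof -
  have root: "sqrt q ^ n = q powr (n / 2)" if "0 < q" for q
  proof -
    have "sqrt q ^ n = sqrt q powr n" using that by (simp add: powr_realpow)
    also have "\<dots> = (q powr (1 / 2)) powr n" using that by (simp only: powr_half_sqrt less_imp_le)
    also have "\<dots> = q powr (n / 2)" by (simp only: powr_powr) simp
    finally show ?thesis .
  qed
  have "(\<integral>\<^sup>+q. ennreal (sqrt q ^ n) * ennreal (exp (- q)) * indicator {0..} q \<partial>lborel)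
      = (\<integral>\<^sup>+q. ennreal (indicator {0..} q * q powr (n / 2 + 1 - 1) / exp q) \<partial>lborel)"
  proof (intro nn_integral_cong_AE eventually_mono[OF AE_lborel_singleton[of 0]])
    fix q :: real assume "q \<noteq> 0"
    then show "ennreal (sqrt q ^ n) * ennreal (exp (- q)) * indicator {0..} q = ennreal (indicator {0..} q * q powr (n / 2 + 1 - 1) / exp q)"
    proof (cases "0 < q")
      case True
      then have "q powr (n / 2 + 1 - 1) / exp q = sqrt q ^ n * exp (- q)"
        using root[OF True] by (simp only: add_diff_cancel_right' exp_minus divide_inverse)
      moreover have "ennreal (sqrt q ^ n) * ennreal (exp (- q)) = ennreal (sqrt q ^ n * exp (- q))"
        using True by (intro ennreal_mult[symmetric]) auto
      ultimately show ?thesis using True by simp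
    qed simp
  qed
  also have "\<dots> = ennreal (Gamma (n / 2 + 1))"
    by (rule Gamma_conv_nn_integral_real[symmetric]) simp
  finally show "(\<integral>\<^sup>+q. ennreal (sqrt q ^ n) * ennreal (exp (- q)) * indicator {0..} q \<partial>lborel) = ennreal (Gamma (n / 2 + 1))" .
  have "(\<integral>\<^sup>+q. ennreal (sqrt q ^ n) * ennreal (1 / q * exp (- q)) * indicator {0..} q \<partial>lborel)
      = (\<integral>\<^sup>+q. ennreal (indicator {0..} q * q powr (n / 2 - 1) / exp q) \<partial>lborel)"
  proof (intro nn_integral_cong_AE eventually_mono[OF AE_lborel_singleton[of 0]])
    fix q :: real assume "q \<noteq> 0"
    then show "ennreal (sqrt q ^ n) * ennreal (1 / q * exp (- q)) * indicator {0..} q = ennreal (indicator {0..} q * q powr (n / 2 - 1) / exp q)"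
    proof (cases "0 < q")
      case True
      then have "q powr (n / 2 - 1) / exp q = sqrt q ^ n * (1 / q * exp (- q))"
        by (simp only: root[OF True] powr_diff powr_one exp_minus divide_inverse mult_1 mult_ac less_imp_le)
      moreover have "ennreal (sqrt q ^ n) * ennreal (1 / q * exp (- q)) = ennreal (sqrt q ^ n * (1 / q * exp (- q)))"
        using True by (intro ennreal_mult[symmetric]) auto
      ultimately show ?thesis using True by simp
    qed simp
  qed
  also have "\<dots> = ennreal (Gamma (n / 2))"
    using assms by (intro Gamma_conv_nn_integral_real[symmetric]) simp
  also have "Gamma (n / 2) = 2 / n * Gamma (n / 2 + 1)"
  proof -
    have "real n / 2 \<notin> \<int>\<^sub>\<le>\<^sub>0"
      using nonpos_Ints_nonpos[of "real n / 2"] assms by auto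
    then have g: "Gamma (n / 2 + 1) = n / 2 * Gamma (n / 2)" by (rule Gamma_plus1)
    show ?thesis unfolding g using assms by simp
  qed
  finally show "(\<integral>\<^sup>+q. ennreal (sqrt q ^ n) * ennreal (1 / q * exp (- q)) * indicator {0..} q \<partial>lborel) = ennreal (2 / n * Gamma (n / 2 + 1))" .
qed

lemma PiM_density:
  fixes f :: "real \<Rightarrow> real"
  assumes "finite I" and [measurable]: "f \<in> borel_measurable borel" and f: "\<And>x. 0 \<le> f x"
    and prob: "prob_space (density lborel f)"
  shows "PiM I (\<lambda>_. density lborel f) = density (lebesgue_PiM I) (\<lambda>x. \<Prod>i\<in>I. ennreal (f (x i)))"
proof -
  interpret product_prob_space "\<lambda>_. density lborel f" I by (rule product_prob_spaceI) (rule prob)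
  have "density (lebesgue_PiM I) (\<lambda>x. \<Prod>i\<in>I. ennreal (f (x i))) = PiM I (\<lambda>_. density lborel f)"
  proof (rule PiM_eqI[OF assms(1)])
    show "sets (density (lebesgue_PiM I) (\<lambda>x. \<Prod>i\<in>I. ennreal (f (x i)))) = sets (PiM I (\<lambda>_. density lborel f))"
      by (simp cong: sets_PiM_cong)
    fix A assume A: "\<And>i. i \<in> I \<Longrightarrow> A i \<in> sets (density lborel f)"
    have [measurable]: "Pi\<^sub>E I A \<in> sets (lebesgue_PiM I)"
      using A by (intro sets_PiM_I_finite assms(1)) auto
    have "emeasure (density (lebesgue_PiM I) (\<lambda>x. \<Prod>i\<in>I. ennreal (f (x i)))) (Pi\<^sub>E I A)
        = (\<integral>\<^sup>+x. (\<Prod>i\<in>I. ennreal (f (x i))) * indicator (Pi\<^sub>E I A) x \<partial>lebesgue_PiM I)"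
      by (subst emeasure_density) auto
    also have "\<dots> = (\<integral>\<^sup>+x. (\<Prod>i\<in>I. ennreal (f (x i)) * indicator (A i) (x i)) \<partial>lebesgue_PiM I)"
    proof (rule nn_integral_cong)
      fix x assume x: "x \<in> space (lebesgue_PiM I)"
      show "(\<Prod>i\<in>I. ennreal (f (x i))) * indicator (Pi\<^sub>E I A) x = (\<Prod>i\<in>I. ennreal (f (x i)) * indicator (A i) (x i))"
      proof (cases "x \<in> Pi\<^sub>E I A")
        case True
        then show ?thesis by (auto simp: PiE_def Pi_def intro!: prod.cong)
      next
        case False
        then obtain i where "i \<in> I" "x i \<notin> A i" using x by (auto simp: space_PiM PiE_def Pi_def)
        then have "(\<Prod>i\<in>I. ennreal (f (x i)) * indicator (A i) (x i)) = 0"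
          using assms(1) by (intro prod_zero bexI[of _ i]) auto
        then show ?thesis using False by simp
      qed
    qed
    also have "\<dots> = (\<Prod>i\<in>I. \<integral>\<^sup>+x. ennreal (f x) * indicator (A i) x \<partial>lborel)"
      using A by (intro lborel_PiM.product_nn_integral_prod assms(1)) auto
    also have "\<dots> = (\<Prod>i\<in>I. emeasure (density lborel f) (A i))"
      using A by (intro prod.cong refl) (subst emeasure_density, auto)
    finally show "emeasure (density (lebesgue_PiM I) (\<lambda>x. \<Prod>i\<in>I. ennreal (f (x i)))) (Pi\<^sub>E I A) = (\<Prod>i\<in>I. emeasure (density lborel f) (A i))" .
  qed
  then show ?thesis ..
qed

text \<open>Variance \<open>1/2\<close> rather than one, so that the joint density of \<open>(z, \<rho>)\<close> is a function of \<open>|z|\<^sup>2 + \<rho>\<close>.\<close>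

definition gauss_density :: "real \<Rightarrow> real" where
  "gauss_density x = exp (- x\<^sup>2) / sqrt pi"

definition expo_density :: "real \<Rightarrow> real" where
  "expo_density x = indicator {0<..} x * exp (- x)"

definition gauss :: "real measure" where "gauss = density lborel gauss_density"

definition expo :: "real measure" where "expo = density lborel expo_density"

lemma borel_gauss_density[measurable]: "gauss_density \<in> borel_measurable borel"
  unfolding gauss_density_def[abs_def] by measurable

lemma borel_expo_density[measurable]: "expo_density \<in> borel_measurable borel"
  unfolding expo_density_def[abs_def] by measurable

lemma sets_gauss[simp, measurable_cong]: "sets gauss = sets borel" "sets expo = sets borel"
  by (auto simp: gauss_def expo_def)

lemma space_gauss[simp]: "space gauss = UNIV" "space expo = UNIV"
  by (auto simp: gauss_def expo_def)

lemma gauss_density_nonneg: "0 \<le> gauss_density x" "0 \<le> expo_density x"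
  by (auto simp: gauss_density_def expo_density_def)

lemma nn_integral_gauss_density: "(\<integral>\<^sup>+x. ennreal (gauss_density x) \<partial>lborel) = 1"
proof -
  have "gauss_density = normal_density 0 (sqrt (1/2))"
    by (auto simp: gauss_density_def normal_density_def fun_eq_iff)
  moreover have "prob_space (density lborel (normal_density 0 (sqrt (1/2))))"
    by (rule prob_space_normal_density) simp
  ultimately show ?thesis
    using prob_space.emeasure_space_1[of "density lborel gauss_density"] by (simp add: emeasure_density)
qed

lemma nn_integral_expo_tail: "0 \<le> y \<Longrightarrow> (\<integral>\<^sup>+x. ennreal (exp (- x)) * indicator {y..} x \<partial>lborel) = ennreal (exp (- y))"
proof -
  have "(\<integral>\<^sup>+x. ennreal (exp (- x)) * indicator {y..} x \<partial>lborel) = ennreal (0 - (- exp (- y)))"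
  proof (rule nn_integral_FTC_atLeast)
    show "((\<lambda>x. - exp (- x)) \<longlongrightarrow> (0::real)) at_top" by real_asymp
  qed (auto intro!: derivative_eq_intros)
  then show ?thesis by simp
qed

lemma nn_integral_expo_density: "(\<integral>\<^sup>+x. ennreal (expo_density x) \<partial>lborel) = 1"
proof -
  have "(\<integral>\<^sup>+x. ennreal (expo_density x) \<partial>lborel) = (\<integral>\<^sup>+x. ennreal (exp (- x)) * indicator {0..} x \<partial>lborel)"
    by (intro nn_integral_cong_AE eventually_mono[OF AE_lborel_singleton[of 0]])
      (auto simp: expo_density_def split: split_indicator)
  then show ?thesis using nn_integral_expo_tail[of 0] by simp
qed

lemma prob_space_gauss: "prob_space gauss" and prob_space_expo: "prob_space expo"
  unfolding gauss_def expo_def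
  by (auto intro!: prob_spaceI simp: emeasure_density nn_integral_gauss_density nn_integral_expo_density)

lemma AE_expo_pos: "AE x in expo. 0 < x"
  unfolding expo_def
  by (subst AE_density) (auto simp: expo_density_def split: split_indicator_asm)

text \<open>Hardy's inequality with the constant weight \<open>2\<close>: since \<open>(x + y)\<^sup>2 \<ge> x\<^sup>2 + y\<^sup>2\<close> for \<open>x, y \<ge> 0\<close>, the tail at \<open>y\<close> is at most
  \<open>exp (- y\<^sup>2)\<close>, which is \<open>sqrt pi \<le> 2\<close> times the density.  The factor is \<open>64 = 16 \<cdot> 2\<^sup>2\<close>.\<close>

lemma osc_gauss_le:
  assumes u: "\<And>x. (u has_real_derivative u' x) (at x)" "continuous_on UNIV u'" "\<And>x. \<bar>u x\<bar> \<le> B"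
  shows "osc gauss u \<le> 64 * (\<integral>\<^sup>+x. ennreal ((u' x)\<^sup>2) \<partial>gauss)"
proof -
  have [measurable]: "u' \<in> borel_measurable borel"
    using u(2) by (rule borel_measurable_continuous_onI)
  have half_line: "(\<integral>\<^sup>+x. ennreal (gauss_density x) * indicator {x. 0 \<le> s * (x - y)} x \<partial>lborel) \<le> ennreal (2 * gauss_density y)"
    if s: "s = 1 \<or> s = -1" and "0 \<le> s * y" for s y :: real
  proof -
    have "(\<integral>\<^sup>+x. ennreal (gauss_density x) * indicator {x. 0 \<le> s * (x - y)} x \<partial>lborel)
        = ennreal \<bar>s\<bar> * (\<integral>\<^sup>+x. ennreal (gauss_density (y + s * x)) * indicator {x. 0 \<le> s * (x - y)} (y + s * x) \<partial>lborel)"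
      using s by (intro nn_integral_real_affine) auto
    also have "\<dots> \<le> (\<integral>\<^sup>+x. ennreal (gauss_density x) * ennreal (exp (- y\<^sup>2)) \<partial>lborel)"
    proof -
      have "ennreal (gauss_density (y + s * x)) * indicator {x. 0 \<le> s * (x - y)} (y + s * x) \<le> ennreal (gauss_density x) * ennreal (exp (- y\<^sup>2))" for x
      proof (cases "0 \<le> x")
        case True
        have "0 \<le> s * y * x" using that(2) True by simp
        moreover have "(s * x)\<^sup>2 = x\<^sup>2" using s by auto
        ultimately have "- (y + s * x)\<^sup>2 \<le> - x\<^sup>2 + - y\<^sup>2"
        proof -
          have "(y + s * x)\<^sup>2 = y\<^sup>2 + 2 * (s * y * x) + (s * x)\<^sup>2"
            by (simp only: power2_sum) (simp add: mult_ac)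
          then show ?thesis using \<open>0 \<le> s * y * x\<close> \<open>(s * x)\<^sup>2 = x\<^sup>2\<close> by linarith
        qed
        then have "exp (- (y + s * x)\<^sup>2) \<le> exp (- x\<^sup>2) * exp (- y\<^sup>2)"
          by (simp flip: exp_add)
        then have "gauss_density (y + s * x) \<le> gauss_density x * exp (- y\<^sup>2)"
          by (simp add: gauss_density_def divide_right_mono)
        then show ?thesis
          by (auto simp: gauss_density_nonneg ennreal_leI split: split_indicator simp flip: ennreal_mult)
      next
        case False
        then show ?thesis using s by auto
      qed
      then show ?thesis using s by (auto intro!: nn_integral_mono)
    qed
    also have "\<dots> = ennreal (exp (- y\<^sup>2))"
      by (simp add: nn_integral_multc nn_integral_gauss_density)
    also have "\<dots> \<le> ennreal (2 * gauss_density y)"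
    proof (rule ennreal_leI)
      have "sqrt pi \<le> sqrt 4" using pi_less_4 by (intro real_sqrt_le_mono) simp
      then show "exp (- y\<^sup>2) \<le> 2 * gauss_density y" by (simp add: gauss_density_def field_simps)
    qed
    finally show ?thesis .
  qed
  have "osc (density lborel gauss_density) u \<le> 16 * (\<integral>\<^sup>+x. ennreal ((u' x)\<^sup>2 * 2\<^sup>2) \<partial>density lborel gauss_density)"
  proof (rule osc_le_weighted_gradient[where S = UNIV and m = 0 and B = B])
    show "continuous_on UNIV u"
      using u(1) by (intro continuous_at_imp_continuous_on) (auto intro: DERIV_isCont)
    show "(u has_real_derivative u' x) (at_right x)" for x
      using u(1) by (rule has_field_derivative_at_within)
    show "\<exists>L. \<forall>x\<in>{a..b}. \<bar>u' x\<bar> \<le> L" for a b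
      by (intro bounded_continuous_Icc continuous_on_subset[OF u(2)]) simp
    show "(\<integral>\<^sup>+x. ennreal (gauss_density x) * indicator (closed_segment 0 x) y \<partial>lborel) \<le> ennreal (2 * gauss_density y)"
      if "y \<noteq> 0" for y
    proof -
      have "(\<integral>\<^sup>+x. ennreal (gauss_density x) * indicator (closed_segment 0 x) y \<partial>lborel)
          \<le> (\<integral>\<^sup>+x. ennreal (gauss_density x) * indicator {x. 0 \<le> sgn y * (x - y)} x \<partial>lborel)"
        using that by (intro nn_integral_mono mult_left_mono)
          (auto simp: sgn_if closed_segment_eq_real_ivl split: split_indicator if_splits)
      also have "\<dots> \<le> ennreal (2 * gauss_density y)"
        using that by (intro half_line) (auto simp: sgn_if)
      finally show ?thesis .
    qed
  qed (use u(3) gauss_density_nonneg nn_integral_gauss_density in auto)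
  also have "\<dots> = 64 * (\<integral>\<^sup>+x. ennreal ((u' x)\<^sup>2) \<partial>gauss)"
  proof -
    have "(\<integral>\<^sup>+x. ennreal ((u' x)\<^sup>2 * 2\<^sup>2) \<partial>gauss) = (\<integral>\<^sup>+x. ennreal ((u' x)\<^sup>2) * 4 \<partial>gauss)"
      by (intro nn_integral_cong) (simp add: ennreal_mult)
    also have "\<dots> = (\<integral>\<^sup>+x. ennreal ((u' x)\<^sup>2) \<partial>gauss) * 4"
      by (rule nn_integral_multc) measurable
    finally have "16 * (\<integral>\<^sup>+x. ennreal ((u' x)\<^sup>2 * 2\<^sup>2) \<partial>gauss) = 16 * ((\<integral>\<^sup>+x. ennreal ((u' x)\<^sup>2) \<partial>gauss) * 4)"
      by (rule arg_cong)
    also have "\<dots> = (16 * 4) * (\<integral>\<^sup>+x. ennreal ((u' x)\<^sup>2) \<partial>gauss)"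
      by (simp only: mult_ac)
    finally show ?thesis by (simp add: gauss_def)
  qed
  finally show ?thesis by (simp only: gauss_def)
qed

text \<open>The weight \<open>3 sqrt x\<close> is small near zero, in view of functions of \<open>|z|\<^sup>2 + x\<close> whose derivatives grow as
  \<open>z\<close> and \<open>x\<close> tend to zero.  From the split point \<open>1\<close>,
  the tail to the right of \<open>y\<close> is \<open>exp (- y)\<close>, and the mass between \<open>0\<close> and \<open>y \<le> 1\<close> is at most
  \<open>y \<le> sqrt y\<close>, where \<open>3 exp (- y) \<ge> 1\<close>.  The factor is \<open>144 = 16 \<cdot> 3\<^sup>2\<close>.\<close>

lemma osc_expo_le:
  assumes u: "\<And>x. 0 < x \<Longrightarrow> (u has_real_derivative u' x) (at x)" "continuous_on {0<..} u'" "\<And>x. 0 < x \<Longrightarrow> \<bar>u x\<bar> \<le> B"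
    and [measurable]: "u' \<in> borel_measurable borel"
  shows "osc expo u \<le> 144 * (\<integral>\<^sup>+x. ennreal (x * (u' x)\<^sup>2) \<partial>expo)"
proof -
  have "osc (density lborel expo_density) u \<le> 16 * (\<integral>\<^sup>+x. ennreal ((u' x)\<^sup>2 * (3 * sqrt x)\<^sup>2) \<partial>density lborel expo_density)"
  proof (rule osc_le_weighted_gradient[where S = "{0<..}" and m = 1 and B = B])
    show "continuous_on {0<..} u"
      using u(1) by (intro continuous_at_imp_continuous_on) (auto intro: DERIV_isCont)
    show "(u has_real_derivative u' x) (at_right x)" if "x \<in> {0<..}" for x
      using that by (auto intro: has_field_derivative_at_within[OF u(1)])
    show "\<exists>L. \<forall>x\<in>{a..b}. \<bar>u' x\<bar> \<le> L" if "{a..b} \<subseteq> {0<..}" for a b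
      using that by (intro bounded_continuous_Icc continuous_on_subset[OF u(2)])
    show "(\<integral>\<^sup>+x. ennreal (expo_density x) * indicator (closed_segment 1 x) y \<partial>lborel) \<le> ennreal (3 * sqrt y * expo_density y)"
      if "y \<in> {0<..}" "y \<noteq> 1" for y
    proof (cases "1 < y")
      case True
      have "(\<integral>\<^sup>+x. ennreal (expo_density x) * indicator (closed_segment 1 x) y \<partial>lborel)
          \<le> (\<integral>\<^sup>+x. ennreal (exp (- x)) * indicator {y..} x \<partial>lborel)"
        using True by (intro nn_integral_mono)
          (auto simp: expo_density_def closed_segment_eq_real_ivl split: split_indicator if_splits)
      also have "\<dots> = ennreal (exp (- y))" using True by (intro nn_integral_expo_tail) simp
      also have "\<dots> \<le> ennreal (3 * sqrt y * expo_density y)"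
      proof (rule ennreal_leI)
        have "1 \<le> 3 * sqrt y" using True real_sqrt_ge_one[of y] by linarith
        then show "exp (- y) \<le> 3 * sqrt y * expo_density y" using True by (simp add: expo_density_def)
      qed
      finally show ?thesis .
    next
      case False
      then have y: "0 < y" "y < 1" using that by auto
      have "(\<integral>\<^sup>+x. ennreal (expo_density x) * indicator (closed_segment 1 x) y \<partial>lborel)
          \<le> (\<integral>\<^sup>+x. 1 * indicator {0..y} x \<partial>lborel)"
        using y by (intro nn_integral_mono)
          (auto simp: expo_density_def closed_segment_eq_real_ivl split: split_indicator if_splits)
      also have "\<dots> = ennreal y" using y by simp
      also have "\<dots> \<le> ennreal (3 * sqrt y * expo_density y)"
      proof (rule ennreal_leI)
        have "y \<le> sqrt y" using y by (intro real_le_rsqrt) (simp add: power2_eq_square mult_le_one mult_left_le)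
        moreover have "1 \<le> 3 * exp (- y)"
        proof -
          have "exp y \<le> exp 1" using y by simp
          also have "exp (1::real) \<le> 3" by (rule exp_le)
          finally show ?thesis by (simp add: exp_minus field_simps)
        qed
        ultimately have "y * 1 \<le> sqrt y * (3 * exp (- y))" using y by (intro mult_mono) auto
        then show "y \<le> 3 * sqrt y * expo_density y" using y by (simp add: expo_density_def mult_ac)
      qed
      finally show ?thesis .
    qed
    show "expo_density x = 0" if "x \<notin> {0<..}" for x using that by (simp add: expo_density_def)
  qed (use u(3) gauss_density_nonneg nn_integral_expo_density in \<open>auto simp: is_interval_oi\<close>)
  also have "\<dots> = 16 * (\<integral>\<^sup>+x. 9 * ennreal (x * (u' x)\<^sup>2) \<partial>expo)"
  proof -
    have "(\<integral>\<^sup>+x. ennreal ((u' x)\<^sup>2 * (3 * sqrt x)\<^sup>2) \<partial>expo) = (\<integral>\<^sup>+x. 9 * ennreal (x * (u' x)\<^sup>2) \<partial>expo)"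
    proof (rule nn_integral_cong_AE, use AE_expo_pos in eventually_elim)
      fix x :: real assume "0 < x"
      then have "(u' x)\<^sup>2 * (3 * sqrt x)\<^sup>2 = 9 * (x * (u' x)\<^sup>2)" by (simp add: power_mult_distrib)
      then show "ennreal ((u' x)\<^sup>2 * (3 * sqrt x)\<^sup>2) = 9 * ennreal (x * (u' x)\<^sup>2)"
        using \<open>0 < x\<close> by (simp add: ennreal_mult mult_ac)
    qed
    then show ?thesis by (simp add: expo_def)
  qed
  also have "\<dots> = 144 * (\<integral>\<^sup>+x. ennreal (x * (u' x)\<^sup>2) \<partial>expo)"
  proof -
    have "(\<integral>\<^sup>+x. 9 * ennreal (x * (u' x)\<^sup>2) \<partial>expo) = 9 * (\<integral>\<^sup>+x. ennreal (x * (u' x)\<^sup>2) \<partial>expo)"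
      by (rule nn_integral_cmult) measurable
    then show ?thesis by (simp add: mult.assoc[symmetric])
  qed
  finally show ?thesis by (simp only: expo_def)
qed

lemma nn_integral_gauss_expo:
  assumes I: "finite I" and [measurable]: "\<phi> \<in> borel_measurable (lebesgue_PiM I)" "k \<in> borel_measurable borel"
  shows "(\<integral>\<^sup>+z. \<integral>\<^sup>+\<rho>. \<phi> (\<lambda>i\<in>I. z i / sqrt (sq_norm I z + \<rho>)) * k (sq_norm I z + \<rho>) \<partial>expo \<partial>PiM I (\<lambda>_. gauss))
    = ennreal ((1 / sqrt pi) ^ card I) * (\<integral>\<^sup>+q. ennreal (sqrt q ^ card I) * (k q * ennreal (exp (- q))) * indicator {0..} q \<partial>lborel)
      * (\<integral>\<^sup>+y. \<phi> y * indicator {y. sq_norm I y \<le> 1} y \<partial>lebesgue_PiM I)"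
proof -
  let ?L = "lebesgue_PiM I" and ?N = "sq_norm I" and ?c = "(1 / sqrt pi) ^ card I"
  let ?y = "\<lambda>z \<rho>. \<lambda>i\<in>I. z i / sqrt (sq_norm I z + \<rho>)"
  let ?f = "\<lambda>z \<rho>. \<phi> (?y z \<rho>) * k (?N z + \<rho>) * ennreal (exp (- \<rho>)) * indicator {0..} \<rho>"
  let ?F = "\<lambda>z \<rho>. \<phi> (?y z \<rho>) * (k (?N z + \<rho>) * ennreal (exp (- (?N z + \<rho>)))) * indicator {0..} \<rho>"
  have gauss_prod: "(\<Prod>i\<in>I. ennreal (gauss_density (z i))) = ennreal (?c * exp (- ?N z))" for z
  proof -
    have "(\<Prod>i\<in>I. exp (- (z i)\<^sup>2)) = exp (- ?N z)"
      using I by (simp add: exp_sum[symmetric] sum_negf)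
    then show ?thesis
      by (subst prod_ennreal) (auto simp: gauss_density_def prod_dividef power_one_over)
  qed
  have PiM_gauss: "PiM I (\<lambda>_. gauss) = density ?L (\<lambda>z. \<Prod>i\<in>I. ennreal (gauss_density (z i)))"
    unfolding gauss_def by (rule PiM_density[OF I]) (auto simp: gauss_density_nonneg prob_space_gauss[unfolded gauss_def])
  have expo_int: "(\<integral>\<^sup>+\<rho>. f \<rho> \<partial>expo) = (\<integral>\<^sup>+\<rho>. f \<rho> * ennreal (exp (- \<rho>)) * indicator {0..} \<rho> \<partial>lborel)"
    if [measurable]: "f \<in> borel_measurable borel" for f
  proof -
    have "(\<integral>\<^sup>+\<rho>. f \<rho> \<partial>expo) = (\<integral>\<^sup>+\<rho>. ennreal (expo_density \<rho>) * f \<rho> \<partial>lborel)"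
      unfolding expo_def by (rule nn_integral_density) measurable
    also have "\<dots> = (\<integral>\<^sup>+\<rho>. f \<rho> * ennreal (exp (- \<rho>)) * indicator {0..} \<rho> \<partial>lborel)"
      by (intro nn_integral_cong_AE eventually_mono[OF AE_lborel_singleton[of 0]])
        (auto simp: expo_density_def mult.commute split: split_indicator)
    finally show ?thesis .
  qed
  have "(\<integral>\<^sup>+z. \<integral>\<^sup>+\<rho>. \<phi> (?y z \<rho>) * k (?N z + \<rho>) \<partial>expo \<partial>PiM I (\<lambda>_. gauss))
      = (\<integral>\<^sup>+z. \<integral>\<^sup>+\<rho>. ?f z \<rho> \<partial>lborel \<partial>PiM I (\<lambda>_. gauss))"
    by (intro nn_integral_cong expo_int) (simp add: PiM_gauss, measurable)
  also have "\<dots> = (\<integral>\<^sup>+z. ennreal (?c * exp (- ?N z)) * (\<integral>\<^sup>+\<rho>. ?f z \<rho> \<partial>lborel) \<partial>?L)"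
    unfolding PiM_gauss gauss_prod by (rule nn_integral_density) measurable
  also have "\<dots> = (\<integral>\<^sup>+z. ennreal ?c * (\<integral>\<^sup>+\<rho>. ?F z \<rho> \<partial>lborel) \<partial>?L)"
  proof (rule nn_integral_cong)
    fix z assume [measurable]: "z \<in> space ?L"
    have "ennreal (exp (- ?N z)) * (\<integral>\<^sup>+\<rho>. ?f z \<rho> \<partial>lborel)
        = (\<integral>\<^sup>+\<rho>. ennreal (exp (- ?N z)) * ?f z \<rho> \<partial>lborel)"
      by (rule nn_integral_cmult[symmetric]) measurable
    also have "\<dots> = (\<integral>\<^sup>+\<rho>. ?F z \<rho> \<partial>lborel)"
    proof (rule nn_integral_cong)
      fix \<rho>
      have "ennreal (exp (- (?N z + \<rho>))) = ennreal (exp (- ?N z)) * ennreal (exp (- \<rho>))"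
        by (subst ennreal_mult[symmetric]) (auto simp flip: exp_add)
      then show "ennreal (exp (- ?N z)) * ?f z \<rho>
          = ?F z \<rho>"
        by (simp only: mult_ac)
    qed
    finally show "ennreal (?c * exp (- ?N z)) * (\<integral>\<^sup>+\<rho>. ?f z \<rho> \<partial>lborel)
        = ennreal ?c * (\<integral>\<^sup>+\<rho>. ?F z \<rho> \<partial>lborel)"
      by (subst ennreal_mult) (auto simp: mult.assoc)
  qed
  also have "\<dots> = ennreal ?c * (\<integral>\<^sup>+z. \<integral>\<^sup>+\<rho>. ?F z \<rho> \<partial>lborel \<partial>?L)"
    by (rule nn_integral_cmult) measurable
  also have "\<dots> = ennreal ?c * ((\<integral>\<^sup>+q. ennreal (sqrt q ^ card I) * (k q * ennreal (exp (- q))) * indicator {0..} q \<partial>lborel)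
      * (\<integral>\<^sup>+y. \<phi> y * indicator {y. ?N y \<le> 1} y \<partial>?L))"
    by (subst nn_integral_radial_fibration[OF I, where k = "\<lambda>q. k q * ennreal (exp (- q))"]) auto
  finally show ?thesis by (simp add: mult.assoc)
qed

section \<open>Continuous and smooth functions of finitely many coordinates\<close>

lemma continuous_map_restrict:
  "continuous_map euclidean (powertop_real I) (\<lambda>x::nat \<Rightarrow> real. restrict x I)"
  unfolding continuous_map_componentwise
  by (auto intro: continuous_on_product_coordinates)

lemma measurable_extend_by_zero:
  "(\<lambda>x i. if i \<in> I then x i else 0) \<in> measurable (lebesgue_PiM I) (borel :: (nat \<Rightarrow> real) measure)"
proof -
  have "(\<lambda>x i. if i \<in> I then x i else 0) \<in> measurable (lebesgue_PiM I) (PiM UNIV (\<lambda>_. borel :: real measure))"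
  proof (rule measurable_PiM_single')
    show "(\<lambda>x. if i \<in> I then x i else 0) \<in> borel_measurable (lebesgue_PiM I)" for i
      by (cases "i \<in> I") auto
  qed auto
  then show ?thesis
    using measurable_cong_sets[OF refl sets_PiM_equal_borel] by blast
qed

lemma restrict_extend_by_zero:
  "x \<in> space (lebesgue_PiM I) \<Longrightarrow> restrict (\<lambda>i. if i \<in> I then x i else 0) I = x"
  by (auto simp: space_PiM PiE_def extensional_def fun_eq_iff)

text \<open>Extension by zero embeds the finite product measurably into all real sequences, where Borel
  sets of the product topology are available.\<close>

lemma borel_measurable_continuous_map_PiM:
  assumes "continuous_map (powertop_real I) euclideanreal f"
  shows "f \<in> borel_measurable (lebesgue_PiM I)"
proof -
  have "continuous_on UNIV (\<lambda>x. f (restrict x I))"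
    using continuous_map_compose[OF continuous_map_restrict assms] by (simp add: o_def)
  then have "(\<lambda>x. f (restrict x I)) \<in> borel_measurable borel"
    by (rule borel_measurable_continuous_onI)
  from measurable_compose[OF measurable_extend_by_zero this]
  have "(\<lambda>x. f (restrict (\<lambda>i. if i \<in> I then x i else 0) I)) \<in> borel_measurable (lebesgue_PiM I)" .
  then show ?thesis
    by (rule measurable_cong[THEN iffD1, rotated]) (simp add: restrict_extend_by_zero)
qed

lemma compactin_sets_PiM:
  assumes "compactin (powertop_real I) K"
  shows "K \<in> sets (lebesgue_PiM I)"
proof -
  have "Hausdorff_space (powertop_real I)"
    by (simp add: Hausdorff_space_product_topology)
  then have "closedin (powertop_real I) K" using assms compactin_imp_closedin by blast
  from closedin_continuous_map_preimage[OF continuous_map_restrict this]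
  have "closed {x. restrict x I \<in> K}" by simp
  then have "{x. restrict x I \<in> K} \<in> sets borel" by (rule borel_closed)
  from measurable_sets[OF measurable_extend_by_zero this]
  have "(\<lambda>x i. if i \<in> I then x i else 0) -` {x. restrict x I \<in> K} \<inter> space (lebesgue_PiM I) \<in> sets (lebesgue_PiM I)" .
  also have "(\<lambda>x i. if i \<in> I then x i else 0) -` {x. restrict x I \<in> K} \<inter> space (lebesgue_PiM I) = K"
    using compactin_subset_topspace[OF assms] restrict_extend_by_zero by (auto simp: space_PiM)
  finally show ?thesis .
qed

lemma bounded_on_compactin:
  assumes "compactin X K" "continuous_map X euclideanreal f"
  obtains B where "\<And>x. x \<in> K \<Longrightarrow> \<bar>f x\<bar> \<le> B"
proof -
  have "compact (f ` K)" using image_compactin[OF assms] by simp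
  then have "bounded (f ` K)" by (rule compact_imp_bounded)
  then show ?thesis using that by (auto simp: bounded_iff)
qed

lemma Rn_iff: "x \<in> Rn m \<longleftrightarrow> (\<forall>i. m \<le> i \<longrightarrow> x i = undefined)"
  by (auto simp: Rn_def PiE_def extensional_def)

lemma tendsto_continuous_map_PiM:
  assumes f: "continuous_map (powertop_real {..<m}) euclideanreal f"
    and x: "\<And>s. x s \<in> Rn m" and l: "l \<in> Rn m"
    and lim: "\<And>i. i < m \<Longrightarrow> ((\<lambda>s. x s i) \<longlongrightarrow> l i) F"
  shows "((\<lambda>s. f (x s)) \<longlongrightarrow> f l) F"
proof -
  have "limitin (powertop_real {..<m}) x l F"
    using x l lim by (auto simp: limitin_componentwise Rn_def PiE_def)
  from continuous_map_limit[OF f this] show ?thesis by (simp add: o_def)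
qed

lemma mean_value_coordinate:
  fixes g g' :: "real \<Rightarrow> real"
  assumes "\<And>s. (g has_real_derivative g' s) (at s)"
  shows "\<exists>\<eta>. \<bar>\<eta> - a\<bar> \<le> \<bar>b - a\<bar> \<and> g b - g a = g' \<eta> * (b - a)"
proof (cases a b rule: linorder_cases)
  case less
  from MVT2[OF less assms] obtain z where "a < z" "z < b" "g b - g a = (b - a) * g' z" by auto
  then show ?thesis by (intro exI[of _ z]) (auto simp: mult.commute)
next
  case greater
  from MVT2[OF greater assms] obtain z where "b < z" "z < a" "g a - g b = (a - b) * g' z" by auto
  then show ?thesis by (intro exI[of _ z]) (auto simp: algebra_simps)
qed auto

text \<open>The filter is \<open>at t within A\<close> because the axial curves have only right derivatives, the other ones
  derivatives on both sides.\<close>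

lemma C1_chain_rule:
  assumes partial: "\<And>i x. i < m \<Longrightarrow> x \<in> Rn m \<Longrightarrow> ((\<lambda>s. f (x(i := s))) has_real_derivative P i x) (at (x i))"
    and cont: "\<And>i. i < m \<Longrightarrow> continuous_map (powertop_real {..<m}) euclideanreal (P i)"
    and curve: "\<And>i. i < m \<Longrightarrow> ((\<lambda>s. c s i) has_real_derivative c' i) (at t within A)"
  shows "((\<lambda>s. f (\<lambda>i\<in>{..<m}. c s i)) has_real_derivative (\<Sum>i<m. P i (\<lambda>i\<in>{..<m}. c t i) * c' i)) (at t within A)"
proof -
  \<comment> \<open>Move the coordinates from \<open>c t\<close> to \<open>c s\<close> one after the other.\<close>
  define W where "W k s = (\<lambda>i\<in>{..<m}. if i < k then c s i else c t i)" for k s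
  define x0 where "x0 = (\<lambda>i\<in>{..<m}. c t i)"
  have x0: "x0 \<in> Rn m" by (auto simp: x0_def Rn_def)
  have W_t: "W k t = x0" for k by (auto simp: W_def x0_def)
  have "((\<lambda>s. f (W k s)) has_real_derivative (\<Sum>i<k. P i x0 * c' i)) (at t within A)" if "k \<le> m" for k
    using that
  proof (induction k)
    case 0
    have "W 0 s = x0" for s by (auto simp: W_def x0_def)
    then show ?case by simp
  next
    case (Suc k)
    then have "k < m" by simp
    have W_Suc: "W (Suc k) s = (W k s)(k := c s k)" and W_same: "W k s = (W k s)(k := c t k)" for s
      using \<open>k < m\<close> by (simp_all add: W_def fun_eq_iff less_Suc_eq)
    have "\<exists>\<eta>. \<bar>\<eta> - c t k\<bar> \<le> \<bar>c s k - c t k\<bar> \<and> f (W (Suc k) s) - f (W k s) = P k ((W k s)(k := \<eta>)) * (c s k - c t k)" for s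
    proof -
      have mem: "(W k s)(k := r) \<in> Rn m" for r using \<open>k < m\<close> by (simp add: W_def Rn_iff)
      have "((\<lambda>r. f ((W k s)(k := r))) has_real_derivative P k ((W k s)(k := r))) (at r)" for r
        using partial[OF \<open>k < m\<close> mem[of r]] by simp
      from mean_value_coordinate[OF this, of "c t k" "c s k"] show ?thesis
        using W_Suc[of s] W_same[of s] by simp
    qed
    \<comment> \<open>The point \<open>\<eta> s\<close> of the mean value theorem tends to \<open>c t k\<close> together with \<open>c s k\<close>.\<close>
    then obtain \<eta> where \<eta>: "\<And>s. \<bar>\<eta> s - c t k\<bar> \<le> \<bar>c s k - c t k\<bar>"
      and incr: "\<And>s. f (W (Suc k) s) - f (W k s) = P k ((W k s)(k := \<eta> s)) * (c s k - c t k)"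
      by metis
    have c_lim: "((\<lambda>s. c s i) \<longlongrightarrow> c t i) (at t within A)" if "i < m" for i
      using DERIV_continuous[OF curve[OF that]] by (simp add: continuous_within)
    have "((\<lambda>s. P k ((W k s)(k := \<eta> s))) \<longlongrightarrow> P k x0) (at t within A)"
    proof (rule tendsto_continuous_map_PiM[OF cont[OF \<open>k < m\<close>] _ x0])
      show "(W k s)(k := \<eta> s) \<in> Rn m" for s using \<open>k < m\<close> by (simp add: W_def Rn_iff)
      fix i assume "i < m"
      have "((\<lambda>s. \<eta> s) \<longlongrightarrow> c t k) (at t within A)"
      proof (rule Lim_null_comparison[where g = "\<lambda>s. \<bar>c s k - c t k\<bar>", THEN LIM_zero_cancel])
        show "((\<lambda>s. \<bar>c s k - c t k\<bar>) \<longlongrightarrow> 0) (at t within A)"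
          using tendsto_rabs_zero[OF LIM_zero[OF c_lim[OF \<open>k < m\<close>]]] .
      qed (use \<eta> in auto)
      then show "((\<lambda>s. ((W k s)(k := \<eta> s)) i) \<longlongrightarrow> x0 i) (at t within A)"
        using \<open>i < m\<close> c_lim[OF \<open>i < m\<close>] by (cases "i = k"; cases "i < k") (auto simp: W_def x0_def)
    qed
    moreover have "((\<lambda>s. (c s k - c t k) / (s - t)) \<longlongrightarrow> c' k) (at t within A)"
      using curve[OF \<open>k < m\<close>] by (simp add: has_field_derivative_iff)
    ultimately have "((\<lambda>s. P k ((W k s)(k := \<eta> s)) * ((c s k - c t k) / (s - t))) \<longlongrightarrow> P k x0 * c' k) (at t within A)"
      by (rule tendsto_mult)
    then have "((\<lambda>s. f (W (Suc k) s) - f (W k s)) has_real_derivative P k x0 * c' k) (at t within A)"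
      by (simp add: has_field_derivative_iff incr W_t)
    from DERIV_add[OF Suc.IH this] Suc.prems show ?case by simp
  qed
  from this[of m] have "((\<lambda>s. f (W m s)) has_real_derivative (\<Sum>i<m. P i x0 * c' i)) (at t within A)" by simp
  moreover have "W m s = (\<lambda>i\<in>{..<m}. c s i)" for s by (auto simp: W_def)
  ultimately show ?thesis by (simp add: x0_def)
qed

lemma continuous_on_along_curve:
  fixes f :: "(nat \<Rightarrow> real) \<Rightarrow> real"
  assumes "continuous_map (powertop_real {..<m}) euclideanreal f"
    and "\<And>i. i < m \<Longrightarrow> continuous_on A (\<lambda>s. c s i)"
  shows "continuous_on A (\<lambda>s. f (\<lambda>i\<in>{..<m}. c s i))"
  unfolding continuous_on_def
proof
  fix t assume "t \<in> A"
  show "((\<lambda>s. f (\<lambda>i\<in>{..<m}. c s i)) \<longlongrightarrow> f (\<lambda>i\<in>{..<m}. c t i)) (at t within A)"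
    using assms(2) \<open>t \<in> A\<close>
    by (intro tendsto_continuous_map_PiM[OF assms(1)]) (auto simp: Rn_def continuous_on_def)
qed

lemma smooth_partial_derivatives:
  assumes "smooth m f"
  shows "continuous_map (powertop_real {..<m}) euclideanreal f"
    and "\<And>i. i < m \<Longrightarrow> continuous_map (powertop_real {..<m}) euclideanreal (partial_deriv i f)"
    and "\<And>i x. i < m \<Longrightarrow> x \<in> Rn m \<Longrightarrow> ((\<lambda>s. f (x(i := s))) has_real_derivative partial_deriv i f x) (at (x i))"
proof -
  have C1: "C_k m (Suc 0) f" using assms unfolding smooth_def by (rule spec)
  then show "continuous_map (powertop_real {..<m}) euclideanreal f"
    and "\<And>i. i < m \<Longrightarrow> continuous_map (powertop_real {..<m}) euclideanreal (partial_deriv i f)"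
    by auto
  show "((\<lambda>s. f (x(i := s))) has_real_derivative partial_deriv i f x) (at (x i))" if "i < m" "x \<in> Rn m" for i x
    using C1 that by (auto simp: partial_deriv_def field_differentiable_derivI)
qed

lemma (in product_prob_space) nn_integral_PiM_resample:
  assumes "finite I" "i \<in> I" and [measurable]: "F \<in> borel_measurable (PiM I M)"
  shows "(\<integral>\<^sup>+x. \<integral>\<^sup>+a. F (x(i := a)) \<partial>M i \<partial>PiM I M) = (\<integral>\<^sup>+x. F x \<partial>PiM I M)"
proof -
  define J where "J = I - {i}"
  have J: "I = insert i J" "finite J" "i \<notin> J" using assms by (auto simp: J_def)
  note [simp] = J(2)
  have [measurable]: "F \<in> borel_measurable (PiM (insert i J) M)" using assms(3) J(1) by simp
  have upd: "(\<lambda>z. (u z)(i := v z)) \<in> measurable L (PiM (insert i J) M)"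
    if "u \<in> measurable L (PiM (insert i J) M)" "v \<in> measurable L (M i)" for u v and L :: "'z measure"
    by (rule measurable_fun_upd[OF _ that]) auto
  note [measurable] = upd
  have "(\<integral>\<^sup>+x. \<integral>\<^sup>+a. F (x(i := a)) \<partial>M i \<partial>PiM (insert i J) M)
      = (\<integral>\<^sup>+x. \<integral>\<^sup>+b. \<integral>\<^sup>+a. F (x(i := b, i := a)) \<partial>M i \<partial>M i \<partial>PiM J M)"
    by (rule product_nn_integral_insert[OF J(2,3)]) measurable
  also have "\<dots> = (\<integral>\<^sup>+x. \<integral>\<^sup>+a. F (x(i := a)) \<partial>M i \<partial>PiM J M)"
    by (simp add: M.emeasure_space_1)
  also have "\<dots> = (\<integral>\<^sup>+x. F x \<partial>PiM (insert i J) M)"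
    by (rule product_nn_integral_insert[OF J(2,3), symmetric]) measurable
  finally show ?thesis unfolding J(1) .
qed

text \<open>Otherwise the simplifier turns \<open>{1..n}\<close> into \<open>{Suc 0..n}\<close> and index sets no longer match.\<close>

declare One_nat_def [simp del]

section \<open>Functions in revolution coordinates\<close>

text \<open>The coordinates are indexed by \<open>{1..n}\<close>, index \<open>0\<close> being kept for the axis.  For \<open>\<rho> > 0\<close> the vector lies in
  the open unit ball.\<close>

definition direction :: "nat \<Rightarrow> (nat \<Rightarrow> real) \<Rightarrow> real \<Rightarrow> nat \<Rightarrow> real" where
  "direction n z \<rho> = (\<lambda>i\<in>{1..n}. z i / sqrt (sq_norm {1..n} z + \<rho>))"

lemma measurable_direction[measurable (raw)]:
  assumes [measurable]: "u \<in> measurable L (lebesgue_PiM {1..n})" "v \<in> borel_measurable L"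
  shows "(\<lambda>p. direction n (u p) (v p)) \<in> measurable L (lebesgue_PiM {1..n})"
  unfolding direction_def by measurable

text \<open>The mean over the unit ball, in Gaussian and exponential coordinates.\<close>

definition ball_avg :: "nat \<Rightarrow> ((nat \<Rightarrow> real) \<Rightarrow> ennreal) \<Rightarrow> ennreal" where
  "ball_avg n \<phi> = (\<integral>\<^sup>+z. \<integral>\<^sup>+\<rho>. \<phi> (direction n z \<rho>) \<partial>expo \<partial>PiM {1..n} (\<lambda>_. gauss))"

lemma sq_norm_update:
  assumes "finite I" "j \<in> I"
  shows "sq_norm I (z(j := s)) = sq_norm (I - {j}) z + s\<^sup>2"
  using assms by (simp add: sum.remove[of I j])

lemma sq_norm_direction:
  assumes "0 < sq_norm {1..n} z + \<rho>"
  shows "sq_norm {1..n} (direction n z \<rho>) = sq_norm {1..n} z / (sq_norm {1..n} z + \<rho>)"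
  using assms by (simp add: direction_def power_divide sum_divide_distrib)

lemma sq_norm_direction_le_1:
  assumes "0 < \<rho>"
  shows "sq_norm {1..n} (direction n z \<rho>) \<le> 1"
proof -
  have "0 \<le> sq_norm {1..n} z" by (simp add: sum_nonneg)
  then show ?thesis using assms by (subst sq_norm_direction) auto
qed

lemma cauchy_schwarz_le_1:
  fixes a y :: "nat \<Rightarrow> real"
  assumes "sq_norm I y \<le> 1"
  shows "(\<Sum>i\<in>I. y i * a i)\<^sup>2 \<le> sq_norm I a"
proof -
  have "(\<Sum>i\<in>I. y i * a i)\<^sup>2 \<le> sq_norm I y * sq_norm I a" by (rule Cauchy_Schwarz_ineq_sum)
  also have "\<dots> \<le> 1 * sq_norm I a" using assms by (intro mult_right_mono) (auto simp: sum_nonneg)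
  finally show ?thesis by simp
qed

context concave_profile
begin

abbreviation \<gamma> :: "(nat \<Rightarrow> real) measure" where "\<gamma> \<equiv> PiM {1..n} (\<lambda>_. gauss)"

lemma sets_\<gamma>[measurable_cong]: "sets \<gamma> = sets (lebesgue_PiM {1..n})"
  by (intro sets_PiM_cong) auto

lemma space_\<gamma>: "space \<gamma> = space (lebesgue_PiM {1..n})"
  by (simp add: space_PiM)

lemma ball_avg_weight:
  assumes [measurable]: "\<phi> \<in> borel_measurable (lebesgue_PiM {1..n})"
  shows "(\<integral>\<^sup>+z. \<integral>\<^sup>+\<rho>. \<phi> (direction n z \<rho>) * ennreal (1 / (sq_norm {1..n} z + \<rho>)) \<partial>expo \<partial>\<gamma>) = ennreal (2 / n) * ball_avg n \<phi>"
proof -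
  let ?c = "ennreal ((1 / sqrt pi) ^ n)" and ?b = "\<integral>\<^sup>+y. \<phi> y * indicator {y. sq_norm {1..n} y \<le> 1} y \<partial>lebesgue_PiM {1..n}"
  have "ball_avg n \<phi> = ?c * ennreal (Gamma (n / 2 + 1)) * ?b"
    using nn_integral_gauss_expo[of "{1..n}" \<phi> "\<lambda>_. 1"] radial_moment(1)[of n] n_pos
    by (simp add: ball_avg_def direction_def)
  moreover have "(\<integral>\<^sup>+z. \<integral>\<^sup>+\<rho>. \<phi> (direction n z \<rho>) * ennreal (1 / (sq_norm {1..n} z + \<rho>)) \<partial>expo \<partial>\<gamma>)
      = ?c * ennreal (2 / n * Gamma (n / 2 + 1)) * ?b"
    using nn_integral_gauss_expo[of "{1..n}" \<phi> "\<lambda>q. ennreal (1 / q)"] radial_moment(2)[of n] n_pos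
    by (simp add: direction_def flip: ennreal_mult'')
  moreover have "ennreal (2 / n * Gamma (n / 2 + 1)) = ennreal (2 / n) * ennreal (Gamma (n / 2 + 1))"
    by (intro ennreal_mult) (auto intro!: less_imp_le Gamma_real_pos)
  ultimately show ?thesis by (simp only: mult_ac)
qed

lemma prob_space_\<gamma>: "prob_space \<gamma>"
  by (intro prob_space_PiM prob_space_gauss)

end

text \<open>A \<open>C\<^sup>1\<close> function \<open>G\<close> of the coordinates in an adapted basis, with partial derivatives \<open>A\<close>, bounded by \<open>B\<close>
  on the body with profile \<open>R\<close>.\<close>

locale revolution_function = concave_profile S R n for S R n +
  fixes G :: "(nat \<Rightarrow> real) \<Rightarrow> real" and A :: "nat \<Rightarrow> (nat \<Rightarrow> real) \<Rightarrow> real" and B M \<sigma> :: real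
  assumes partial: "\<And>k c. k < Suc n \<Longrightarrow> c \<in> Rn (Suc n) \<Longrightarrow> ((\<lambda>s. G (c(k := s))) has_real_derivative A k c) (at (c k))"
    and G_cont: "continuous_map (powertop_real {..<Suc n}) euclideanreal G"
    and A_cont: "\<And>k. k < Suc n \<Longrightarrow> continuous_map (powertop_real {..<Suc n}) euclideanreal (A k)"
    and G_bound: "\<And>t y. t \<in> S \<Longrightarrow> sq_norm {1..n} y \<le> 1 \<Longrightarrow> \<bar>G (\<lambda>k\<in>{..<Suc n}. if k = 0 then t else R t * y k)\<bar> \<le> B"
    and R_le: "\<And>t. t \<in> S \<Longrightarrow> R t \<le> M" and M_pos: "0 < M" and \<sigma>_pos: "0 < \<sigma>"
    and second_moment: "(\<integral>\<^sup>+t. ennreal (t\<^sup>2) \<partial>\<nu>) \<le> ennreal (\<sigma>\<^sup>2)"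
begin

definition point :: "real \<Rightarrow> (nat \<Rightarrow> real) \<Rightarrow> nat \<Rightarrow> real" where
  "point t y = (\<lambda>k\<in>{..<Suc n}. if k = 0 then t else R t * y k)"

definition \<Gamma> :: "(nat \<Rightarrow> real) \<Rightarrow> real" where "\<Gamma> c = (\<Sum>k<Suc n. (A k c)\<^sup>2)"

lemma \<Gamma>_nonneg: "0 \<le> \<Gamma> c" by (simp add: \<Gamma>_def sum_nonneg)

lemma split_coordinates: "(\<Sum>k<Suc n. f k) = f 0 + (\<Sum>j=1..n. f j)" for f :: "nat \<Rightarrow> real"
proof -
  have "{..<Suc n} = insert 0 {1..n}" by auto
  then show ?thesis by simp
qed

lemma \<Gamma>_split: "\<Gamma> c = (A 0 c)\<^sup>2 + (\<Sum>j=1..n. (A j c)\<^sup>2)"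
  unfolding \<Gamma>_def by (rule split_coordinates)

lemma transversal_le_\<Gamma>: "(\<Sum>j=1..n. (A j c)\<^sup>2) \<le> \<Gamma> c"
  by (simp add: \<Gamma>_split)

lemma measurable_point[measurable (raw)]:
  assumes [measurable]: "t \<in> borel_measurable L" and y: "y \<in> measurable L (lebesgue_PiM {1..n})"
  shows "(\<lambda>p. point (t p) (y p)) \<in> measurable L (lebesgue_PiM {..<Suc n})"
  unfolding point_def
proof (rule measurable_restrict)
  fix k assume "k \<in> {..<Suc n}"
  show "(\<lambda>p. if k = 0 then t p else R (t p) * y p k) \<in> measurable L lborel"
  proof (cases "k = 0")
    case False
    then have "k \<in> {1..n}" using \<open>k \<in> {..<Suc n}\<close> by auto
    then have [measurable]: "(\<lambda>p. y p k) \<in> borel_measurable L"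
      using measurable_compose[OF y measurable_component_singleton[of k "{1..n}"]] by auto
    then show ?thesis using False by simp
  qed simp
qed

lemma borel_measurable_G[measurable]: "G \<in> borel_measurable (lebesgue_PiM {..<Suc n})"
  by (rule borel_measurable_continuous_map_PiM[OF G_cont])

lemma borel_measurable_A: "k < Suc n \<Longrightarrow> A k \<in> borel_measurable (lebesgue_PiM {..<Suc n})"
  by (rule borel_measurable_continuous_map_PiM[OF A_cont])

lemma borel_measurable_\<Gamma>[measurable]: "\<Gamma> \<in> borel_measurable (lebesgue_PiM {..<Suc n})"
  unfolding \<Gamma>_def[abs_def] by (intro borel_measurable_sum borel_measurable_power borel_measurable_A) auto

lemma chain:
  assumes "\<And>k. k < Suc n \<Longrightarrow> ((\<lambda>s. c s k) has_real_derivative c' k) (at t within X)"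
  shows "((\<lambda>s. G (\<lambda>k\<in>{..<Suc n}. c s k)) has_real_derivative (\<Sum>k<Suc n. A k (\<lambda>k\<in>{..<Suc n}. c t k) * c' k)) (at t within X)"
  by (rule C1_chain_rule[OF partial A_cont assms])

lemma D_locally_bounded:
  assumes "{a..b} \<subseteq> S"
  shows "\<exists>L. \<forall>x\<in>{a..b}. \<bar>D x\<bar> \<le> L"
proof (intro exI ballI)
  fix x assume x: "x \<in> {a..b}"
  then have "a \<in> S" "b \<in> S" "x \<in> S" using assms by auto
  then have "D b \<le> D x" "D x \<le> D a"
    using x right_slope_antimono[OF open_S concave_R] by auto
  then show "\<bar>D x\<bar> \<le> \<bar>D a\<bar> + \<bar>D b\<bar>" by linarith
qed

text \<open>Along \<open>t \<mapsto> (t, R t \<cdot> y)\<close> the derivative is \<open>a + D t \<cdot> b\<close> with \<open>a\<close> the axial derivative and \<open>b = \<langle>y, \<nabla>\<rangle>\<close>;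
  as \<open>|y| \<le> 1\<close>, its square is at most \<open>(1 + (D t)\<^sup>2) (a\<^sup>2 + b\<^sup>2)\<close> and \<open>a\<^sup>2 + b\<^sup>2\<close> at most the square of the gradient.\<close>

lemma axial_osc:
  assumes y: "sq_norm {1..n} y \<le> 1" "y \<in> space (lebesgue_PiM {1..n})"
  shows "osc \<nu> (\<lambda>t. G (point t y)) \<le> ennreal (16 * (64 * \<sigma>\<^sup>2 + (M / (real n + 1))\<^sup>2)) * (\<integral>\<^sup>+t. ennreal (\<Gamma> (point t y)) \<partial>\<nu>)"
proof -
  define u' where "u' t = A 0 (point t y) + D t * (\<Sum>j=1..n. y j * A j (point t y))" for t
  note [measurable] = y(2)
  have A_meas: "(\<lambda>t. A k (point t y)) \<in> borel_measurable borel" if "k < Suc n" for k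
    by (rule measurable_compose[OF _ borel_measurable_A[OF that]]) measurable
  have curve_cont: "continuous_on S (\<lambda>t. if k = 0 then t else R t * y k)" for k :: nat
    by (cases "k = 0") (auto intro!: continuous_intros continuous_R)
  show ?thesis
  proof (rule osc_le_gradient[OF \<sigma>_pos second_moment R_le M_pos, where u' = u' and B = B])
    show "continuous_on S (\<lambda>t. G (point t y))"
      unfolding point_def by (intro continuous_on_along_curve[OF G_cont] curve_cont)
    show "\<bar>G (point t y)\<bar> \<le> B" if "t \<in> S" for t
      using G_bound[OF that y(1)] by (simp add: point_def)
    show "u' \<in> borel_measurable borel"
      unfolding u'_def using A_meas by (intro borel_measurable_add borel_measurable_times borel_measurable_sum borel_D borel_measurable_const) auto
    show "(\<lambda>t. \<Gamma> (point t y)) \<in> borel_measurable borel"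
      by measurable
    show "((\<lambda>t. G (point t y)) has_real_derivative u' t) (at_right t)" if "t \<in> S" for t
    proof -
      have "((\<lambda>s. G (point s y)) has_real_derivative (\<Sum>k<Suc n. A k (point t y) * (if k = 0 then 1 else D t * y k))) (at_right t)"
        unfolding point_def
      proof (rule chain)
        fix k
        show "((\<lambda>s. if k = 0 then s else R s * y k) has_real_derivative (if k = 0 then 1 else D t * y k)) (at_right t)"
          using DERIV_cmult_right[OF right_slope_has_derivative[OF open_S concave_R that], of "y k"] by (cases "k = 0") auto
      qed
      also have "(\<Sum>k<Suc n. A k (point t y) * (if k = 0 then 1 else D t * y k)) = u' t"
        unfolding split_coordinates u'_def by (simp add: sum_distrib_left mult_ac)
      finally show ?thesis .
    qed
    show "\<exists>L. \<forall>t\<in>{a..b}. \<bar>u' t\<bar> \<le> L" if ab: "{a..b} \<subseteq> S" for a b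
    proof -
      have A_along: "continuous_on {a..b} (\<lambda>t. A k (point t y))" if "k < Suc n" for k
        unfolding point_def
        by (intro continuous_on_along_curve[OF A_cont[OF that]] continuous_on_subset[OF curve_cont ab])
      obtain L0 where L0: "\<And>t. t \<in> {a..b} \<Longrightarrow> \<bar>A 0 (point t y)\<bar> \<le> L0"
        using bounded_continuous_Icc[OF A_along[OF zero_less_Suc]] by blast
      have "continuous_on {a..b} (\<lambda>t. \<Sum>j=1..n. y j * A j (point t y))"
        by (intro continuous_intros A_along) auto
      then obtain L1 where L1: "\<And>t. t \<in> {a..b} \<Longrightarrow> \<bar>\<Sum>j=1..n. y j * A j (point t y)\<bar> \<le> L1"
        using bounded_continuous_Icc by blast
      obtain L2 where L2: "\<And>t. t \<in> {a..b} \<Longrightarrow> \<bar>D t\<bar> \<le> L2" using D_locally_bounded[OF ab] by blast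
      have "\<bar>u' t\<bar> \<le> L0 + L2 * L1" if t: "t \<in> {a..b}" for t
      proof -
        have "\<bar>u' t\<bar> \<le> \<bar>A 0 (point t y)\<bar> + \<bar>D t\<bar> * \<bar>\<Sum>j=1..n. y j * A j (point t y)\<bar>"
          using abs_triangle_ineq[of "A 0 (point t y)" "D t * (\<Sum>j=1..n. y j * A j (point t y))"]
          by (simp add: u'_def abs_mult)
        also have "\<dots> \<le> L0 + L2 * L1"
          using L0[OF t] L1[OF t] L2[OF t] by (intro add_mono mult_mono) auto
        finally show ?thesis .
      qed
      then show ?thesis by blast
    qed
    show "(u' t)\<^sup>2 \<le> (1 + (D t)\<^sup>2) * \<Gamma> (point t y)" if "t \<in> S" for t
    proof -
      define a b where "a = A 0 (point t y)" and "b = (\<Sum>j=1..n. y j * A j (point t y))"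
      have "(1 + (D t)\<^sup>2) * (a\<^sup>2 + b\<^sup>2) - (a + D t * b)\<^sup>2 = (b - D t * a)\<^sup>2"
        by (simp add: power2_eq_square algebra_simps)
      then have "(a + D t * b)\<^sup>2 \<le> (1 + (D t)\<^sup>2) * (a\<^sup>2 + b\<^sup>2)"
        by (smt (verit) zero_le_power2)
      also have "\<dots> \<le> (1 + (D t)\<^sup>2) * \<Gamma> (point t y)"
        unfolding \<Gamma>_split a_def b_def
        by (intro mult_left_mono add_left_mono cauchy_schwarz_le_1[OF y(1)]) (auto simp: add_nonneg_nonneg)
      finally show ?thesis by (simp add: u'_def a_def b_def)
    qed
  qed
qed

text \<open>The derivative of \<open>G (point t (direction n z \<rho>))\<close> with respect to \<open>z j\<close>.\<close>

definition tangential :: "real \<Rightarrow> nat \<Rightarrow> (nat \<Rightarrow> real) \<Rightarrow> real \<Rightarrow> real" where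
  "tangential t j z \<rho> = (let y = direction n z \<rho>; q = sq_norm {1..n} z + \<rho> in
     R t / sqrt q * (A j (point t y) - y j * (\<Sum>k=1..n. y k * A k (point t y))))"

text \<open>The map \<open>a \<mapsto> a - y \<langle>y, a\<rangle>\<close> is a contraction for \<open>|y| \<le> 1\<close>: the square norm drops by
  \<open>\<langle>y, a\<rangle>\<^sup>2 (2 - |y|\<^sup>2)\<close>.\<close>

lemma sum_tangential_le:
  assumes "0 < \<rho>"
  shows "(\<Sum>j=1..n. (tangential t j z \<rho>)\<^sup>2) \<le> (R t)\<^sup>2 / (sq_norm {1..n} z + \<rho>) * \<Gamma> (point t (direction n z \<rho>))"
proof -
  define y where "y = direction n z \<rho>"
  define q where "q = sq_norm {1..n} z + \<rho>"
  define a where "a j = A j (point t y)" for j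
  define b where "b = (\<Sum>k=1..n. y k * a k)"
  have "0 \<le> sq_norm {1..n} z" by (simp add: sum_nonneg)
  then have "0 < q" using assms by (simp add: q_def)
  have "(\<Sum>j=1..n. (a j - y j * b)\<^sup>2) = sq_norm {1..n} a - 2 * b * (\<Sum>j=1..n. y j * a j) + b\<^sup>2 * sq_norm {1..n} y"
    by (simp add: power2_diff power_mult_distrib sum.distrib sum_subtractf sum_distrib_left mult_ac)
  also have "\<dots> = sq_norm {1..n} a - 2 * b\<^sup>2 + b\<^sup>2 * sq_norm {1..n} y"
    unfolding b_def[symmetric] by (simp add: power2_eq_square)
  also have "b\<^sup>2 * sq_norm {1..n} y \<le> b\<^sup>2 * 1"
    unfolding y_def by (intro mult_left_mono sq_norm_direction_le_1 assms) simp
  finally have "(\<Sum>j=1..n. (a j - y j * b)\<^sup>2) \<le> sq_norm {1..n} a"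
    by (smt (verit) zero_le_power2)
  also have "\<dots> \<le> \<Gamma> (point t y)" unfolding a_def by (rule transversal_le_\<Gamma>)
  finally have "(R t)\<^sup>2 / q * (\<Sum>j=1..n. (a j - y j * b)\<^sup>2) \<le> (R t)\<^sup>2 / q * \<Gamma> (point t y)"
    using \<open>0 < q\<close> by (intro mult_left_mono) auto
  moreover have "(tangential t j z \<rho>)\<^sup>2 = (R t)\<^sup>2 / q * (a j - y j * b)\<^sup>2" for j
    unfolding tangential_def Let_def y_def[symmetric] q_def[symmetric] a_def[symmetric] b_def[symmetric]
    using \<open>0 < q\<close> by (simp add: power_mult_distrib power_divide)
  ultimately show ?thesis by (simp add: sum_distrib_left y_def q_def)
qed

lemma direction_coordinate_derivative:
  fixes z :: "nat \<Rightarrow> real" and s :: real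
  assumes "0 < \<rho>" "j \<in> {1..n}" "k \<in> {1..n}"
  defines "q \<equiv> \<lambda>s. sq_norm {1..n} (z(j := s)) + \<rho>"
  shows "((\<lambda>s. direction n (z(j := s)) \<rho> k) has_real_derivative
     ((if k = j then 1 else 0) - direction n (z(j := s)) \<rho> j * direction n (z(j := s)) \<rho> k) / sqrt (q s)) (at s)"
proof -
  have q: "q s = (sq_norm ({1..n} - {j}) z + \<rho>) + s\<^sup>2" for s
    unfolding q_def sq_norm_update[OF finite_atLeastAtMost assms(2)] by simp
  have q_pos: "0 < q s" for s
    using assms(1) by (simp add: q_def add_nonneg_pos sum_nonneg)
  have dq: "(q has_real_derivative 2 * s) (at s)"
    unfolding q by (auto intro!: derivative_eq_intros)
  have dir: "direction n (z(j := s)) \<rho> i = (z(j := s)) i / sqrt (q s)" if "i \<in> {1..n}" for i s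
    using that by (simp only: direction_def q_def restrict_apply' )
  have "((\<lambda>s. (z(j := s)) k / sqrt (q s)) has_real_derivative
      ((if k = j then 1 else 0) * sqrt (q s) - (z(j := s)) k * (inverse (sqrt (q s)) / 2 * (2 * s))) / (sqrt (q s) * sqrt (q s))) (at s)"
    using q_pos[of s] by (intro DERIV_divide DERIV_chain2[OF DERIV_real_sqrt dq]) (auto intro!: derivative_eq_intros)
  moreover have "((if k = j then 1 else 0) * sqrt (q s) - (z(j := s)) k * (inverse (sqrt (q s)) / 2 * (2 * s))) / (sqrt (q s) * sqrt (q s))
      = ((if k = j then 1 else 0) - direction n (z(j := s)) \<rho> j * direction n (z(j := s)) \<rho> k) / sqrt (q s)"
    using q_pos[of s] unfolding dir[OF assms(2)] dir[OF assms(3)] by (simp add: field_simps)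
  ultimately show ?thesis using assms(3) by (simp add: dir)
qed

lemma sq_norm_update_continuous:
  assumes "j \<in> {1..n}"
  shows "continuous_on UNIV (\<lambda>s. sq_norm {1..n} (z(j := s)))"
  unfolding sq_norm_update[OF finite_atLeastAtMost assms] by (intro continuous_intros)

lemma tangential_osc:
  assumes t: "t \<in> S" and "0 < \<rho>" and j: "j \<in> {1..n}"
  shows "osc gauss (\<lambda>s. G (point t (direction n (z(j := s)) \<rho>)))
    \<le> 64 * (\<integral>\<^sup>+s. ennreal ((tangential t j (z(j := s)) \<rho>)\<^sup>2) \<partial>gauss)"
proof (rule osc_gauss_le[where B = B])
  let ?y = "\<lambda>s. direction n (z(j := s)) \<rho>" and ?q = "\<lambda>s. sq_norm {1..n} (z(j := s)) + \<rho>"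
  have q_pos: "0 < ?q s" for s
    using \<open>0 < \<rho>\<close> by (simp only: add_nonneg_pos sum_nonneg zero_le_power2)
  have dir_cont: "continuous_on UNIV (\<lambda>s. ?y s k)" if "k \<in> {1..n}" for k
    using direction_coordinate_derivative[OF \<open>0 < \<rho>\<close> j that]
    by (intro continuous_at_imp_continuous_on ballI) (blast intro: DERIV_isCont)
  have curve_cont: "continuous_on UNIV (\<lambda>s. if k = 0 then t else R t * ?y s k)" if "k < Suc n" for k
    using that dir_cont[of k] by (cases "k = 0") (auto intro!: continuous_intros)
  show "((\<lambda>s. G (point t (?y s))) has_real_derivative tangential t j (z(j := s)) \<rho>) (at s)" for s
  proof -
    let ?d = "\<lambda>k. ((if k = j then 1 else 0) - ?y s j * ?y s k) / sqrt (?q s)"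
    have "((\<lambda>s. G (point t (?y s))) has_real_derivative (\<Sum>k<Suc n. A k (point t (?y s)) * (if k = 0 then 0 else R t * ?d k))) (at s)"
      unfolding point_def
    proof (rule chain)
      fix k assume "k < Suc n"
      show "((\<lambda>s. if k = 0 then t else R t * ?y s k) has_real_derivative (if k = 0 then 0 else R t * ?d k)) (at s)"
      proof (cases "k = 0")
        case False
        then have "k \<in> {1..n}" using \<open>k < Suc n\<close> by auto
        from DERIV_cmult[OF direction_coordinate_derivative[OF \<open>0 < \<rho>\<close> j this], of "R t"] False show ?thesis by simp
      qed simp
    qed
    also have "(\<Sum>k<Suc n. A k (point t (?y s)) * (if k = 0 then 0 else R t * ?d k)) = tangential t j (z(j := s)) \<rho>"
    proof -
      have "(\<Sum>k<Suc n. A k (point t (?y s)) * (if k = 0 then 0 else R t * ?d k))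
          = (\<Sum>k=1..n. R t / sqrt (?q s) * ((if k = j then A k (point t (?y s)) else 0) - ?y s j * (?y s k * A k (point t (?y s)))))"
        unfolding split_coordinates by (auto intro!: sum.cong simp: field_simps)
      also have "\<dots> = R t / sqrt (?q s) * (\<Sum>k=1..n. (if k = j then A k (point t (?y s)) else 0) - ?y s j * (?y s k * A k (point t (?y s))))"
        by (rule sum_distrib_left[symmetric])
      also have "\<dots> = tangential t j (z(j := s)) \<rho>"
        using j unfolding tangential_def Let_def sum_subtractf sum_distrib_left[symmetric] by (simp only: sum.delta finite_atLeastAtMost if_True)
      finally show ?thesis .
    qed
    finally show ?thesis .
  qed
  have "continuous_on UNIV (\<lambda>s. A k (point t (?y s)))" if "k < Suc n" for k
    unfolding point_def by (intro continuous_on_along_curve[OF A_cont[OF that]] curve_cont)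
  then show "continuous_on UNIV (\<lambda>s. tangential t j (z(j := s)) \<rho>)"
    unfolding tangential_def Let_def using j dir_cont q_pos
    by (intro continuous_intros sq_norm_update_continuous) (auto simp: less_imp_neq[symmetric])
  show "\<bar>G (point t (?y s))\<bar> \<le> B" for s
    unfolding point_def by (intro G_bound t sq_norm_direction_le_1 \<open>0 < \<rho>\<close>)
qed

text \<open>The derivative \<open>- R t / (2 q) \<langle>y, \<nabla>\<rangle>\<close> is of order \<open>1 / q\<close>, twice that of the tangential ones; the
  weight \<open>\<rho> \<le> q\<close> of \<open>osc_expo_le\<close> restores the factor \<open>1 / q\<close> for its square.\<close>

lemma radial_osc:
  assumes t: "t \<in> S" and z: "z \<in> space (lebesgue_PiM {1..n})"
  shows "osc expo (\<lambda>\<rho>. G (point t (direction n z \<rho>)))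
    \<le> 144 * (\<integral>\<^sup>+\<rho>. ennreal ((R t)\<^sup>2 / (4 * (sq_norm {1..n} z + \<rho>)) * \<Gamma> (point t (direction n z \<rho>))) \<partial>expo)"
proof -
  let ?y = "\<lambda>\<rho>. direction n z \<rho>" and ?q = "\<lambda>\<rho>. sq_norm {1..n} z + \<rho>"
  define u' where "u' \<rho> = - R t / (2 * ?q \<rho>) * (\<Sum>k=1..n. ?y \<rho> k * A k (point t (?y \<rho>)))" for \<rho>
  note [measurable] = z
  have N: "0 \<le> sq_norm {1..n} z" by (simp add: sum_nonneg)
  have dir: "?y \<rho> k = z k / sqrt (?q \<rho>)" if "k \<in> {1..n}" for k \<rho>
    using that by (simp add: direction_def)
  have dir_deriv: "((\<lambda>\<rho>. ?y \<rho> k) has_real_derivative - ?y \<rho> k / (2 * ?q \<rho>)) (at \<rho>)"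
    if "k \<in> {1..n}" "0 < \<rho>" for k \<rho>
  proof -
    have q_pos: "0 < ?q \<rho>" using N that by simp
    have "((\<lambda>\<rho>. z k / sqrt (?q \<rho>)) has_real_derivative
        (0 * sqrt (?q \<rho>) - z k * (inverse (sqrt (?q \<rho>)) / 2 * 1)) / (sqrt (?q \<rho>) * sqrt (?q \<rho>))) (at \<rho>)"
      using q_pos by (intro DERIV_divide DERIV_chain2[OF DERIV_real_sqrt]) (auto intro!: derivative_eq_intros)
    moreover have "(0 * sqrt (?q \<rho>) - z k * (inverse (sqrt (?q \<rho>)) / 2 * 1)) / (sqrt (?q \<rho>) * sqrt (?q \<rho>)) = - ?y \<rho> k / (2 * ?q \<rho>)"
      using q_pos unfolding dir[OF that(1)] by (simp add: field_simps)
    ultimately show ?thesis unfolding dir[OF that(1)] by simp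
  qed
  have dir_cont: "continuous_on {0<..} (\<lambda>\<rho>. ?y \<rho> k)" if "k \<in> {1..n}" for k
    using dir_deriv[OF that] by (intro continuous_at_imp_continuous_on ballI) (blast intro: DERIV_isCont)
  have curve_cont: "continuous_on {0<..} (\<lambda>\<rho>. if k = 0 then t else R t * ?y \<rho> k)" if "k < Suc n" for k
    using that dir_cont[of k] by (cases "k = 0") (auto intro!: continuous_intros)
  have A_cont': "continuous_on {0<..} (\<lambda>\<rho>. A k (point t (?y \<rho>)))" if "k < Suc n" for k
    unfolding point_def by (intro continuous_on_along_curve[OF A_cont[OF that]] curve_cont)
  have A_meas: "(\<lambda>\<rho>. A k (point t (?y \<rho>))) \<in> borel_measurable borel" if "k < Suc n" for k
    by (rule measurable_compose[OF _ borel_measurable_A[OF that]]) measurable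
  have y_meas: "(\<lambda>\<rho>. ?y \<rho> k) \<in> borel_measurable borel" if "k \<in> {1..n}" for k
    unfolding dir[OF that] by measurable
  have "osc expo (\<lambda>\<rho>. G (point t (?y \<rho>))) \<le> 144 * (\<integral>\<^sup>+\<rho>. ennreal (\<rho> * (u' \<rho>)\<^sup>2) \<partial>expo)"
  proof (rule osc_expo_le[where B = B])
    show "((\<lambda>\<rho>. G (point t (?y \<rho>))) has_real_derivative u' \<rho>) (at \<rho>)" if "0 < \<rho>" for \<rho>
    proof -
      have "((\<lambda>\<rho>. G (point t (?y \<rho>))) has_real_derivative (\<Sum>k<Suc n. A k (point t (?y \<rho>)) * (if k = 0 then 0 else R t * (- ?y \<rho> k / (2 * ?q \<rho>))))) (at \<rho>)"
        unfolding point_def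
      proof (rule chain)
        fix k assume "k < Suc n"
        show "((\<lambda>\<rho>. if k = 0 then t else R t * ?y \<rho> k) has_real_derivative (if k = 0 then 0 else R t * (- ?y \<rho> k / (2 * ?q \<rho>)))) (at \<rho>)"
        proof (cases "k = 0")
          case False
          then have "k \<in> {1..n}" using \<open>k < Suc n\<close> by auto
          from DERIV_cmult[OF dir_deriv[OF this that], of "R t"] False show ?thesis by simp
        qed simp
      qed
      also have "(\<Sum>k<Suc n. A k (point t (?y \<rho>)) * (if k = 0 then 0 else R t * (- ?y \<rho> k / (2 * ?q \<rho>)))) = u' \<rho>"
        unfolding split_coordinates u'_def sum_distrib_left by (auto intro!: sum.cong)
      finally show ?thesis .
    qed
    show "continuous_on {0<..} u'"
      unfolding u'_def using N A_cont' dir_cont by (intro continuous_intros) auto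
    show "\<bar>G (point t (?y \<rho>))\<bar> \<le> B" if "0 < \<rho>" for \<rho>
      unfolding point_def by (intro G_bound t sq_norm_direction_le_1 that)
    show "u' \<in> borel_measurable borel"
      unfolding u'_def using A_meas y_meas
      by (intro borel_measurable_times borel_measurable_sum borel_measurable_divide borel_measurable_add) auto
  qed
  also have "\<dots> \<le> 144 * (\<integral>\<^sup>+\<rho>. ennreal ((R t)\<^sup>2 / (4 * ?q \<rho>) * \<Gamma> (point t (?y \<rho>))) \<partial>expo)"
  proof (intro mult_left_mono nn_integral_mono_AE, use AE_expo_pos in eventually_elim)
    fix \<rho> :: real assume "0 < \<rho>"
    then have q: "0 < ?q \<rho>" "\<rho> \<le> ?q \<rho>" using N by auto
    define b where "b = (\<Sum>k=1..n. ?y \<rho> k * A k (point t (?y \<rho>)))"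
    have "b\<^sup>2 \<le> \<Gamma> (point t (?y \<rho>))"
      unfolding b_def using cauchy_schwarz_le_1[OF sq_norm_direction_le_1[OF \<open>0 < \<rho>\<close>]] transversal_le_\<Gamma> by (rule order_trans)
    define q where "q = ?q \<rho>"
    have q: "0 < q" "\<rho> \<le> q" using q by (auto simp: q_def)
    have "\<rho> * (u' \<rho>)\<^sup>2 = \<rho> * ((R t)\<^sup>2 / (4 * (q)\<^sup>2) * b\<^sup>2)"
      unfolding u'_def b_def[symmetric] q_def[symmetric] by (simp add: power_mult_distrib power_divide)
    also have "\<dots> \<le> q * ((R t)\<^sup>2 / (4 * (q)\<^sup>2) * b\<^sup>2)"
      using q by (intro mult_right_mono) auto
    also have "\<dots> = (R t)\<^sup>2 / (4 * q) * b\<^sup>2"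
      using q by (simp add: power2_eq_square)
    also have "\<dots> \<le> (R t)\<^sup>2 / (4 * q) * \<Gamma> (point t (?y \<rho>))"
      using q \<open>b\<^sup>2 \<le> _\<close> by (intro mult_left_mono) auto
    finally show "ennreal (\<rho> * (u' \<rho>)\<^sup>2) \<le> ennreal ((R t)\<^sup>2 / (4 * ?q \<rho>) * \<Gamma> (point t (?y \<rho>)))"
      unfolding q_def by (rule ennreal_leI)
  qed simp
  finally show ?thesis .
qed

text \<open>Efron--Stein over the \<open>n\<close> Gaussian variables and the exponential one.  The constants \<open>64\<close> for the
  first and \<open>144 / 4 = 36\<close> for the second add up to \<open>100\<close>, and \<open>ball_avg_weight\<close> contributes the factor \<open>2 / n\<close>.\<close>

lemma cross_section_osc:
  assumes t: "t \<in> S"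
  shows "(\<integral>\<^sup>+z. \<integral>\<^sup>+\<rho>. \<integral>\<^sup>+z'. \<integral>\<^sup>+\<rho>'. ennreal ((G (point t (direction n z \<rho>)) - G (point t (direction n z' \<rho>')))\<^sup>2) \<partial>expo \<partial>\<gamma> \<partial>expo \<partial>\<gamma>)
    \<le> ennreal (200 * M\<^sup>2 / n) * ball_avg n (\<lambda>y. ennreal (\<Gamma> (point t y)))"
proof -
  interpret g: prob_space \<gamma> by (rule prob_space_\<gamma>)
  interpret e: prob_space expo by (rule prob_space_expo)
  interpret ge: pair_prob_space \<gamma> expo ..
  interpret gs: product_prob_space "\<lambda>_::nat. gauss" "{1..n}" by (rule product_prob_spaceI) (rule prob_space_gauss)
  let ?N = "sq_norm {1..n}"
  let ?g = "\<lambda>z \<rho>. G (point t (direction n z \<rho>))" and ?w = "\<lambda>z \<rho>. \<Gamma> (point t (direction n z \<rho>))"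
  let ?F = "\<lambda>z \<rho>. ennreal (?w z \<rho>) * ennreal (1 / (?N z + \<rho>))"
  let ?I = "\<integral>\<^sup>+z. \<integral>\<^sup>+\<rho>. ?F z \<rho> \<partial>expo \<partial>\<gamma>"
  have N: "0 \<le> ?N z" for z by (simp add: sum_nonneg)
  have R2: "(R t)\<^sup>2 \<le> M\<^sup>2" using R_le[OF t] R_nonneg by (intro power_mono)
  have joint[measurable]: "(\<lambda>p. G (point t (direction n (u p) (v p)))) \<in> borel_measurable L"
    if [measurable]: "u \<in> measurable L (lebesgue_PiM {1..n})" "v \<in> borel_measurable L" for u v and L :: "'z measure"
    by measurable
  have bound: "ennreal (c * (R t)\<^sup>2 / (?N z + \<rho>) * ?w z \<rho>) \<le> ennreal (c * M\<^sup>2) * ?F z \<rho>"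
    if "0 < \<rho>" "0 \<le> c" for c z \<rho>
  proof -
    have q: "0 < ?N z + \<rho>" using N[of z] that by simp
    have "c * (R t)\<^sup>2 / (?N z + \<rho>) * ?w z \<rho> \<le> c * M\<^sup>2 / (?N z + \<rho>) * ?w z \<rho>"
      using q that R2 \<Gamma>_nonneg by (intro mult_right_mono divide_right_mono mult_left_mono) auto
    also have "\<dots> = c * M\<^sup>2 * (?w z \<rho> * (1 / (?N z + \<rho>)))" by simp
    finally have "ennreal (c * (R t)\<^sup>2 / (?N z + \<rho>) * ?w z \<rho>)
        \<le> ennreal (c * M\<^sup>2 * (?w z \<rho> * (1 / (?N z + \<rho>))))"
      by (rule ennreal_leI)
    also have "\<dots> = ennreal (c * M\<^sup>2) * ennreal (?w z \<rho> * (1 / (?N z + \<rho>)))"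
      using q that \<Gamma>_nonneg by (intro ennreal_mult) auto
    also have "ennreal (?w z \<rho> * (1 / (?N z + \<rho>))) = ?F z \<rho>"
      using q \<Gamma>_nonneg by (intro ennreal_mult) auto
    finally show ?thesis .
  qed
  have tangential_meas[measurable]: "(\<lambda>p. tangential t j (u p) (v p)) \<in> borel_measurable L"
    if j: "j \<in> {1..n}" and [measurable]: "u \<in> measurable L (lebesgue_PiM {1..n})" "v \<in> borel_measurable L" for j u v and L :: "'z measure"
  proof -
    have y: "(\<lambda>p. direction n (u p) (v p)) \<in> measurable L (lebesgue_PiM {1..n})" by measurable
    have A: "(\<lambda>p. A k (point t (direction n (u p) (v p)))) \<in> borel_measurable L" if "k \<in> {1..n}" for k
      by (rule measurable_compose[OF _ borel_measurable_A]) (use that in \<open>measurable, auto\<close>)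
    have c: "(\<lambda>p. direction n (u p) (v p) k) \<in> borel_measurable L" if "k \<in> {1..n}" for k
      using measurable_compose[OF y measurable_component_singleton[OF that]] by simp
    have "(\<lambda>p. sqrt (?N (u p) + v p)) \<in> borel_measurable L" by measurable
    then show ?thesis
      unfolding tangential_def Let_def using A c j
      by (intro borel_measurable_times borel_measurable_diff borel_measurable_sum borel_measurable_divide borel_measurable_const) auto
  qed
  have "(\<integral>\<^sup>+z. \<integral>\<^sup>+\<rho>. \<integral>\<^sup>+z'. \<integral>\<^sup>+\<rho>'. ennreal ((?g z \<rho> - ?g z' \<rho>')\<^sup>2) \<partial>expo \<partial>\<gamma> \<partial>expo \<partial>\<gamma>)
      \<le> (\<integral>\<^sup>+\<rho>. osc \<gamma> (\<lambda>z. ?g z \<rho>) \<partial>expo) + (\<integral>\<^sup>+z. osc expo (\<lambda>\<rho>. ?g z \<rho>) \<partial>\<gamma>)"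
    by (rule osc_pair[OF prob_space_\<gamma> prob_space_expo]) measurable
  also have "(\<integral>\<^sup>+z. osc expo (\<lambda>\<rho>. ?g z \<rho>) \<partial>\<gamma>) \<le> ennreal (36 * M\<^sup>2) * ?I"
  proof -
    have "(\<integral>\<^sup>+z. osc expo (\<lambda>\<rho>. ?g z \<rho>) \<partial>\<gamma>)
        \<le> (\<integral>\<^sup>+z. \<integral>\<^sup>+\<rho>. ennreal (36 * M\<^sup>2) * ?F z \<rho> \<partial>expo \<partial>\<gamma>)"
    proof (rule nn_integral_mono)
      fix z assume "z \<in> space \<gamma>"
      then have z[measurable]: "z \<in> space (lebesgue_PiM {1..n})" by (simp add: space_\<gamma>)
      have "osc expo (\<lambda>\<rho>. ?g z \<rho>)
          \<le> 144 * (\<integral>\<^sup>+\<rho>. ennreal ((R t)\<^sup>2 / (4 * (?N z + \<rho>)) * ?w z \<rho>) \<partial>expo)"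
        by (rule radial_osc[OF t z])
      also have "\<dots> = (\<integral>\<^sup>+\<rho>. 144 * ennreal ((R t)\<^sup>2 / (4 * (?N z + \<rho>)) * ?w z \<rho>) \<partial>expo)"
        by (rule nn_integral_cmult[symmetric]) measurable
      also have "\<dots> \<le> (\<integral>\<^sup>+\<rho>. ennreal (36 * M\<^sup>2) * ?F z \<rho> \<partial>expo)"
      proof (intro nn_integral_mono_AE, use AE_expo_pos in eventually_elim)
        fix \<rho> :: real assume "0 < \<rho>"
        have "144 * ennreal ((R t)\<^sup>2 / (4 * (?N z + \<rho>)) * ?w z \<rho>)
            = ennreal (144 * ((R t)\<^sup>2 / (4 * (?N z + \<rho>)) * ?w z \<rho>))"
          by (subst ennreal_mult'[of 144]) simp_all
        also have "144 * ((R t)\<^sup>2 / (4 * (?N z + \<rho>)) * ?w z \<rho>) = 36 * (R t)\<^sup>2 / (?N z + \<rho>) * ?w z \<rho>"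
        proof -
          have "144 * (r / (4 * q) * g) = 36 * r / q * g" for r q g :: real by simp
          then show ?thesis .
        qed
        also have "ennreal \<dots> \<le> ennreal (36 * M\<^sup>2) * ?F z \<rho>"
          by (rule bound[OF \<open>0 < \<rho>\<close>]) simp
        finally show "144 * ennreal ((R t)\<^sup>2 / (4 * (?N z + \<rho>)) * ?w z \<rho>)
            \<le> ennreal (36 * M\<^sup>2) * ?F z \<rho>" .
      qed
      finally show "osc expo (\<lambda>\<rho>. ?g z \<rho>)
          \<le> (\<integral>\<^sup>+\<rho>. ennreal (36 * M\<^sup>2) * ?F z \<rho> \<partial>expo)" .
    qed
    also have "\<dots> = (\<integral>\<^sup>+z. ennreal (36 * M\<^sup>2) * (\<integral>\<^sup>+\<rho>. ?F z \<rho> \<partial>expo) \<partial>\<gamma>)"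
      by (intro nn_integral_cong nn_integral_cmult) (simp add: space_\<gamma>, measurable)
    also have "\<dots> = ennreal (36 * M\<^sup>2) * ?I"
      by (rule nn_integral_cmult) measurable
    finally show ?thesis .
  qed
  also have "(\<integral>\<^sup>+\<rho>. osc \<gamma> (\<lambda>z. ?g z \<rho>) \<partial>expo) \<le> ennreal (64 * M\<^sup>2) * ?I"
  proof -
    have "(\<integral>\<^sup>+\<rho>. osc \<gamma> (\<lambda>z. ?g z \<rho>) \<partial>expo)
        \<le> (\<integral>\<^sup>+\<rho>. \<integral>\<^sup>+z. ennreal (64 * M\<^sup>2) * ?F z \<rho> \<partial>\<gamma> \<partial>expo)"
    proof (intro nn_integral_mono_AE, use AE_expo_pos in eventually_elim)
      fix \<rho> :: real assume "0 < \<rho>"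
      have "osc \<gamma> (\<lambda>z. ?g z \<rho>) \<le> (\<Sum>j\<in>{1..n}. \<integral>\<^sup>+z. osc gauss (\<lambda>s. ?g (z(j := s)) \<rho>) \<partial>\<gamma>)"
        by (rule osc_PiM[OF _ prob_space_gauss]) auto
      also have "\<dots> \<le> (\<Sum>j\<in>{1..n}. \<integral>\<^sup>+z. 64 * ennreal ((tangential t j z \<rho>)\<^sup>2) \<partial>\<gamma>)"
      proof (rule sum_mono)
        fix j assume j: "j \<in> {1..n}"
        have [measurable]: "(\<lambda>z. tangential t j z \<rho>) \<in> borel_measurable \<gamma>"
          using j by (rule tangential_meas) measurable
        have [measurable]: "(\<lambda>z. ennreal ((tangential t j z \<rho>)\<^sup>2)) \<in> borel_measurable \<gamma>"
          by measurable
        have upd[measurable]: "(\<lambda>p. (u p)(j := v p)) \<in> measurable L \<gamma>"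
          if "u \<in> measurable L \<gamma>" "v \<in> measurable L gauss" for u v and L :: "'z measure"
          by (rule measurable_fun_upd[OF _ that]) (use j in auto)
        have "(\<integral>\<^sup>+z. osc gauss (\<lambda>s. ?g (z(j := s)) \<rho>) \<partial>\<gamma>)
            \<le> (\<integral>\<^sup>+z. 64 * (\<integral>\<^sup>+s. ennreal ((tangential t j (z(j := s)) \<rho>)\<^sup>2) \<partial>gauss) \<partial>\<gamma>)"
          by (intro nn_integral_mono tangential_osc t \<open>0 < \<rho>\<close> j)
        also have "\<dots> = 64 * (\<integral>\<^sup>+z. \<integral>\<^sup>+s. ennreal ((tangential t j (z(j := s)) \<rho>)\<^sup>2) \<partial>gauss \<partial>\<gamma>)"
          by (rule nn_integral_cmult) measurable
        also have "\<dots> = 64 * (\<integral>\<^sup>+z. ennreal ((tangential t j z \<rho>)\<^sup>2) \<partial>\<gamma>)"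
          by (subst gs.nn_integral_PiM_resample[OF finite_atLeastAtMost j]) auto
        also have "\<dots> = (\<integral>\<^sup>+z. 64 * ennreal ((tangential t j z \<rho>)\<^sup>2) \<partial>\<gamma>)"
          by (rule nn_integral_cmult[symmetric]) measurable
        finally show "(\<integral>\<^sup>+z. osc gauss (\<lambda>s. ?g (z(j := s)) \<rho>) \<partial>\<gamma>) \<le> (\<integral>\<^sup>+z. 64 * ennreal ((tangential t j z \<rho>)\<^sup>2) \<partial>\<gamma>)" .
      qed
      also have "\<dots> = (\<integral>\<^sup>+z. (\<Sum>j\<in>{1..n}. 64 * ennreal ((tangential t j z \<rho>)\<^sup>2)) \<partial>\<gamma>)"
      proof (rule nn_integral_sum[symmetric])
        fix j assume "j \<in> {1..n}"
        then have [measurable]: "(\<lambda>z. tangential t j z \<rho>) \<in> borel_measurable \<gamma>"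
          by (rule tangential_meas) measurable
        show "(\<lambda>z. 64 * ennreal ((tangential t j z \<rho>)\<^sup>2)) \<in> borel_measurable \<gamma>" by measurable
      qed
      also have "\<dots> \<le> (\<integral>\<^sup>+z. ennreal (64 * M\<^sup>2) * ?F z \<rho> \<partial>\<gamma>)"
      proof (rule nn_integral_mono)
        fix z
        have "(\<Sum>j\<in>{1..n}. 64 * ennreal ((tangential t j z \<rho>)\<^sup>2)) = ennreal (64 * (\<Sum>j\<in>{1..n}. (tangential t j z \<rho>)\<^sup>2))"
          by (simp add: ennreal_mult' sum_ennreal[symmetric] sum_distrib_left del: sum_ennreal)
        also have "\<dots> \<le> ennreal (64 * (R t)\<^sup>2 / (?N z + \<rho>) * ?w z \<rho>)"
          using sum_tangential_le[OF \<open>0 < \<rho>\<close>, of t z] by (intro ennreal_leI) simp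
        also have "\<dots> \<le> ennreal (64 * M\<^sup>2) * ?F z \<rho>"
          by (rule bound[OF \<open>0 < \<rho>\<close>]) simp
        finally show "(\<Sum>j\<in>{1..n}. 64 * ennreal ((tangential t j z \<rho>)\<^sup>2)) \<le> ennreal (64 * M\<^sup>2) * ?F z \<rho>" .
      qed
      finally show "osc \<gamma> (\<lambda>z. ?g z \<rho>) \<le> (\<integral>\<^sup>+z. ennreal (64 * M\<^sup>2) * ?F z \<rho> \<partial>\<gamma>)" .
    qed
    also have "\<dots> = (\<integral>\<^sup>+z. \<integral>\<^sup>+\<rho>. ennreal (64 * M\<^sup>2) * ?F z \<rho> \<partial>expo \<partial>\<gamma>)"
      by (rule ge.Fubini') measurable
    also have "\<dots> = (\<integral>\<^sup>+z. ennreal (64 * M\<^sup>2) * (\<integral>\<^sup>+\<rho>. ?F z \<rho> \<partial>expo) \<partial>\<gamma>)"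
      by (intro nn_integral_cong nn_integral_cmult) (simp add: space_\<gamma>, measurable)
    also have "\<dots> = ennreal (64 * M\<^sup>2) * ?I"
      by (rule nn_integral_cmult) measurable
    finally show ?thesis .
  qed
  also have "?I = ennreal (2 / n) * ball_avg n (\<lambda>y. ennreal (\<Gamma> (point t y)))"
    by (rule ball_avg_weight) measurable
  finally have "(\<integral>\<^sup>+z. \<integral>\<^sup>+\<rho>. \<integral>\<^sup>+z'. \<integral>\<^sup>+\<rho>'. ennreal ((?g z \<rho> - ?g z' \<rho>')\<^sup>2) \<partial>expo \<partial>\<gamma> \<partial>expo \<partial>\<gamma>)
      \<le> ennreal (64 * M\<^sup>2) * (ennreal (2 / n) * ball_avg n (\<lambda>y. ennreal (\<Gamma> (point t y))))
        + ennreal (36 * M\<^sup>2) * (ennreal (2 / n) * ball_avg n (\<lambda>y. ennreal (\<Gamma> (point t y))))"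
    by (simp add: add_mono)
  also have "\<dots> = ennreal (200 * M\<^sup>2 / n) * ball_avg n (\<lambda>y. ennreal (\<Gamma> (point t y)))"
    by (simp add: mult.assoc[symmetric] ennreal_mult[symmetric] ennreal_plus[symmetric] flip: distrib_right)
  finally show ?thesis .
qed

text \<open>One more use of \<open>osc_pair\<close> separates \<open>t\<close> from \<open>(z, \<rho>)\<close>.\<close>

lemma revolution_osc:
  defines "avg \<equiv> \<lambda>\<phi>. \<integral>\<^sup>+t. ball_avg n (\<lambda>y. \<phi> (point t y)) \<partial>\<nu>"
  shows "avg (\<lambda>p. avg (\<lambda>q. ennreal ((G p - G q)\<^sup>2)))
    \<le> ennreal (16 * (64 * \<sigma>\<^sup>2 + (M / (real n + 1))\<^sup>2) + 200 * M\<^sup>2 / n) * avg (\<lambda>p. ennreal (\<Gamma> p))"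
proof -
  interpret g: prob_space \<gamma> by (rule prob_space_\<gamma>)
  interpret e: prob_space expo by (rule prob_space_expo)
  interpret ge: pair_prob_space \<gamma> expo ..
  define W where "W = \<gamma> \<Otimes>\<^sub>M expo"
  interpret W: prob_space W unfolding W_def by (rule prob_space_pair[OF prob_space_\<gamma> prob_space_expo])
  interpret nW: pair_prob_space \<nu> W ..
  have [measurable_cong]: "sets W = sets (lebesgue_PiM {1..n} \<Otimes>\<^sub>M borel)"
    unfolding W_def by (intro sets_pair_measure_cong sets_\<gamma>) simp
  define dir where "dir w = direction n (fst w) (snd w)" for w
  have [measurable]: "dir \<in> measurable W (lebesgue_PiM {1..n})"
    unfolding dir_def[abs_def] by measurable
  have W_int: "(\<integral>\<^sup>+w. f w \<partial>W) = (\<integral>\<^sup>+z. \<integral>\<^sup>+\<rho>. f (z, \<rho>) \<partial>expo \<partial>\<gamma>)" if "f \<in> borel_measurable W" for f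
    using e.nn_integral_fst[of f \<gamma>] that by (simp add: W_def)
  have avg_W: "avg \<phi> = (\<integral>\<^sup>+t. \<integral>\<^sup>+w. \<phi> (point t (dir w)) \<partial>W \<partial>\<nu>)" if [measurable]: "\<phi> \<in> borel_measurable (lebesgue_PiM {..<Suc n})" for \<phi>
    unfolding avg_def ball_avg_def by (subst W_int) (measurable, simp add: dir_def)
  have inner: "avg (\<lambda>q. ennreal ((a - G q)\<^sup>2)) = (\<integral>\<^sup>+t. \<integral>\<^sup>+w. ennreal ((a - G (point t (dir w)))\<^sup>2) \<partial>W \<partial>\<nu>)" for a
    by (rule avg_W) measurable
  have "avg (\<lambda>p. avg (\<lambda>q. ennreal ((G p - G q)\<^sup>2)))
      = (\<integral>\<^sup>+t. \<integral>\<^sup>+w. \<integral>\<^sup>+t'. \<integral>\<^sup>+w'. ennreal ((G (point t (dir w)) - G (point t' (dir w')))\<^sup>2) \<partial>W \<partial>\<nu> \<partial>W \<partial>\<nu>)"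
    unfolding inner by (rule avg_W) measurable
  also have "\<dots> \<le> (\<integral>\<^sup>+w. osc \<nu> (\<lambda>t. G (point t (dir w))) \<partial>W) + (\<integral>\<^sup>+t. osc W (\<lambda>w. G (point t (dir w))) \<partial>\<nu>)"
    by (rule osc_pair[OF prob_space_\<nu> W.prob_space_axioms]) measurable
  also have "(\<integral>\<^sup>+w. osc \<nu> (\<lambda>t. G (point t (dir w))) \<partial>W)
      \<le> ennreal (16 * (64 * \<sigma>\<^sup>2 + (M / (real n + 1))\<^sup>2)) * avg (\<lambda>p. ennreal (\<Gamma> p))" (is "_ \<le> ?K * _")
  proof -
    have pos: "AE w in W. 0 < snd w"
      unfolding W_def
    proof (rule ge.AE_pair_measure)
      have "{w \<in> space W. 0 < snd w} \<in> sets W" by measurable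
      then show "{w \<in> space (\<gamma> \<Otimes>\<^sub>M expo). 0 < snd w} \<in> sets (\<gamma> \<Otimes>\<^sub>M expo)" unfolding W_def .
    qed (use AE_expo_pos in simp)
    have "(\<integral>\<^sup>+w. osc \<nu> (\<lambda>t. G (point t (dir w))) \<partial>W) \<le> (\<integral>\<^sup>+w. ?K * (\<integral>\<^sup>+t. ennreal (\<Gamma> (point t (dir w))) \<partial>\<nu>) \<partial>W)"
    proof (intro nn_integral_mono_AE, use pos AE_space in eventually_elim)
      fix w assume "0 < snd w" "w \<in> space W"
      show "osc \<nu> (\<lambda>t. G (point t (dir w))) \<le> ?K * (\<integral>\<^sup>+t. ennreal (\<Gamma> (point t (dir w))) \<partial>\<nu>)"
      proof (intro axial_osc)
        show "sq_norm {1..n} (dir w) \<le> 1" unfolding dir_def by (rule sq_norm_direction_le_1) fact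
        show "dir w \<in> space (lebesgue_PiM {1..n})" by (simp add: dir_def direction_def space_PiM)
      qed
    qed
    also have "\<dots> = ?K * (\<integral>\<^sup>+w. \<integral>\<^sup>+t. ennreal (\<Gamma> (point t (dir w))) \<partial>\<nu> \<partial>W)"
      by (rule nn_integral_cmult) measurable
    also have "(\<integral>\<^sup>+w. \<integral>\<^sup>+t. ennreal (\<Gamma> (point t (dir w))) \<partial>\<nu> \<partial>W) = avg (\<lambda>p. ennreal (\<Gamma> p))"
      by (subst avg_W) (measurable, rule nW.Fubini', measurable)
    finally show ?thesis .
  qed
  also have "(\<integral>\<^sup>+t. osc W (\<lambda>w. G (point t (dir w))) \<partial>\<nu>) \<le> ennreal (200 * M\<^sup>2 / n) * avg (\<lambda>p. ennreal (\<Gamma> p))"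
  proof -
    have "(\<integral>\<^sup>+t. osc W (\<lambda>w. G (point t (dir w))) \<partial>\<nu>) \<le> (\<integral>\<^sup>+t. ennreal (200 * M\<^sup>2 / n) * ball_avg n (\<lambda>y. ennreal (\<Gamma> (point t y))) \<partial>\<nu>)"
    proof (intro nn_integral_mono_AE, use AE_\<nu>_S in eventually_elim)
      fix t assume t: "t \<in> S"
      have "osc W (\<lambda>w. G (point t (dir w))) = (\<integral>\<^sup>+w. \<integral>\<^sup>+z'. \<integral>\<^sup>+\<rho>'. ennreal ((G (point t (dir w)) - G (point t (direction n z' \<rho>')))\<^sup>2) \<partial>expo \<partial>\<gamma> \<partial>W)"
        unfolding osc_def by (subst W_int) (measurable, simp add: dir_def)
      also have "\<dots> = (\<integral>\<^sup>+z. \<integral>\<^sup>+\<rho>. \<integral>\<^sup>+z'. \<integral>\<^sup>+\<rho>'. ennreal ((G (point t (direction n z \<rho>)) - G (point t (direction n z' \<rho>')))\<^sup>2) \<partial>expo \<partial>\<gamma> \<partial>expo \<partial>\<gamma>)"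
        by (subst W_int) (measurable, simp add: dir_def)
      also have "\<dots> \<le> ennreal (200 * M\<^sup>2 / n) * ball_avg n (\<lambda>y. ennreal (\<Gamma> (point t y)))"
        by (rule cross_section_osc[OF t])
      finally show "osc W (\<lambda>w. G (point t (dir w))) \<le> ennreal (200 * M\<^sup>2 / n) * ball_avg n (\<lambda>y. ennreal (\<Gamma> (point t y)))" .
    qed
    also have "\<dots> = ennreal (200 * M\<^sup>2 / n) * avg (\<lambda>p. ennreal (\<Gamma> p))"
      unfolding avg_def ball_avg_def by (rule nn_integral_cmult) measurable
    finally show ?thesis .
  qed
  finally show ?thesis
    by (simp add: add_mono distrib_right ennreal_plus)
qed

end

section \<open>Integration over a body of revolution\<close>

lemma ball_law:
  assumes n: "1 \<le> n"
  obtains b :: real where "0 < b"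
    "\<And>\<phi>. \<phi> \<in> borel_measurable (lebesgue_PiM {1..n}) \<Longrightarrow>
      (\<integral>\<^sup>+y. \<phi> y * indicator {y. sq_norm {1..n} y \<le> 1} y \<partial>lebesgue_PiM {1..n})
      = ennreal b * ball_avg n \<phi>"
proof -
  define c where "c = (1 / sqrt pi) ^ n * Gamma (n / 2 + 1)"
  have "0 < c" by (simp add: c_def Gamma_real_pos)
  have "ennreal ((1 / sqrt pi) ^ n) * ennreal (Gamma (n / 2 + 1)) = ennreal c"
    unfolding c_def by (intro ennreal_mult[symmetric]) (auto intro!: less_imp_le Gamma_real_pos)
  then have law: "ball_avg n \<phi>
      = ennreal c * (\<integral>\<^sup>+y. \<phi> y * indicator {y. sq_norm {1..n} y \<le> 1} y \<partial>lebesgue_PiM {1..n})"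
    if "\<phi> \<in> borel_measurable (lebesgue_PiM {1..n})" for \<phi>
    using nn_integral_gauss_expo[OF _ that, of "\<lambda>_. 1"] radial_moment(1)[of n] n
    by (simp add: ball_avg_def direction_def)
  show ?thesis
  proof (rule that[of "1 / c"])
    show "0 < 1 / c" using \<open>0 < c\<close> by simp
    fix \<phi> :: "(nat \<Rightarrow> real) \<Rightarrow> ennreal" assume \<phi>: "\<phi> \<in> borel_measurable (lebesgue_PiM {1..n})"
    have "ennreal (1 / c) * ennreal c = 1"
      using \<open>0 < c\<close> by (subst ennreal_mult[symmetric]) auto
    then show "(\<integral>\<^sup>+y. \<phi> y * indicator {y. sq_norm {1..n} y \<le> 1} y \<partial>lebesgue_PiM {1..n})
      = ennreal (1 / c) * ball_avg n \<phi>"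
      unfolding law[OF \<phi>] by (simp only: mult.assoc[symmetric] mult_1)
  qed
qed

text \<open>The concentric ball of half the radius has at most half of the volume, so \<open>|y|\<^sup>2 > 1/4\<close> with probability
  at least \<open>1/2\<close>.\<close>

lemma direction_second_moment:
  assumes n: "1 \<le> n"
  shows "ennreal (1 / 8) \<le> ball_avg n (\<lambda>y. ennreal (sq_norm {1..n} y))"
proof -
  let ?L = "lebesgue_PiM {1..n}" and ?N = "sq_norm {1..n}"
  let ?in = "\<lambda>y. indicator {y. ?N y \<le> 1/4} y :: ennreal" and ?out = "\<lambda>y. indicator {y. 1/4 < ?N y} y :: ennreal"
  let ?E = "\<lambda>\<phi>. \<integral>\<^sup>+z. \<integral>\<^sup>+\<rho>. \<phi> (direction n z \<rho>) \<partial>expo \<partial>PiM {1..n} (\<lambda>_. gauss)"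
  interpret g: prob_space "PiM {1..n::nat} (\<lambda>_. gauss)" by (intro prob_space_PiM prob_space_gauss)
  interpret e: prob_space expo by (rule prob_space_expo)
  have [measurable_cong]: "sets (PiM {1..n::nat} (\<lambda>_. gauss)) = sets ?L"
    by (intro sets_PiM_cong) auto
  have space: "space (PiM {1..n::nat} (\<lambda>_. gauss)) = space ?L"
    by (simp add: space_PiM)
  obtain b :: real where "0 < b" and b: "\<And>\<phi>. \<phi> \<in> borel_measurable ?L \<Longrightarrow> (\<integral>\<^sup>+y. \<phi> y * indicator {y. ?N y \<le> 1} y \<partial>?L) = ennreal b * ?E \<phi>"
    using ball_law[OF n] unfolding ball_avg_def by blast
  have [measurable]: "(\<lambda>y. indicator {y. P (?N y)} y :: ennreal) \<in> borel_measurable ?L" if [measurable]: "Measurable.pred borel P" for P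
  proof -
    have "(\<lambda>y. indicator {y. P (?N y)} y :: ennreal) = (\<lambda>y. if P (?N y) then 1 else 0)" by (auto simp: indicator_def)
    also have "\<dots> \<in> borel_measurable ?L" by measurable
    finally show ?thesis .
  qed
  have "ennreal b * ?E ?in = (\<integral>\<^sup>+y. indicator {y. ?N y \<le> 1/4} y * indicator {y. ?N y \<le> 1} y \<partial>?L)"
    by (rule b[symmetric]) measurable
  also have "\<dots> = (\<integral>\<^sup>+y. indicator {y. ?N y \<le> 1/4} y \<partial>?L)"
    by (intro nn_integral_cong) (auto split: split_indicator)
  also have "\<dots> = ennreal (\<bar>1/2\<bar> ^ card {1..n}) * (\<integral>\<^sup>+y. indicator {y. ?N y \<le> 1/4} (\<lambda>i\<in>{1..n}. 0 + 1/2 * y i) \<partial>?L)"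
    by (rule nn_integral_PiM_affine) auto
  also have "(\<lambda>y. indicator {y. ?N y \<le> 1/4} (\<lambda>i\<in>{1..n}. 0 + 1/2 * y i) :: ennreal) = (\<lambda>y. 1 * indicator {y. ?N y \<le> 1} y)"
    by (auto simp: fun_eq_iff power_divide sum_divide_distrib[symmetric] split: split_indicator)
  also have "(\<integral>\<^sup>+y. 1 * indicator {y. ?N y \<le> 1} y \<partial>?L) = ennreal b * ?E (\<lambda>y. 1)"
    by (rule b) simp
  also have "?E (\<lambda>y. 1) = 1"
    by (simp add: e.emeasure_space_1[simplified] g.emeasure_space_1[simplified])
  also have "ennreal (\<bar>1/2\<bar> ^ card {1..n}) * (ennreal b * 1) \<le> ennreal b * ennreal (1/2)"
  proof -
    have "(1/2::real) ^ n \<le> (1/2) ^ 1" using n by (intro power_decreasing) auto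
    then have "ennreal (\<bar>1/2\<bar> ^ card {1..n}) \<le> ennreal (1/2)" by (intro ennreal_leI) simp
    then show ?thesis by (simp add: mult.commute mult_left_mono)
  qed
  finally have "ennreal b * ?E ?in \<le> ennreal b * ennreal (1/2)" .
  then have small: "?E ?in \<le> ennreal (1/2)"
    using \<open>0 < b\<close> by (subst (asm) ennreal_mult_le_mult_iff) auto
  have "1 = ?E (\<lambda>y. indicator {y. ?N y \<le> 1/4} y + indicator {y. 1/4 < ?N y} y)"
  proof -
    have "indicator {y. ?N y \<le> 1/4} y + indicator {y. 1/4 < ?N y} y = (1 :: ennreal)" for y
      by (auto split: split_indicator)
    then show ?thesis
      by (simp only: nn_integral_const e.emeasure_space_1 g.emeasure_space_1 mult_1)
  qed
  also have "\<dots> = ?E ?in + ?E ?out"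
  proof -
    have [measurable]: "(\<lambda>p. indicator {y. P (?N y)} (direction n (u p) (v p)) :: ennreal) \<in> borel_measurable M"
      if [measurable]: "u \<in> measurable M ?L" "v \<in> borel_measurable M" "Measurable.pred borel P" for P u v and M :: "'z measure"
      by (rule measurable_compose[of "\<lambda>p. direction n (u p) (v p)"]) measurable
    have "?E (\<lambda>y. indicator {y. ?N y \<le> 1/4} y + indicator {y. 1/4 < ?N y} y)
        = (\<integral>\<^sup>+z. (\<integral>\<^sup>+\<rho>. indicator {y. ?N y \<le> 1/4} (direction n z \<rho>) \<partial>expo) + (\<integral>\<^sup>+\<rho>. indicator {y. 1/4 < ?N y} (direction n z \<rho>) \<partial>expo) \<partial>PiM {1..n} (\<lambda>_. gauss))"
      by (intro nn_integral_cong nn_integral_add) (simp_all only: space, measurable)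
    also have "\<dots> = ?E ?in + ?E ?out"
      by (rule nn_integral_add) measurable
    finally show ?thesis .
  qed
  finally have one: "1 \<le> ennreal (1/2) + ?E ?out"
    using small by (metis add_right_mono)
  have "ennreal (1/2) \<le> ?E ?out"
  proof -
    have "ennreal (1/2) + ennreal (1/2) = 1" by (subst ennreal_plus[symmetric]) auto
    then have "ennreal (1/2) + ennreal (1/2) \<le> ennreal (1/2) + ?E ?out" using one by simp
    then show ?thesis by (subst (asm) ennreal_add_left_cancel_le) auto
  qed
  then have "ennreal (1/4) * ennreal (1/2) \<le> ennreal (1/4) * ?E ?out"
    by (rule mult_left_mono) simp
  also have "\<dots> \<le> ?E (\<lambda>y. ennreal (?N y))"
  proof -
    have [measurable]: "(\<lambda>p. indicator {y. 1/4 < ?N y} (direction n (u p) (v p)) :: ennreal) \<in> borel_measurable M"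
      if [measurable]: "u \<in> measurable M ?L" "v \<in> borel_measurable M" for u v and M :: "'z measure"
      by (rule measurable_compose[of "\<lambda>p. direction n (u p) (v p)"]) measurable
    have "ennreal (1/4) * ?E ?out
        = (\<integral>\<^sup>+z. ennreal (1/4) * (\<integral>\<^sup>+\<rho>. indicator {y. 1/4 < ?N y} (direction n z \<rho>) \<partial>expo) \<partial>PiM {1..n} (\<lambda>_. gauss))"
      by (rule nn_integral_cmult[symmetric]) measurable
    also have "\<dots> = (\<integral>\<^sup>+z. \<integral>\<^sup>+\<rho>. ennreal (1/4) * indicator {y. 1/4 < ?N y} (direction n z \<rho>) \<partial>expo \<partial>PiM {1..n} (\<lambda>_. gauss))"
      by (intro nn_integral_cong nn_integral_cmult[symmetric]) (simp only: space, measurable)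
    also have "\<dots> \<le> ?E (\<lambda>y. ennreal (?N y))"
      by (intro nn_integral_mono) (auto split: split_indicator intro!: ennreal_leI)
    finally show ?thesis .
  qed
  also have "ennreal (1/4) * ennreal (1/2) = ennreal (1/8)"
    by (subst ennreal_mult[symmetric]) auto
  finally show ?thesis by (simp only: ball_avg_def)
qed

lemma emeasure_sq_norm_le_0:
  assumes "1 \<le> n"
  shows "(\<integral>\<^sup>+x. indicator {x. sq_norm {1..n} x \<le> 0} x \<partial>lebesgue_PiM {1..n}) = 0"
proof -
  have "(\<integral>\<^sup>+x. indicator {x. sq_norm {1..n} x \<le> 0} x \<partial>lebesgue_PiM {1..n}) = (\<integral>\<^sup>+x. indicator (Pi\<^sub>E {1..n} (\<lambda>_. {0})) x \<partial>lebesgue_PiM {1..n})"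
  proof (rule nn_integral_cong)
    fix x assume x: "x \<in> space (lebesgue_PiM {1..n})"
    have "sq_norm {1..n} x \<le> 0 \<longleftrightarrow> sq_norm {1..n} x = 0" using sum_nonneg[of "{1..n}" "\<lambda>i. (x i)\<^sup>2"] by auto
    also have "\<dots> \<longleftrightarrow> (\<forall>i\<in>{1..n}. x i = 0)"
      by (subst sum_nonneg_eq_0_iff) auto
    also have "\<dots> \<longleftrightarrow> x \<in> Pi\<^sub>E {1..n} (\<lambda>_. {0})"
      using x by (simp only: PiE_iff singleton_iff) (auto simp: space_PiM PiE_def)
    finally show "indicator {x. sq_norm {1..n} x \<le> 0} x = (indicator (Pi\<^sub>E {1..n} (\<lambda>_. {0})) x :: ennreal)"
      by (simp add: indicator_def)
  qed
  also have "\<dots> = emeasure (lebesgue_PiM {1..n}) (Pi\<^sub>E {1..n} (\<lambda>_. {0}))"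
    by (intro nn_integral_indicator sets_PiM_I_finite) auto
  also have "\<dots> = (\<Prod>i\<in>{1..n}. emeasure lborel {0::real})"
    by (rule lborel_PiM.emeasure_PiM) auto
  also have "\<dots> = 0" using assms by simp
  finally show ?thesis .
qed

text \<open>Rotate to the adapted basis, integrate over the sections and scale each of them to the unit ball.  The profile
  is replaced by zero outside the interior of its interval, which changes it at two points at most; sections of
  radius zero are null sets.\<close>

lemma nn_integral_body_of_revolution:
  assumes n: "1 \<le> n" and e: "orthonormal_basis (Suc n) e"
    and K: "K = {z \<in> Rn (Suc n). scalar_product (Suc n) z (e 0) \<in> I \<and>
      L2_set (\<lambda>j. scalar_product (Suc n) z (e j)) {1..n} \<le> R0 (scalar_product (Suc n) z (e 0))}"
    and K_sets[measurable]: "K \<in> sets (lebesgue_PiM {..<Suc n})"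
    and I: "is_interval I" and R0: "\<And>t. t \<in> I \<Longrightarrow> 0 \<le> R0 t"
    and R: "R = (\<lambda>t. if t \<in> interior I then R0 t else 0)" and R_meas[measurable]: "R \<in> borel_measurable borel"
    and \<phi>[measurable]: "\<phi> \<in> borel_measurable (lebesgue_PiM {..<Suc n})"
  shows "(\<integral>\<^sup>+z. \<phi> z * indicator K z \<partial>lebesgue_PiM {..<Suc n})
    = (\<integral>\<^sup>+t. ennreal (R t ^ n) * (\<integral>\<^sup>+y. \<phi> (from_coords (Suc n) e (\<lambda>k\<in>{..<Suc n}. if k = 0 then t else R t * y k))
        * indicator {y. sq_norm {1..n} y \<le> 1} y \<partial>lebesgue_PiM {1..n}) \<partial>lborel)"
proof -
  let ?p = "\<lambda>t y. \<lambda>k\<in>{..<Suc n}. if k = 0 then t else R t * y k"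
  let ?s = "\<lambda>t y. \<lambda>i\<in>{1..n}. 0 + R t * y i"
  let ?Q = "from_coords (Suc n) e" and ?N = "sq_norm {1..n}" and ?L = "lebesgue_PiM {1..n}"
  have set_eq: "{..<Suc n} = insert 0 {1..n}" by auto
  have R_nonneg: "0 \<le> R t" for t using R0 interior_subset[of I] by (auto simp: R)
  have AE_I: "AE t in lborel. t \<in> I \<longleftrightarrow> t \<in> interior I"
  proof -
    have "convex I" using I by (simp add: is_interval_convex_1)
    then have "negligible (frontier I)" by (rule negligible_convex_frontier)
    moreover have "{t. \<not> (t \<in> I \<longleftrightarrow> t \<in> interior I)} \<subseteq> frontier I"
      using interior_subset[of I] closure_subset[of I] by (auto simp: frontier_def)
    ultimately have "{t. \<not> (t \<in> I \<longleftrightarrow> t \<in> interior I)} \<in> null_sets lebesgue"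
      using negligible_subset by (auto simp: negligible_iff_null_sets)
    then have "AE t in lebesgue. t \<in> I \<longleftrightarrow> t \<in> interior I"
      by (rule AE_I') auto
    then show ?thesis by (simp add: AE_completion_iff)
  qed
  have in_K: "?Q c \<in> K \<longleftrightarrow> c 0 \<in> I \<and> ?N c \<le> (R0 (c 0))\<^sup>2" for c
  proof -
    have "scalar_product (Suc n) (?Q c) (e 0) = c 0"
      by (rule scalar_product_from_coords[OF e]) simp
    moreover have "L2_set (\<lambda>j. scalar_product (Suc n) (?Q c) (e j)) {1..n} = sqrt (?N c)"
      unfolding L2_set_def by (intro arg_cong[where f = sqrt] sum.cong refl) (simp add: scalar_product_from_coords[OF e])
    moreover have "sqrt (?N c) \<le> R0 (c 0) \<longleftrightarrow> ?N c \<le> (R0 (c 0))\<^sup>2" if "c 0 \<in> I"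
      using R0[OF that] by (metis real_sqrt_le_iff real_sqrt_unique)
    ultimately show ?thesis
      unfolding K using from_coords_in_Rn by auto
  qed
  have Q_upd[measurable]: "(\<lambda>p. ?Q ((u p)(0 := v p))) \<in> measurable M (lebesgue_PiM {..<Suc n})"
    if "u \<in> measurable M ?L" "v \<in> borel_measurable M" for u v and M :: "'z measure"
  proof (rule measurable_compose[OF _ borel_measurable_from_coords])
    show "(\<lambda>p. (u p)(0 := v p)) \<in> measurable M (lebesgue_PiM {..<Suc n})"
      by (rule measurable_fun_upd[where J = "{1..n}"]) (use that set_eq in auto)
  qed
  have ind_meas[measurable]: "(\<lambda>x. indicator {x. ?N x \<le> r} x :: ennreal) \<in> borel_measurable ?L" for r
  proof -
    have "(\<lambda>x. indicator {x. ?N x \<le> r} x :: ennreal) = (\<lambda>x. if ?N x \<le> r then 1 else 0)" by (auto simp: indicator_def)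
    also have "\<dots> \<in> borel_measurable ?L" by measurable
    finally show ?thesis .
  qed
  have "(\<integral>\<^sup>+z. \<phi> z * indicator K z \<partial>lebesgue_PiM {..<Suc n}) = (\<integral>\<^sup>+c. \<phi> (?Q c) * indicator K (?Q c) \<partial>lebesgue_PiM {..<Suc n})"
    by (rule nn_integral_rotation[OF e, symmetric]) measurable
  also have "\<dots> = (\<integral>\<^sup>+t. \<integral>\<^sup>+x. \<phi> (?Q (x(0 := t))) * indicator K (?Q (x(0 := t))) \<partial>?L \<partial>lborel)"
    unfolding set_eq by (rule lborel_PiM.product_nn_integral_insert_rev) (auto simp: set_eq[symmetric])
  also have "\<dots> = (\<integral>\<^sup>+t. ennreal (R t ^ n) * (\<integral>\<^sup>+y. \<phi> (?Q (?p t y)) * indicator {y. ?N y \<le> 1} y \<partial>?L) \<partial>lborel)"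
  proof (rule nn_integral_cong_AE, use AE_I in eventually_elim)
    fix t assume t: "t \<in> I \<longleftrightarrow> t \<in> interior I"
    have ind: "indicator K (?Q (x(0 := t))) = (if t \<in> interior I then indicator {x. ?N x \<le> (R t)\<^sup>2} x else 0 :: ennreal)" for x
    proof -
      have "?N (x(0 := t)) = ?N x" by (intro sum.cong) auto
      then show ?thesis using t by (auto simp: in_K R indicator_def)
    qed
    show "(\<integral>\<^sup>+x. \<phi> (?Q (x(0 := t))) * indicator K (?Q (x(0 := t))) \<partial>?L)
      = ennreal (R t ^ n) * (\<integral>\<^sup>+y. \<phi> (?Q (?p t y)) * indicator {y. ?N y \<le> 1} y \<partial>?L)"
    proof (cases "t \<in> interior I \<and> 0 < R t")
      case True
      have "(\<integral>\<^sup>+x. \<phi> (?Q (x(0 := t))) * indicator K (?Q (x(0 := t))) \<partial>?L)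
          = (\<integral>\<^sup>+x. \<phi> (?Q (x(0 := t))) * indicator {x. ?N x \<le> (R t)\<^sup>2} x \<partial>?L)"
        using True by (simp add: ind)
      also have "\<dots> = ennreal (\<bar>R t\<bar> ^ card {1..n}) * (\<integral>\<^sup>+y. \<phi> (?Q ((?s t y)(0 := t))) * indicator {x. ?N x \<le> (R t)\<^sup>2} (?s t y) \<partial>?L)"
      proof (rule nn_integral_PiM_affine)
        show "(\<lambda>x. \<phi> (?Q (x(0 := t))) * indicator {x. ?N x \<le> (R t)\<^sup>2} x) \<in> borel_measurable ?L"
          by measurable
      qed (use True in auto)
      also have "(\<integral>\<^sup>+y. \<phi> (?Q ((?s t y)(0 := t))) * indicator {x. ?N x \<le> (R t)\<^sup>2} (?s t y) \<partial>?L)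
          = (\<integral>\<^sup>+y. \<phi> (?Q (?p t y)) * indicator {y. ?N y \<le> 1} y \<partial>?L)"
      proof (rule nn_integral_cong)
        fix y
        have "(?s t y)(0 := t) = ?p t y"
          by (auto simp: fun_eq_iff)
        moreover have "?N (?s t y) = (R t)\<^sup>2 * ?N y"
          by (simp add: power_mult_distrib sum_distrib_left)
        then have "?N (?s t y) \<le> (R t)\<^sup>2 \<longleftrightarrow> ?N y \<le> 1"
          using True by (simp add: mult_le_cancel_left1)
        ultimately show "\<phi> (?Q ((?s t y)(0 := t))) * indicator {x. ?N x \<le> (R t)\<^sup>2} (?s t y)
            = \<phi> (?Q (?p t y)) * indicator {y. ?N y \<le> 1} y"
          by (simp add: indicator_def)
      qed
      also have "ennreal (\<bar>R t\<bar> ^ card {1..n}) * \<dots> = ennreal (R t ^ n) * \<dots>"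
        using True by simp
      finally show ?thesis .
    next
      case False
      then have R_0: "R t = 0" using R_nonneg[of t] by (auto simp: R)
      have "(\<integral>\<^sup>+x. \<phi> (?Q (x(0 := t))) * indicator K (?Q (x(0 := t))) \<partial>?L) = (\<integral>\<^sup>+x. 0 \<partial>?L)"
      proof (rule nn_integral_cong_AE)
        have "AE x in ?L. indicator {x. ?N x \<le> 0} x = (0 :: ennreal)"
          using emeasure_sq_norm_le_0[OF n] by (subst (asm) nn_integral_0_iff_AE) auto
        then show "AE x in ?L. \<phi> (?Q (x(0 := t))) * indicator K (?Q (x(0 := t))) = 0"
          by eventually_elim (simp add: ind R_0)
      qed
      then show ?thesis using R_0 n by (simp add: zero_power)
    qed
  qed
  finally show ?thesis .
qed

text \<open>Dividing by a mass of \<open>0\<close> or \<open>\<infinity>\<close> yields the zero measure.\<close>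

lemma integral_degenerate_uniform_measure:
  fixes g :: "'a \<Rightarrow> real"
  assumes "K \<in> sets M" "emeasure M K = 0 \<or> emeasure M K = \<infinity>"
  shows "(LINT x|uniform_measure M K. g x) = 0"
proof -
  have "emeasure (uniform_measure M K) (space M) = emeasure M (K \<inter> space M) / emeasure M K"
    using assms(1) by (intro emeasure_uniform_measure) auto
  also have "\<dots> = 0"
    using assms sets.Int_space_eq2[OF assms(1)] by auto
  finally have "space (uniform_measure M K) \<in> null_sets (uniform_measure M K)"
    by (auto simp: null_sets_def)
  then have "AE x in uniform_measure M K. g x = 0"
    by (rule AE_I') auto
  then show ?thesis by (rule integral_eq_zero_AE)
qed

section \<open>Isotropic convex bodies of revolution\<close>

lemma continuous_map_coordinate:
  "i \<in> I \<Longrightarrow> continuous_map (powertop_real I) euclideanreal (\<lambda>x. x i)"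
  by (rule continuous_map_product_projection)

lemma continuous_map_scalar_product:
  "continuous_map (powertop_real {..<m}) euclideanreal (\<lambda>x. scalar_product m x y)"
  unfolding scalar_product_def
  by (intro continuous_map_sum continuous_map_real_mult continuous_map_coordinate continuous_map_const[THEN iffD2]) auto

lemma orthonormal_basis_unit:
  assumes "orthonormal_basis m e" "j < m"
  shows "e j \<in> Rn m" "L2_set (e j) {..<m} = 1"
  using assms by (auto simp: orthonormal_basis_def L2_set_def scalar_product_def power2_eq_square)

lemma sum_squares_scalar_products:
  assumes "orthonormal_basis m e" "y \<in> Rn m"
  shows "(\<Sum>j<m. (scalar_product m y (e j))\<^sup>2) = (\<Sum>i<m. (y i)\<^sup>2)"
  using sum_squares_from_coords[OF assms(1), of "\<lambda>j. scalar_product m y (e j)"]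
  by (simp add: from_coords_scalar_product[OF assms])

text \<open>Continuous functions are bounded on the compact set \<open>K\<close>, hence bounded almost surely and integrable for its
  uniform law.\<close>

locale uniform_on_body =
  fixes m :: nat and K :: "(nat \<Rightarrow> real) set"
  assumes compact_K: "compactin (powertop_real {..<m}) K"
    and mass: "0 < emeasure (lebesgue_Rn m) K" "emeasure (lebesgue_Rn m) K < \<infinity>"
begin

abbreviation \<mu> :: "(nat \<Rightarrow> real) measure" where "\<mu> \<equiv> uniform_prob m K"

lemma K_sets[measurable]: "K \<in> sets (lebesgue_PiM {..<m})"
  by (rule compactin_sets_PiM[OF compact_K])

lemma sets_\<mu>[measurable_cong]: "sets \<mu> = sets (lebesgue_PiM {..<m})"
  by (simp add: uniform_prob_def lebesgue_Rn_def)

lemma nn_integral_\<mu>: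
  assumes "\<phi> \<in> borel_measurable (lebesgue_PiM {..<m})"
  shows "(\<integral>\<^sup>+x. \<phi> x \<partial>\<mu>) = (\<integral>\<^sup>+x. \<phi> x * indicator K x \<partial>lebesgue_PiM {..<m}) / emeasure (lebesgue_PiM {..<m}) K"
  unfolding uniform_prob_def lebesgue_Rn_def using assms K_sets by (rule nn_integral_uniform_measure)

sublocale \<mu>: prob_space \<mu>
  using mass unfolding uniform_prob_def by (intro prob_space_uniform_measure) auto

lemma AE_\<mu>_K: "AE x in \<mu>. x \<in> K"
  unfolding uniform_prob_def using mass K_sets by (intro AE_uniform_measureI) (auto simp: lebesgue_Rn_def)

lemma continuous_map_AE_bounded:
  assumes "continuous_map (powertop_real {..<m}) euclideanreal g"
  obtains B where "AE x in \<mu>. \<bar>g x\<bar> \<le> B"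
proof -
  obtain B where "\<And>x. x \<in> K \<Longrightarrow> \<bar>g x\<bar> \<le> B" using bounded_on_compactin[OF compact_K assms] by blast
  then have "AE x in \<mu>. \<bar>g x\<bar> \<le> B" using AE_\<mu>_K by (auto elim: eventually_mono)
  then show ?thesis using that by blast
qed

lemma continuous_map_measurable:
  assumes "continuous_map (powertop_real {..<m}) euclideanreal g"
  shows "g \<in> borel_measurable \<mu>"
  using borel_measurable_continuous_map_PiM[OF assms] measurable_cong_sets[OF sets_\<mu> refl] by blast

lemma continuous_map_integrable:
  assumes "continuous_map (powertop_real {..<m}) euclideanreal g"
  shows "integrable \<mu> g"
proof -
  obtain B where "AE x in \<mu>. \<bar>g x\<bar> \<le> B" using continuous_map_AE_bounded[OF assms] by blast
  then show ?thesis
    by (intro \<mu>.integrable_const_bound[of _ B] continuous_map_measurable assms) auto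
qed

lemma nn_integral_square:
  assumes "continuous_map (powertop_real {..<m}) euclideanreal g"
  shows "(\<integral>\<^sup>+x. ennreal ((g x)\<^sup>2) \<partial>\<mu>) = ennreal (LINT x|\<mu>. (g x)\<^sup>2)"
proof (rule nn_integral_eq_integral)
  have "continuous_map (powertop_real {..<m}) euclideanreal (\<lambda>x. (g x)\<^sup>2)"
    unfolding power2_eq_square by (intro continuous_map_real_mult assms)
  then show "integrable \<mu> (\<lambda>x. (g x)\<^sup>2)" by (rule continuous_map_integrable)
qed simp

lemma trace_covariance:
  assumes c: "\<And>\<theta>. \<theta> \<in> Rn m \<Longrightarrow> L2_set \<theta> {..<m} = 1 \<Longrightarrow> (LINT x|\<mu>. (scalar_product m x \<theta>)\<^sup>2) = c"
  shows "(LINT x|\<mu>. (L2_set x {..<m})\<^sup>2) = real m * c"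
proof -
  have coord: "(LINT x|\<mu>. (x i)\<^sup>2) = c" if "i < m" for i
  proof -
    define \<delta> where "\<delta> = (\<lambda>j\<in>{..<m}. if j = i then 1 else 0 :: real)"
    have "\<delta> \<in> Rn m" by (auto simp: \<delta>_def Rn_def)
    moreover have "L2_set \<delta> {..<m} = 1"
    proof -
      have "(\<Sum>j<m. (\<delta> j)\<^sup>2) = (\<Sum>j<m. if j = i then 1 else 0)"
        by (intro sum.cong) (auto simp: \<delta>_def)
      then show ?thesis using that by (simp add: L2_set_def)
    qed
    moreover have "scalar_product m x \<delta> = x i" for x
    proof -
      have "scalar_product m x \<delta> = (\<Sum>j<m. if j = i then x j else 0)"
        unfolding scalar_product_def by (intro sum.cong) (auto simp: \<delta>_def)
      then show ?thesis using that by simp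
    qed
    ultimately show ?thesis using c[of \<delta>] by simp
  qed
  have "(LINT x|\<mu>. (L2_set x {..<m})\<^sup>2) = (LINT x|\<mu>. (\<Sum>i<m. (x i)\<^sup>2))"
    by (simp add: L2_set_def sum_nonneg)
  also have "\<dots> = (\<Sum>i<m. LINT x|\<mu>. (x i)\<^sup>2)"
  proof (rule Bochner_Integration.integral_sum)
    fix i assume "i \<in> {..<m}"
    then show "integrable \<mu> (\<lambda>x. (x i)\<^sup>2)"
      unfolding power2_eq_square by (intro continuous_map_integrable continuous_map_real_mult continuous_map_coordinate)
  qed
  also have "\<dots> = real m * c" by (simp add: coord)
  finally show ?thesis .
qed

end

text \<open>Here \<open>c\<close> is the common second moment of all directions.  It gives \<open>\<sigma>\<^sup>2 = c\<close> along the axis and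
  \<open>R\<^sup>2 \<le> 12 \<cdot> 8 \<cdot> n c = 96 n c\<close> across it.  As \<open>n \<le> (n + 1)\<^sup>2\<close>, the constant of \<open>revolution_osc\<close> is then at
  most \<open>16 \<cdot> 64 + 16 \<cdot> 96 + 200 \<cdot> 96 = 21760\<close> times \<open>c\<close>.\<close>

lemma revolution_variance_bound:
  assumes n: "1 \<le> n" and body: "convex_body_of_revolution n K"
    and mass: "0 < emeasure (lebesgue_Rn (Suc n)) K" "emeasure (lebesgue_Rn (Suc n)) K < \<infinity>"
    and c: "\<And>\<theta>. \<theta> \<in> Rn (Suc n) \<Longrightarrow> L2_set \<theta> {..<Suc n} = 1 \<Longrightarrow> (LINT x|uniform_prob (Suc n) K. (scalar_product (Suc n) x \<theta>)\<^sup>2) = c"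
    and f: "smooth (Suc n) f"
  shows "Var (uniform_prob (Suc n) K) f \<le> 21760 * c * (LINT x|uniform_prob (Suc n) K. (L2_set (grad (Suc n) f x) {..<Suc n})\<^sup>2)"
proof -
  obtain e I R0 where compact_K: "compactin (powertop_real {..<Suc n}) K"
    and e: "orthonormal_basis (Suc n) e" and I: "is_interval I" and R0: "\<And>t. t \<in> I \<Longrightarrow> 0 \<le> R0 t"
    and conc: "concave_on I R0"
    and K: "K = {z \<in> Rn (Suc n). scalar_product (Suc n) z (e 0) \<in> I \<and>
      L2_set (\<lambda>j. scalar_product (Suc n) z (e j)) {1..n} \<le> R0 (scalar_product (Suc n) z (e 0))}"
    using body unfolding convex_body_of_revolution_def convex_body_def Suc_eq_plus1[symmetric] by blast
  interpret uniform_on_body "Suc n" K by unfold_locales (use compact_K mass in auto)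
  let ?Q = "from_coords (Suc n) e" and ?N = "sq_norm {1..n}" and ?L = "lebesgue_PiM {..<Suc n}"
  let ?P = "\<lambda>i. partial_deriv i f"
  note f_cont = smooth_partial_derivatives(1)[OF f] and P_cont = smooth_partial_derivatives(2)[OF f]
    and f_partial = smooth_partial_derivatives(3)[OF f]
  define S where "S = interior I"
  define R where "R t = (if t \<in> S then R0 t else 0)" for t
  have S: "open S" "is_interval S" "S \<subseteq> I"
    using I by (auto simp: S_def is_interval_convex_1 interior_subset)
  have conc_S: "concave_on S R"
  proof -
    have "concave_on S R0"
      using conc S convex_on_subset[of I "\<lambda>x. - R0 x" S] by (simp add: concave_on_def is_interval_convex_1)
    then show ?thesis by (auto simp: concave_on_iff R_def is_interval_convex_1 convex_def)
  qed
  have R_nonneg: "0 \<le> R t" for t using R0 S by (auto simp: R_def)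
  have R_meas[measurable]: "R \<in> borel_measurable borel"
  proof -
    have "continuous_on S R"
      using convex_on_continuous[OF S(1), of "\<lambda>x. - R x"] conc_S by (auto simp: concave_on_def dest: continuous_on_minus)
    then have "(\<lambda>x. indicator S x *\<^sub>R R x) \<in> borel_measurable borel"
      using S(1) by (intro borel_measurable_continuous_on_indicator) auto
    moreover have "(\<lambda>x. indicator S x *\<^sub>R R x) = R" by (auto simp: R_def split: split_indicator)
    ultimately show ?thesis by simp
  qed
  obtain b :: real where "0 < b" and ball: "\<And>\<phi>. \<phi> \<in> borel_measurable (lebesgue_PiM {1..n}) \<Longrightarrow>
      (\<integral>\<^sup>+y. \<phi> y * indicator {y. ?N y \<le> 1} y \<partial>lebesgue_PiM {1..n})
      = ennreal b * ball_avg n \<phi>"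
    using ball_law[OF n] by blast
  define pt where "pt t y = (\<lambda>k\<in>{..<Suc n}. if k = 0 then t else R t * y k)" for t and y :: "nat \<Rightarrow> real"
  interpret g: prob_space "PiM {1..n::nat} (\<lambda>_. gauss)" by (intro prob_space_PiM prob_space_gauss)
  interpret ex: prob_space expo by (rule prob_space_expo)
  have avg_const: "ball_avg n (\<lambda>_. a) = a" for a
    by (simp add: ball_avg_def ex.emeasure_space_1[simplified] g.emeasure_space_1[simplified])
  have pt_meas[measurable]: "(\<lambda>p. pt (u p) (v p)) \<in> measurable M ?L"
    if [measurable]: "u \<in> borel_measurable M" and v: "v \<in> measurable M (lebesgue_PiM {1..n})" for u v and M :: "'z measure"
    unfolding pt_def
  proof (rule measurable_restrict)
    fix k assume "k \<in> {..<Suc n}"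
    then show "(\<lambda>p. if k = 0 then u p else R (u p) * v p k) \<in> measurable M lborel"
    proof (cases "k = 0")
      case False
      then have "k \<in> {1..n}" using \<open>k \<in> _\<close> by auto
      then have [measurable]: "(\<lambda>p. v p k) \<in> borel_measurable M"
        using measurable_compose[OF v measurable_component_singleton[of k "{1..n}"]] by auto
      then show ?thesis using False by simp
    qed simp
  qed
  have fibration: "(\<integral>\<^sup>+z. \<phi> z * indicator K z \<partial>?L) = (\<integral>\<^sup>+t. ennreal (R t ^ n) * (ennreal b * ball_avg n (\<lambda>y. \<phi> (?Q (pt t y)))) \<partial>lborel)"
    if [measurable]: "\<phi> \<in> borel_measurable ?L" for \<phi>
  proof -
    have "(\<integral>\<^sup>+z. \<phi> z * indicator K z \<partial>?L)
        = (\<integral>\<^sup>+t. ennreal (R t ^ n) * (\<integral>\<^sup>+y. \<phi> (?Q (pt t y)) * indicator {y. ?N y \<le> 1} y \<partial>lebesgue_PiM {1..n}) \<partial>lborel)"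
      unfolding pt_def using n e K K_sets I R0 _ R_meas that
      by (rule nn_integral_body_of_revolution) (auto simp: R_def S_def)
    also have "\<dots> = (\<integral>\<^sup>+t. ennreal (R t ^ n) * (ennreal b * ball_avg n (\<lambda>y. \<phi> (?Q (pt t y)))) \<partial>lborel)"
      by (intro nn_integral_cong arg_cong2[where f = "(*)"] refl ball) measurable
    finally show ?thesis .
  qed
  have volume: "emeasure ?L K = (\<integral>\<^sup>+t. ennreal (R t ^ n) \<partial>lborel) * ennreal b"
    using fibration[of "\<lambda>_. 1"] by (simp add: avg_const nn_integral_multc)
  have mass': "0 < emeasure ?L K" "emeasure ?L K < \<infinity>" using mass by (auto simp: lebesgue_Rn_def)
  have mass_pos: "0 < (\<integral>\<^sup>+t. ennreal (R t ^ n) \<partial>lborel)" and mass_finite: "(\<integral>\<^sup>+t. ennreal (R t ^ n) \<partial>lborel) < \<infinity>"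
    using mass' \<open>0 < b\<close> unfolding volume by (auto simp: zero_less_iff_neq_zero ennreal_mult_less_top ennreal_mult_eq_top_iff less_top)
  \<comment> \<open>A nonnegative concave function that vanishes in the interior vanishes identically.\<close>
  have R_pos: "0 < R t0" if "t0 \<in> S" for t0
  proof (rule ccontr)
    assume "\<not> 0 < R t0"
    then have "R t0 = 0" using R_nonneg[of t0] by simp
    obtain d where "0 < d" and d: "cball t0 d \<subseteq> S" using S(1) \<open>t0 \<in> S\<close> unfolding open_contains_cball by blast
    then have "t0 + d \<in> cball t0 d" "t0 - d \<in> cball t0 d" by (simp_all add: dist_real_def)
    then have near: "t0 + d \<in> S" "t0 - d \<in> S" using d by blast+
    have super: "R t \<le> right_slope S R t0 * (t - t0)" if "t \<in> S" for t
      using right_slope_supergradient[OF S(1) conc_S \<open>t0 \<in> S\<close> that] \<open>R t0 = 0\<close> by simp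
    have "right_slope S R t0 = 0"
    proof -
      have "0 \<le> right_slope S R t0 * d" using super[OF near(1)] R_nonneg[of "t0 + d"] by simp
      moreover have "right_slope S R t0 * d \<le> 0" using super[OF near(2)] R_nonneg[of "t0 - d"] by simp
      ultimately have "right_slope S R t0 * d = 0" by (rule antisym[rotated])
      then show ?thesis using \<open>0 < d\<close> by simp
    qed
    then have "R t = 0" for t
      using super[of t] R_nonneg[of t] by (cases "t \<in> S") (auto simp: R_def)
    then show False using mass_pos n by (simp add: zero_power)
  qed
  interpret concave_profile S R n
    by unfold_locales (use S conc_S R_pos n mass_pos mass_finite in \<open>auto simp: R_def\<close>)
  have law: "(\<integral>\<^sup>+x. \<phi> x \<partial>\<mu>) = (\<integral>\<^sup>+t. ball_avg n (\<lambda>y. \<phi> (?Q (pt t y))) \<partial>\<nu>)"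
    if [measurable]: "\<phi> \<in> borel_measurable ?L" for \<phi>
  proof -
    have [measurable]: "(\<lambda>t. ball_avg n (\<lambda>y. \<phi> (?Q (pt t y)))) \<in> borel_measurable borel"
      unfolding ball_avg_def by measurable
    have vol: "emeasure ?L K = ennreal (Z * b)"
      using Z_pos \<open>0 < b\<close> by (simp add: volume nn_integral_R_power ennreal_mult)
    have "(\<integral>\<^sup>+z. \<phi> z * indicator K z \<partial>?L) = (\<integral>\<^sup>+t. ennreal (Z * b) * (ennreal (h t) * ball_avg n (\<lambda>y. \<phi> (?Q (pt t y)))) \<partial>lborel)"
      unfolding fibration[OF that]
      using Z_pos \<open>0 < b\<close> by (intro nn_integral_cong) (simp add: ennreal_R_power ennreal_mult mult_ac)
    also have "\<dots> = ennreal (Z * b) * (\<integral>\<^sup>+t. ennreal (h t) * ball_avg n (\<lambda>y. \<phi> (?Q (pt t y))) \<partial>lborel)"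
      by (rule nn_integral_cmult) measurable
    also have "(\<integral>\<^sup>+t. ennreal (h t) * ball_avg n (\<lambda>y. \<phi> (?Q (pt t y))) \<partial>lborel) = (\<integral>\<^sup>+t. ball_avg n (\<lambda>y. \<phi> (?Q (pt t y))) \<partial>\<nu>)"
      by (rule nn_integral_\<nu>[symmetric]) measurable
    finally show ?thesis
      unfolding nn_integral_\<mu>[OF that] vol using Z_pos \<open>0 < b\<close>
      by (simp add: mult.commute[of "ennreal (Z * b)"] ennreal_mult_divide_eq)
  qed
  have pt_0: "pt t y 0 = t" and pt_j: "\<And>j. j \<in> {1..n} \<Longrightarrow> pt t y j = R t * y j" for t y
    by (auto simp: pt_def)
  have coords: "scalar_product (Suc n) (?Q (pt t y)) (e k) = pt t y k" if "k < Suc n" for t y k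
    by (rule scalar_product_from_coords[OF e that])
  have moment: "(\<integral>\<^sup>+x. ennreal ((scalar_product (Suc n) x (e k))\<^sup>2) \<partial>\<mu>) = ennreal c" if "k < Suc n" for k
    using nn_integral_square[OF continuous_map_scalar_product] c[OF orthonormal_basis_unit[OF e that]] by simp
  have scalar_meas[measurable]: "(\<lambda>x. scalar_product (Suc n) x y) \<in> borel_measurable ?L" for y
    by (rule borel_measurable_continuous_map_PiM[OF continuous_map_scalar_product])
  have axial_moment: "(\<integral>\<^sup>+t. ennreal (t\<^sup>2) \<partial>\<nu>) = ennreal c"
  proof -
    have "ennreal c = (\<integral>\<^sup>+t. ball_avg n (\<lambda>y. ennreal ((scalar_product (Suc n) (?Q (pt t y)) (e 0))\<^sup>2)) \<partial>\<nu>)"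
      unfolding moment[OF zero_less_Suc, symmetric] by (rule law) measurable
    also have "\<dots> = (\<integral>\<^sup>+t. ennreal (t\<^sup>2) \<partial>\<nu>)"
      unfolding coords[OF zero_less_Suc] by (simp add: pt_0 avg_const)
    finally show ?thesis ..
  qed
  have "0 \<le> c" using c[OF orthonormal_basis_unit[OF e zero_less_Suc], symmetric] by simp
  have radius_moment: "(\<integral>\<^sup>+t. ennreal ((R t)\<^sup>2) \<partial>\<nu>) * ennreal (1/8) \<le> ennreal (n * c)"
  proof -
    let ?c = "\<lambda>t y j. scalar_product (Suc n) (?Q (pt t y)) (e j)"
    have "(\<integral>\<^sup>+t. ennreal ((R t)\<^sup>2) \<partial>\<nu>) * ennreal (1/8) = (\<integral>\<^sup>+t. ennreal ((R t)\<^sup>2) * ennreal (1/8) \<partial>\<nu>)"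
      by (rule nn_integral_multc[symmetric]) measurable
    also have "\<dots> \<le> (\<integral>\<^sup>+t. ennreal ((R t)\<^sup>2) * ball_avg n (\<lambda>y. ennreal (?N y)) \<partial>\<nu>)"
      by (intro nn_integral_mono mult_left_mono direction_second_moment n) simp
    also have "\<dots> = (\<integral>\<^sup>+t. ball_avg n (\<lambda>y. ennreal (\<Sum>j\<in>{1..n}. (?c t y j)\<^sup>2)) \<partial>\<nu>)"
    proof (rule nn_integral_cong)
      fix t
      have "(\<Sum>j\<in>{1..n}. (?c t y j)\<^sup>2) = (R t)\<^sup>2 * ?N y" for y
      proof -
        have "(\<Sum>j\<in>{1..n}. (?c t y j)\<^sup>2) = (\<Sum>j\<in>{1..n}. (R t * y j)\<^sup>2)"
          by (intro sum.cong refl) (simp add: coords pt_j)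
        then show ?thesis by (simp add: power_mult_distrib sum_distrib_left)
      qed
      then have "ball_avg n (\<lambda>y. ennreal (\<Sum>j\<in>{1..n}. (?c t y j)\<^sup>2)) = ball_avg n (\<lambda>y. ennreal ((R t)\<^sup>2) * ennreal (?N y))"
        by (simp add: ennreal_mult sum_nonneg)
      also have "\<dots> = (\<integral>\<^sup>+z. ennreal ((R t)\<^sup>2) * (\<integral>\<^sup>+\<rho>. ennreal (?N (direction n z \<rho>)) \<partial>expo) \<partial>\<gamma>)"
        unfolding ball_avg_def by (intro nn_integral_cong nn_integral_cmult) (simp only: space_\<gamma>, measurable)
      also have "\<dots> = ennreal ((R t)\<^sup>2) * ball_avg n (\<lambda>y. ennreal (?N y))"
        unfolding ball_avg_def by (rule nn_integral_cmult) measurable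
      finally show "ennreal ((R t)\<^sup>2) * ball_avg n (\<lambda>y. ennreal (?N y)) = ball_avg n (\<lambda>y. ennreal (\<Sum>j\<in>{1..n}. (?c t y j)\<^sup>2))" ..
    qed
    also have "\<dots> = (\<integral>\<^sup>+x. ennreal (\<Sum>j\<in>{1..n}. (scalar_product (Suc n) x (e j))\<^sup>2) \<partial>\<mu>)"
      by (rule law[symmetric]) measurable
    also have "\<dots> = (\<integral>\<^sup>+x. (\<Sum>j\<in>{1..n}. ennreal ((scalar_product (Suc n) x (e j))\<^sup>2)) \<partial>\<mu>)"
      by (simp add: sum_ennreal)
    also have "\<dots> = (\<Sum>j\<in>{1..n}. \<integral>\<^sup>+x. ennreal ((scalar_product (Suc n) x (e j))\<^sup>2) \<partial>\<mu>)"
      by (rule nn_integral_sum) measurable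
    also have "\<dots> = (\<Sum>j\<in>{1..n}. ennreal c)"
      by (intro sum.cong refl moment) auto
    also have "\<dots> = ennreal (n * c)"
      using \<open>0 \<le> c\<close> by (simp add: ennreal_mult ennreal_of_nat_eq_real_of_nat)
    finally show ?thesis .
  qed
  have R_sq: "(R t)\<^sup>2 \<le> 96 * n * c" if "t \<in> S" for t
  proof -
    have "ennreal ((R t)\<^sup>2) \<le> 12 * (\<integral>\<^sup>+x. ennreal ((R x)\<^sup>2) \<partial>\<nu>)" by (rule radius_le_second_moment[OF that])
    also have "12 = ennreal (1/8) * 96"
    proof -
      have "ennreal (1/8) * ennreal 96 = ennreal (1/8 * 96)" by (rule ennreal_mult[symmetric]) auto
      then show ?thesis by simp
    qed
    also have "ennreal (1/8) * 96 * (\<integral>\<^sup>+x. ennreal ((R x)\<^sup>2) \<partial>\<nu>) = 96 * ((\<integral>\<^sup>+x. ennreal ((R x)\<^sup>2) \<partial>\<nu>) * ennreal (1/8))"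
      by (simp only: mult_ac)
    also have "\<dots> \<le> 96 * ennreal (n * c)" by (intro mult_left_mono radius_moment) simp
    also have "\<dots> = ennreal (96 * n * c)" using \<open>0 \<le> c\<close> by (simp add: ennreal_mult' mult.assoc)
    finally show ?thesis using \<open>0 \<le> c\<close> by (subst (asm) ennreal_le_iff) auto
  qed
  have "0 < c"
  proof -
    obtain t where "t \<in> S" using median_exists by blast
    then have "0 < 96 * n * c" using R_sq[of t] R_pos[of t] by (smt (verit) zero_less_power)
    then show ?thesis using n by (simp add: zero_less_mult_iff)
  qed
  obtain B where B: "\<And>x. x \<in> K \<Longrightarrow> \<bar>f x\<bar> \<le> B" using bounded_on_compactin[OF compact_K f_cont] by blast
  \<comment> \<open>The function \<open>f\<close> and its gradient in the coordinates of the basis \<open>e\<close>.\<close>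
  define G where "G x = f (?Q x)" for x
  define A where "A k x = (\<Sum>i<Suc n. ?P i (?Q x) * e k i)" for k x
  have Q_cont: "continuous_map (powertop_real {..<Suc n}) (powertop_real {..<Suc n}) ?Q"
    unfolding continuous_map_componentwise
  proof
    show "?Q ` topspace (powertop_real {..<Suc n}) \<subseteq> extensional {..<Suc n}" by (auto simp: from_coords_def)
    show "\<forall>i\<in>{..<Suc n}. continuous_map (powertop_real {..<Suc n}) euclideanreal (\<lambda>x. ?Q x i)"
      by (auto simp: from_coords_def simp del: sum.lessThan_Suc intro!: continuous_map_sum continuous_map_real_mult continuous_map_coordinate)
  qed
  interpret revolution_function S R n G A B "sqrt (96 * n * c)" "sqrt c"
  proof
    show "((\<lambda>s. G (x(k := s))) has_real_derivative A k x) (at (x k))" if "k < Suc n" "x \<in> Rn (Suc n)" for k x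
    proof -
      have "((\<lambda>s. f (\<lambda>i\<in>{..<Suc n}. \<Sum>j<Suc n. (x(k := s)) j * e j i)) has_real_derivative
          (\<Sum>i<Suc n. ?P i (\<lambda>i\<in>{..<Suc n}. \<Sum>j<Suc n. (x(k := x k)) j * e j i) * e k i)) (at (x k))"
      proof (rule C1_chain_rule[OF f_partial P_cont])
        fix i
        have "((\<lambda>s. \<Sum>j<Suc n. (x(k := s)) j * e j i) has_real_derivative (\<Sum>j<Suc n. if j = k then e j i else 0)) (at (x k))"
          by (intro DERIV_sum) (auto intro!: derivative_eq_intros)
        also have "(\<Sum>j<Suc n. if j = k then e j i else 0) = e k i" using that by (simp del: sum.lessThan_Suc)
        finally show "((\<lambda>s. \<Sum>j<Suc n. (x(k := s)) j * e j i) has_real_derivative e k i) (at (x k))" .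
      qed
      then show ?thesis unfolding G_def A_def from_coords_def by (simp only: fun_upd_triv)
    qed
    show "continuous_map (powertop_real {..<Suc n}) euclideanreal G"
      using continuous_map_compose[OF Q_cont f_cont] by (simp add: G_def[abs_def] o_def)
    show "continuous_map (powertop_real {..<Suc n}) euclideanreal (A k)" for k
    proof -
      have "continuous_map (powertop_real {..<Suc n}) euclideanreal (\<lambda>x. ?P i (?Q x))" if "i < Suc n" for i
        using continuous_map_compose[OF Q_cont P_cont[OF that]] by (simp add: o_def)
      then show ?thesis
        unfolding A_def[abs_def] by (intro continuous_map_sum continuous_map_real_mult continuous_map_const[THEN iffD2]) auto
    qed
    show "\<bar>G (\<lambda>k\<in>{..<Suc n}. if k = 0 then t else R t * y k)\<bar> \<le> B" if t: "t \<in> S" and y: "?N y \<le> 1" for t y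
    proof -
      have "L2_set (\<lambda>j. scalar_product (Suc n) (?Q (pt t y)) (e j)) {1..n} = sqrt (\<Sum>j\<in>{1..n}. (R t * y j)\<^sup>2)"
        unfolding L2_set_def by (intro arg_cong[where f = sqrt] sum.cong refl) (simp add: coords pt_j)
      also have "\<dots> = R t * sqrt (?N y)"
        using R_nonneg[of t] by (simp add: power_mult_distrib real_sqrt_mult flip: sum_distrib_left)
      also have "\<dots> \<le> R t * 1" using y R_nonneg[of t] by (intro mult_left_mono) auto
      finally have "?Q (pt t y) \<in> K"
        using t S(3) from_coords_in_Rn unfolding K by (auto simp: coords pt_0 R_def)
      from B[OF this] show ?thesis by (simp only: G_def pt_def)
    qed
    show "R t \<le> sqrt (96 * n * c)" if "t \<in> S" for t
      using R_sq[OF that] by (rule real_le_rsqrt)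
    show "0 < sqrt (96 * n * c)" "0 < sqrt c" using \<open>0 < c\<close> n by auto
    show "(\<integral>\<^sup>+t. ennreal (t\<^sup>2) \<partial>\<nu>) \<le> ennreal ((sqrt c)\<^sup>2)"
      using \<open>0 < c\<close> by (simp add: axial_moment)
  qed
  have point: "point = pt" by (simp add: fun_eq_iff point_def pt_def)
  have \<Gamma>: "\<Gamma> x = (L2_set (grad (Suc n) f (?Q x)) {..<Suc n})\<^sup>2" for x
  proof -
    have "A k x = scalar_product (Suc n) (grad (Suc n) f (?Q x)) (e k)" for k
      by (simp add: A_def scalar_product_def grad_def del: sum.lessThan_Suc)
    moreover have "grad (Suc n) f (?Q x) \<in> Rn (Suc n)" by (auto simp: grad_def Rn_def)
    ultimately show ?thesis
      by (simp add: \<Gamma>_def sum_squares_scalar_products[OF e] L2_set_def sum_nonneg del: sum.lessThan_Suc)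
  qed
  define W where "W x = (L2_set (grad (Suc n) f x) {..<Suc n})\<^sup>2" for x
  have W_cont: "continuous_map (powertop_real {..<Suc n}) euclideanreal W"
  proof -
    have "W = (\<lambda>x. \<Sum>i<Suc n. ?P i x * ?P i x)"
      by (auto simp: W_def L2_set_def sum_nonneg grad_def power2_eq_square[symmetric] fun_eq_iff simp del: sum.lessThan_Suc)
    then show ?thesis by (auto simp del: sum.lessThan_Suc intro!: continuous_map_sum continuous_map_real_mult P_cont)
  qed
  have [measurable]: "f \<in> borel_measurable ?L" "W \<in> borel_measurable ?L"
    by (rule borel_measurable_continuous_map_PiM[OF f_cont] borel_measurable_continuous_map_PiM[OF W_cont])+
  have "ennreal (Var \<mu> f) \<le> osc \<mu> f"
  proof -
    obtain B' where "AE x in \<mu>. \<bar>f x\<bar> \<le> B'" using continuous_map_AE_bounded[OF f_cont] by blast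
    then show ?thesis
      unfolding Var_def by (intro variance_le_osc \<mu>.prob_space_axioms continuous_map_measurable f_cont)
  qed
  also have "osc \<mu> f = (\<integral>\<^sup>+t. ball_avg n (\<lambda>y. \<integral>\<^sup>+t'. ball_avg n (\<lambda>y'. ennreal ((G (point t y) - G (point t' y'))\<^sup>2)) \<partial>\<nu>) \<partial>\<nu>)"
  proof -
    have inner: "(\<integral>\<^sup>+y. ennreal ((a - f y)\<^sup>2) \<partial>\<mu>) = (\<integral>\<^sup>+t. ball_avg n (\<lambda>y. ennreal ((a - f (?Q (pt t y)))\<^sup>2)) \<partial>\<nu>)" for a
      by (rule law) measurable
    have "osc \<mu> f = (\<integral>\<^sup>+t. ball_avg n (\<lambda>y. \<integral>\<^sup>+x. ennreal ((f (?Q (pt t y)) - f x)\<^sup>2) \<partial>\<mu>) \<partial>\<nu>)"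
      unfolding osc_def by (rule law) measurable
    then show ?thesis unfolding inner by (simp only: point G_def)
  qed
  also have "\<dots> \<le> ennreal (16 * (64 * (sqrt c)\<^sup>2 + (sqrt (96 * n * c) / (real n + 1))\<^sup>2) + 200 * (sqrt (96 * n * c))\<^sup>2 / n)
      * (\<integral>\<^sup>+t. ball_avg n (\<lambda>y. ennreal (\<Gamma> (point t y))) \<partial>\<nu>)"
    by (rule revolution_osc)
  also have "(\<integral>\<^sup>+t. ball_avg n (\<lambda>y. ennreal (\<Gamma> (point t y))) \<partial>\<nu>) = (\<integral>\<^sup>+x. ennreal (W x) \<partial>\<mu>)"
    unfolding point \<Gamma> W_def[symmetric] by (rule law[symmetric]) measurable
  also have "\<dots> = ennreal (LINT x|\<mu>. W x)"
    by (intro nn_integral_eq_integral continuous_map_integrable W_cont) (simp add: W_def)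
  also have "ennreal (16 * (64 * (sqrt c)\<^sup>2 + (sqrt (96 * n * c) / (real n + 1))\<^sup>2) + 200 * (sqrt (96 * n * c))\<^sup>2 / n) * ennreal (LINT x|\<mu>. W x)
      \<le> ennreal (21760 * c) * ennreal (LINT x|\<mu>. W x)"
  proof (intro mult_right_mono ennreal_leI)
    have "(sqrt (96 * n * c) / (real n + 1))\<^sup>2 = 96 * c * (n / (real n + 1)\<^sup>2)"
      using \<open>0 < c\<close> by (simp add: power_divide)
    also have "\<dots> \<le> 96 * c * 1"
    proof (intro mult_left_mono)
      have "real n \<le> (real n + 1)\<^sup>2" by (simp add: power2_eq_square algebra_simps)
      then show "n / (real n + 1)\<^sup>2 \<le> 1" by (simp add: divide_le_eq_1)
    qed (use \<open>0 < c\<close> in simp)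
    finally have "16 * (64 * (sqrt c)\<^sup>2 + (sqrt (96 * n * c) / (real n + 1))\<^sup>2) \<le> 2560 * c" using \<open>0 < c\<close> by simp
    moreover have "200 * (sqrt (96 * n * c))\<^sup>2 / n = 19200 * c" using \<open>0 < c\<close> n by simp
    ultimately show "16 * (64 * (sqrt c)\<^sup>2 + (sqrt (96 * n * c) / (real n + 1))\<^sup>2) + 200 * (sqrt (96 * n * c))\<^sup>2 / n \<le> 21760 * c"
      by linarith
  qed simp
  also have "\<dots> = ennreal (21760 * c * (LINT x|\<mu>. W x))"
    using \<open>0 < c\<close> by (intro ennreal_mult[symmetric]) (auto simp: W_def)
  finally have "ennreal (Var \<mu> f) \<le> ennreal (21760 * c * (LINT x|\<mu>. W x))" .
  moreover have "0 \<le> (LINT x|\<mu>. W x)" by (simp add: W_def)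
  ultimately have "Var \<mu> f \<le> 21760 * c * (LINT x|\<mu>. W x)"
    using \<open>0 < c\<close> by (subst (asm) ennreal_le_iff) auto
  then show ?thesis unfolding W_def[abs_def] .
qed

theorem corollary8:
  shows "\<exists>C::real. \<forall>n\<ge>1. \<forall>K. convex_body_of_revolution n K \<and> isotropic (n + 1) K \<longrightarrow>
    poincare_constant (n + 1) (uniform_prob (n + 1) K)
      \<le> ereal (C * (LINT x|uniform_prob (n + 1) K. (L2_set x {..<n + 1})\<^sup>2) / real (n + 1))"
proof (intro exI allI impI)
  fix n :: nat and K assume n: "1 \<le> n" and "convex_body_of_revolution n K \<and> isotropic (n + 1) K"
  then have body: "convex_body_of_revolution n K" and iso: "isotropic (Suc n) K" by (auto simp: Suc_eq_plus1)
  let ?\<mu> = "uniform_prob (Suc n) K"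
  let ?A = "21760 * (LINT x|?\<mu>. (L2_set x {..<Suc n})\<^sup>2) / real (Suc n)"
  have compact_K: "compactin (powertop_real {..<Suc n}) K"
    using iso by (auto simp: isotropic_def convex_body_def)
  have "Var ?\<mu> f \<le> ?A * (LINT x|?\<mu>. (L2_set (grad (Suc n) f x) {..<Suc n})\<^sup>2)" if f: "smooth (Suc n) f" for f
  \<comment> \<open>For a degenerate mass both sides vanish.\<close>
  proof (cases "emeasure (lebesgue_Rn (Suc n)) K = 0 \<or> emeasure (lebesgue_Rn (Suc n)) K = \<infinity>")
    case True
    have "(LINT x|?\<mu>. g x) = 0" for g :: "_ \<Rightarrow> real"
      unfolding uniform_prob_def
      by (rule integral_degenerate_uniform_measure) (use True compactin_sets_PiM[OF compact_K] in \<open>auto simp: lebesgue_Rn_def\<close>)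
    then show ?thesis by (simp add: Var_def)
  next
    case False
    then have mass: "0 < emeasure (lebesgue_Rn (Suc n)) K" "emeasure (lebesgue_Rn (Suc n)) K < \<infinity>"
      by (auto simp: zero_less_iff_neq_zero less_top)
    interpret uniform_on_body "Suc n" K by unfold_locales (use compact_K mass in auto)
    obtain c where c: "\<And>\<theta>. \<theta> \<in> Rn (Suc n) \<Longrightarrow> L2_set \<theta> {..<Suc n} = 1 \<Longrightarrow> (LINT x|?\<mu>. (scalar_product (Suc n) x \<theta>)\<^sup>2) = c"
      using iso unfolding isotropic_def by blast
    have "?A = 21760 * c" using trace_covariance[OF c] by simp
    then show ?thesis using revolution_variance_bound[OF n body mass c f] by simp
  qed
  then have "poincare_constant (Suc n) ?\<mu> \<le> ereal ?A"
    unfolding poincare_constant_def by (intro Inf_lower imageI) auto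
  then show "poincare_constant (n + 1) (uniform_prob (n + 1) K)
      \<le> ereal (21760 * (LINT x|uniform_prob (n + 1) K. (L2_set x {..<n + 1})\<^sup>2) / real (n + 1))"
    by (simp only: Suc_eq_plus1)
qed

end
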